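(* Let $1<p<\infty$, $T>0$, and let $\Theta\subset\mathbb{R}^l$ be a compact set. Let $F_0,F_1,\dots,F_k:\mathbb{R}^d\times\Theta\to\mathbb{R}^d$ be such that, for some $L>0$, $$\sup_{i=0,\dots,k}|F_i(x_1,\theta_1)-F_i(x_2,\theta_2)|_2\le L\big(|x_1-x_2|_2+|x_1+x_2|_2\,|\theta_1-\theta_2|_2\big)$$ for all $(x_1,\theta_1),(x_2,\theta_2)\in\mathbb{R}^d\times\Theta$; let $x_0:\Theta\to\mathbb{R}^d$ be continuous; let $a:\mathbb{R}^d\times\Theta\to[0,+\infty)$ be continuous; and let $f:[0,T]\times\mathbb{R}^k\to\mathbb{R}$ satisfy: (i) $f(\cdot,u)$ is measurable for every $u\in\mathbb{R}^k$; (ii) $f(t,\cdot)$ is continuous and convex for a.e. $t\in[0,T]$; (iii) there exist $c\in L^1([0,T],[0,+\infty))$ and $C>0$ such that $f(t,u)\ge C|u|_2^p-c(t)$ for a.e. $t\in[0,T]$ and every $u\in\mathbb{R}^k$; (iv) there exist $u'\in\mathbb{R}^k$ and $c'\in L^1([0,T],[0,+\infty))$ such that $|f(t,u')|\le c'(t)$ for a.e. $t\in[0,T]$. Suppose in addition that $f(t,\cdot)$ is strictly convex for a.e. $t\in[0,T]$. For every $N\in\mathbb{N}\cup\{+\infty\}$ let $\Theta^N\subseteq\Theta$ be a nonempty compact set, and assume $d_H(\Theta^N,\Theta^\infty)\to0$ as $N\to\infty$. Let $\mathcal{J}^N$ and the ball $\mathcal{X}\subset\mathcal{U}=L^p([0,T],\mathbb{R}^k)$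 be as defined in the context, and consider $\mathcal{J}^N$ restricted to $\mathcal{X}$. For every $N\in\mathbb{N}$ let $u_N^*\in\mathcal{X}$ be a minimizer of $\mathcal{J}^N$. Then the sequence $(u_N^* )_{N\in\mathbb{N}}$ is pre-compact in the strong topology of $L^p$, and every limiting point is a minimizer of $\mathcal{J}^\infty$.
   Context: Write $F=(F_1,\dots,F_k):\mathbb{R}^d\times\Theta\to\mathbb{R}^{d\times k}$. For $u\in\mathcal{U}$ and $\theta\in\Theta$, $x_u^\theta:[0,T]\to\mathbb{R}^d$ denotes the (Carathéodory, absolutely continuous) solution of $\dot x(t)=F_0(x(t),\theta)+F(x(t),\theta)u(t)$ for a.e. $t\in[0,T]$, $x(0)=x_0(\theta)$, and $X_u(t,\theta):=x_u^\theta(t)$. For $N\in\mathbb{N}\cup\{+\infty\}$, with $\mathbb{N}=\{1,2,\dots\}$, $\mathcal{J}^N:\mathcal{U}\to\mathbb{R}\cup\{+\infty\}$ is $$\mathcal{J}^N(u):=\max_{\theta\in\Theta^N}a(X_u(T,\theta),\theta)+\int_0^Tf(t,u(t))\,dt.$$ $\mathcal{X}:=\{u\in\mathcal{U}:\|u\|_{L^p}\le\rho\}$, where $\rho>0$ is a constant such that every $u^*\in\arg\min_{\mathcal{U}}\mathcal{J}^N$, for every $N\in\mathbb{N}\cup\{+\infty\}$, satisfies $\|u^*\|_{L^p}\le\rho$. Hausdorff distance: $d_H(A,B):=\max\{\sup_{a\in A}\inf_{b\in B}|a-b|_2,\ \sup_{b\in B}\inf_{a\in A}|b-a|_2\}$.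 *)

theory Defs
  imports "HOL-Analysis.Analysis"
begin

section \<open>The spaces $L^p([0,T],\mathbb{R}^k)$\<close>

text \<open>
  Elements of \<open>L\<^sup>p\<close> are handled through representatives: \<open>Lp_fun p T\<close> is a set of functions, not of
  classes modulo a.e. equality, and \<open>Lp_norm p T\<close> is a seminorm on it. Values outside
  \<open>[0,T]\<close> are irrelevant.
\<close>

definition Lp_fun :: "real \<Rightarrow> real \<Rightarrow> (real \<Rightarrow> 'a::euclidean_space) set" where
  "Lp_fun p T = {u. u \<in> borel_measurable (lebesgue_on {0..T}) \<and>
                    integrable (lebesgue_on {0..T}) (\<lambda>t. norm (u t) powr p)}"

definition Lp_norm :: "real \<Rightarrow> real \<Rightarrow> (real \<Rightarrow> 'a::euclidean_space) \<Rightarrow> real" where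
  "Lp_norm p T u = (LINT t|lebesgue_on {0..T}. norm (u t) powr p) powr (1 / p)"

text \<open>
  The strong topology is the topology of the seminorm. It is the pullback of the topology of the
  quotient by a.e. equality, so compactness, and compactness of closures, mean the same for sets
  of representatives as for the corresponding sets of classes.
\<close>

definition Lp_topology :: "real \<Rightarrow> real \<Rightarrow> (real \<Rightarrow> 'a::euclidean_space) topology" where
  "Lp_topology p T = topology (\<lambda>S. S \<subseteq> Lp_fun p T \<and>
     (\<forall>u\<in>S. \<exists>e>0. \<forall>v\<in>Lp_fun p T. Lp_norm p T (\<lambda>t. v t - u t) < e \<longrightarrow> v \<in> S))"

lemma openin_Lp_topology:
  fixes S :: "(real \<Rightarrow> 'a::euclidean_space) set"
  shows "openin (Lp_topology p T) S \<longleftrightarrow> S \<subseteq> Lp_fun p T \<and>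
     (\<forall>u\<in>S. \<exists>e>0. \<forall>v\<in>Lp_fun p T. Lp_norm p T (\<lambda>t. v t - u t) < e \<longrightarrow> v \<in> S)"
proof -
  let ?P = "\<lambda>S :: (real \<Rightarrow> 'a) set. S \<subseteq> Lp_fun p T \<and>
     (\<forall>u\<in>S. \<exists>e>0. \<forall>v\<in>Lp_fun p T. Lp_norm p T (\<lambda>t. v t - u t) < e \<longrightarrow> v \<in> S)"
  have "?P (S \<inter> S')" if S: "?P S" and S': "?P S'" for S S'
  proof (intro conjI ballI)
    fix u assume u: "u \<in> S \<inter> S'"
    obtain e where e: "e > 0" "\<forall>v\<in>Lp_fun p T. Lp_norm p T (\<lambda>t. v t - u t) < e \<longrightarrow> v \<in> S"
      using S u by blast
    obtain e' where e': "e' > 0" "\<forall>v\<in>Lp_fun p T. Lp_norm p T (\<lambda>t. v t - u t) < e' \<longrightarrow> v \<in> S'"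
      using S' u by blast
    show "\<exists>e>0. \<forall>v\<in>Lp_fun p T. Lp_norm p T (\<lambda>t. v t - u t) < e \<longrightarrow> v \<in> S \<inter> S'"
      using e e' by (intro exI[of _ "min e e'"]) auto
  qed (use S in blast)
  moreover have "?P (\<Union>K)" if "\<forall>S\<in>K. ?P S" for K
    using that by (meson Sup_le_iff UnionE UnionI)
  ultimately have "istopology ?P"
    unfolding istopology_def by blast
  then show ?thesis
    unfolding Lp_topology_def by (simp only: topology_inverse')
qed

lemma topspace_Lp_topology [simp]: "topspace (Lp_topology p T) = Lp_fun p T"
proof
  show "topspace (Lp_topology p T) \<subseteq> Lp_fun p T"
    by (auto simp: topspace_def openin_Lp_topology)
  have "openin (Lp_topology p T) (Lp_fun p T)"
    by (auto simp: openin_Lp_topology intro: exI[of _ 1])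
  then show "Lp_fun p T \<subseteq> topspace (Lp_topology p T)"
    by (rule openin_subset)
qed

section \<open>The controlled ensemble\<close>

text \<open>
  Every member of a division is a compact interval, with end points \<open>Inf K \<le> Sup K\<close>, and distinct
  members have disjoint interiors.
\<close>

definition absolutely_continuous_fun :: "real \<Rightarrow> real \<Rightarrow> (real \<Rightarrow> 'a::real_normed_vector) \<Rightarrow> bool" where
  "absolutely_continuous_fun a b x \<longleftrightarrow>
     (\<forall>e>0. \<exists>d>0. \<forall>D S. D division_of S \<and> S \<subseteq> {a..b} \<and> (\<Sum>K\<in>D. Sup K - Inf K) < d \<longrightarrow>
        (\<Sum>K\<in>D. norm (x (Sup K) - x (Inf K))) < e)"

definition field_matrix ::
    "('k \<Rightarrow> real^'d \<Rightarrow> real^'l \<Rightarrow> real^'d) \<Rightarrow> real^'d \<Rightarrow> real^'l \<Rightarrow> real^'k^'d" where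
  "field_matrix F x \<theta> = (\<chi> j i. F i x \<theta> $ j)"

definition caratheodory_solution ::
    "real \<Rightarrow> (real^'d \<Rightarrow> real^'l \<Rightarrow> real^'d) \<Rightarrow> ('k::finite \<Rightarrow> real^'d \<Rightarrow> real^'l \<Rightarrow> real^'d) \<Rightarrow>
     (real^'l \<Rightarrow> real^'d) \<Rightarrow> (real \<Rightarrow> real^'k) \<Rightarrow> real^'l \<Rightarrow> (real \<Rightarrow> real^'d) \<Rightarrow> bool" where
  "caratheodory_solution T F0 F x0 u \<theta> x \<longleftrightarrow>
     absolutely_continuous_fun 0 T x \<and> x 0 = x0 \<theta> \<and>
     (AE t in lebesgue_on {0..T}.
        (x has_vector_derivative (F0 (x t) \<theta> + field_matrix F (x t) \<theta> *v u t))
          (at t within {0..T}))"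

text \<open>Only the values on \<open>[0,T]\<close> of the chosen solution are meaningful.\<close>

definition trajectory ::
    "real \<Rightarrow> (real^'d \<Rightarrow> real^'l \<Rightarrow> real^'d) \<Rightarrow> ('k::finite \<Rightarrow> real^'d \<Rightarrow> real^'l \<Rightarrow> real^'d) \<Rightarrow>
     (real^'l \<Rightarrow> real^'d) \<Rightarrow> (real \<Rightarrow> real^'k) \<Rightarrow> real \<Rightarrow> real^'l \<Rightarrow> real^'d" where
  "trajectory T F0 F x0 u t \<theta> = (SOME x. caratheodory_solution T F0 F x0 u \<theta> x) t"

section \<open>The functionals\<close>

text \<open>
  The Lebesgue integral of a function whose negative part is integrable; it may be \<open>+\<infinity>\<close>.
\<close>

definition extended_integral :: "'a measure \<Rightarrow> ('a \<Rightarrow> real) \<Rightarrow> ereal" where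
  "extended_integral M g =
     enn2ereal (\<integral>\<^sup>+x. ennreal (g x) \<partial>M) - enn2ereal (\<integral>\<^sup>+x. ennreal (- g x) \<partial>M)"

text \<open>
  Over a nonempty compact parameter set \<open>S\<close>, with continuous end-point cost and continuous
  dependence of the trajectories on the parameter, the supremum is a maximum.
\<close>

definition ensemble_cost ::
    "real \<Rightarrow> (real^'d \<Rightarrow> real^'l \<Rightarrow> real^'d) \<Rightarrow> ('k::finite \<Rightarrow> real^'d \<Rightarrow> real^'l \<Rightarrow> real^'d) \<Rightarrow>
     (real^'l \<Rightarrow> real^'d) \<Rightarrow> (real^'d \<Rightarrow> real^'l \<Rightarrow> real) \<Rightarrow> (real \<Rightarrow> real^'k \<Rightarrow> real) \<Rightarrow>
     (real^'l) set \<Rightarrow> (real \<Rightarrow> real^'k) \<Rightarrow> ereal" where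
  "ensemble_cost T F0 F x0 a f S u =
     (SUP \<theta>\<in>S. ereal (a (trajectory T F0 F x0 u T \<theta>) \<theta>)) +
     extended_integral (lebesgue_on {0..T}) (\<lambda>t. f t (u t))"

section \<open>Auxiliary notions\<close>

definition strictly_convex :: "('a::real_vector \<Rightarrow> real) \<Rightarrow> bool" where
  "strictly_convex g \<longleftrightarrow>
     (\<forall>x y s. x \<noteq> y \<longrightarrow> 0 < s \<longrightarrow> s < 1 \<longrightarrow>
        g ((1 - s) *\<^sub>R x + s *\<^sub>R y) < (1 - s) * g x + s * g y)"

definition hausdorff_distance :: "'a::real_normed_vector set \<Rightarrow> 'a set \<Rightarrow> real" where
  "hausdorff_distance A B =
     max (SUP a\<in>A. INF b\<in>B. norm (a - b)) (SUP b\<in>B. INF a\<in>A. norm (b - a))"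

end

theory Submission
  imports Defs "HOL-Complex_Analysis.Great_Picard"
begin

text \<open>
  The weak topology of \<open>L\<^sup>p\<close> is avoided. On a ball of \<open>L\<^sup>p\<close> the primitives of the controls form an
  equicontinuous family, and the trajectories, hence the end-point costs, are uniformly continuous
  functions of the primitive, uniformly in the parameter. Along a subsequence of almost minimizers
  with uniformly convergent primitives, comparison of two members with their midpoint shows that
  the mean gap in the convexity inequality of \<open>f\<close> tends to \<open>0\<close>. Strict convexity turns this into
  convergence in \<open>L\<^sup>1\<close>; comparison with the limit then gives convergence of the running costs, and
  the coercivity of \<open>f\<close> upgrades the convergence to \<open>L\<^sup>p\<close>. Applied to a minimizing sequence of the
  limit functional, the argument provides a global minimizer, which lies in the ball by the choice
  of its radius, so that the minima over the ball are finite. The limit points are identified by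
  Fatou's lemma.
\<close>

section \<open>Absolutely continuous functions\<close>

text \<open>If no control in the ball had finite cost, every element of \<open>\<X>\<close> would be
  a minimizer and precompactness would have no reason to hold. The constant control
  \<open>u'\<close> has finite cost but may lie outside the ball. Existence of a global minimizer is
  therefore proved on the way, and the compactness theorem is stated for almost minimizers: a
  minimizing sequence of one functional and minimizers of varying functionals are two instances of
  it. Two controls are always compared under the same functional. What compactness asks of the
  functionals is thus a modulus of continuity of the end-point costs that is uniform over all
  nonempty sets of parameters; Hausdorff convergence serves to identify the limit points.
  Trajectories are chosen by \<open>SOME\<close>, so one knows of them an initial value, absolute
  continuity and a prescribed a.e. derivative. Gronwall and Picard arguments need an integral
  equation instead, and the passage rests on the fundamental theorem of calculus for absolutely
  continuous functions.\<close>

lemma absolutely_continuous_funE: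
  assumes "absolutely_continuous_fun a b x" "e > 0"
  obtains d where "d > 0" "\<And>D S. D division_of S \<Longrightarrow> S \<subseteq> {a..b} \<Longrightarrow> (\<Sum>K\<in>D. Sup K - Inf K) < d
      \<Longrightarrow> (\<Sum>K\<in>D. norm (x (Sup K) - x (Inf K))) < e"
proof -
  obtain d where "d > 0" "\<forall>D S. D division_of S \<and> S \<subseteq> {a..b} \<and> (\<Sum>K\<in>D. Sup K - Inf K) < d \<longrightarrow>
        (\<Sum>K\<in>D. norm (x (Sup K) - x (Inf K))) < e"
    using assms(1)[unfolded absolutely_continuous_fun_def, rule_format, OF assms(2)] by (elim exE conjE)
  then show thesis by (intro that[of d]) blast+
qed

lemma absolutely_continuous_fun_imp_continuous_on:
  fixes x :: "real \<Rightarrow> 'a::real_normed_vector"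
  assumes "absolutely_continuous_fun a b x"
  shows "continuous_on {a..b} x"
proof (unfold continuous_on_iff, intro ballI allI impI)
  fix t e :: real assume t: "t \<in> {a..b}" and e: "e > 0"
  obtain d where d: "d > 0" "\<And>D S. D division_of S \<Longrightarrow> S \<subseteq> {a..b} \<Longrightarrow> (\<Sum>K\<in>D. Sup K - Inf K) < d
      \<Longrightarrow> (\<Sum>K\<in>D. norm (x (Sup K) - x (Inf K))) < e"
    by (rule absolutely_continuous_funE[OF assms e]) (rule that)
  have *: "norm (x s - x r) < e" if "r \<le> s" "r \<in> {a..b}" "s \<in> {a..b}" "s - r < d" for r s
  proof -
    have "{{r..s}} division_of {r..s}"
      using that division_of_self[of r s] by simp
    from d(2)[OF this] that show ?thesis by auto
  qed
  show "\<exists>d>0. \<forall>s\<in>{a..b}. dist s t < d \<longrightarrow> dist (x s) (x t) < e"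
  proof (intro exI[of _ d] conjI ballI impI)
    fix s assume s: "s \<in> {a..b}" "dist s t < d"
    show "dist (x s) (x t) < e"
      using *[of t s] *[of s t] s t
      by (cases "t \<le> s") (auto simp: dist_norm norm_minus_commute abs_if split: if_splits)
  qed (fact d(1))
qed

text \<open>One comparison covers restriction to a subinterval (\<open>y = x\<close>,
  \<open>M = 1\<close>), a change by an additive constant, and composition with a Lipschitz
  map.\<close>

lemma absolutely_continuous_fun_dominated:
  fixes x :: "real \<Rightarrow> 'a::real_normed_vector" and y :: "real \<Rightarrow> 'b::real_normed_vector"
  assumes x: "absolutely_continuous_fun a b x"
    and sub: "{a'..b'} \<subseteq> {a..b}"
    and y: "\<And>r s. r \<in> {a'..b'} \<Longrightarrow> s \<in> {a'..b'} \<Longrightarrow> norm (y r - y s) \<le> M * norm (x r - x s)"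
  shows "absolutely_continuous_fun a' b' y"
  unfolding absolutely_continuous_fun_def
proof (intro allI impI)
  fix e :: real assume e: "e > 0"
  \<comment> \<open>\<open>M\<close> may be zero or negative, while \<open>e / M'\<close> needs a
    positive divisor.\<close>
  define M' where "M' = max M 1"
  have M': "M' > 0" "M \<le> M'" by (auto simp: M'_def)
  obtain d where d: "d > 0" "\<And>D S. D division_of S \<Longrightarrow> S \<subseteq> {a..b} \<Longrightarrow> (\<Sum>K\<in>D. Sup K - Inf K) < d
      \<Longrightarrow> (\<Sum>K\<in>D. norm (x (Sup K) - x (Inf K))) < e / M'"
    by (rule absolutely_continuous_funE[OF x divide_pos_pos[OF e M'(1)]]) (rule that)
  show "\<exists>d>0. \<forall>D S. D division_of S \<and> S \<subseteq> {a'..b'} \<and> (\<Sum>K\<in>D. Sup K - Inf K) < d \<longrightarrow>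
      (\<Sum>K\<in>D. norm (y (Sup K) - y (Inf K))) < e"
  proof (intro exI[of _ d] conjI allI impI)
    fix D S assume D: "D division_of S \<and> S \<subseteq> {a'..b'} \<and> (\<Sum>K\<in>D. Sup K - Inf K) < d"
    have "(\<Sum>K\<in>D. norm (y (Sup K) - y (Inf K))) \<le> (\<Sum>K\<in>D. M' * norm (x (Sup K) - x (Inf K)))"
    proof (rule sum_mono)
      fix K assume K: "K \<in> D"
      then obtain u v where uv: "K = {u..v}" "u \<le> v"
        using D by (metis atLeastatMost_empty_iff2 box_real(2) division_ofD(3,4) not_le linorder_not_le)
      then have "u \<in> {a'..b'}" "v \<in> {a'..b'}"
        using D K division_ofD(2)[of D S K] by (meson atLeastAtMost_iff order_refl subsetD)+
      then have "norm (y (Sup K) - y (Inf K)) \<le> M * norm (x (Sup K) - x (Inf K))"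
        using y uv by simp
      then show "norm (y (Sup K) - y (Inf K)) \<le> M' * norm (x (Sup K) - x (Inf K))"
        using M' by (meson mult_right_mono norm_ge_zero order_trans)
    qed
    also have "\<dots> = M' * (\<Sum>K\<in>D. norm (x (Sup K) - x (Inf K)))"
      by (simp add: sum_distrib_left)
    also have "\<dots> < e"
      using d(2)[of D S] D M' order_trans[OF _ sub, of S] by (simp add: field_simps)
    finally show "(\<Sum>K\<in>D. norm (y (Sup K) - y (Inf K))) < e" .
  qed (fact d(1))
qed

text \<open>
  The exceptional null set is covered by an open set of small measure: the intervals of a fine
  tagged division with tag in the exceptional set contribute little to the increment of \<open>x\<close> by
  absolute continuity.
\<close>

theorem fundamental_theorem_of_calculus_absolutely_continuous:
  fixes x :: "real \<Rightarrow> 'a::banach"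
  assumes ab: "a \<le> b" and ac: "absolutely_continuous_fun a b x" and N: "negligible N"
    and deriv: "\<And>t. t \<in> {a..b} - N \<Longrightarrow> (x has_vector_derivative g t) (at t within {a..b})"
  shows "(g has_integral (x b - x a)) {a..b}"
proof -
  \<comment> \<open>On the null set the values of \<open>g\<close> are arbitrary and would spoil the
    Riemann sums. They are set to 0 and restored at the end, where a negligible set does not
    matter.\<close>
  define h where "h t = (if t \<in> N then 0 else g t)" for t
  have "(h has_integral (x b - x a)) (cbox a b)"
    unfolding has_integral
  proof (intro allI impI)
    fix e :: real assume e: "e > 0"
    \<comment> \<open>The summand 1 covers \<open>a = b\<close> and makes the second bound
      strict.\<close>
    define e1 where "e1 = e / (2 * (b - a + 1))"
    have e1: "e1 > 0" "e1 * (b - a) < e / 2"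
      using e ab by (auto simp: e1_def field_simps)
    obtain d where d: "d > 0" "\<And>D S. D division_of S \<Longrightarrow> S \<subseteq> {a..b} \<Longrightarrow> (\<Sum>K\<in>D. Sup K - Inf K) < d
      \<Longrightarrow> (\<Sum>K\<in>D. norm (x (Sup K) - x (Inf K))) < e / 2"
      by (rule absolutely_continuous_funE[OF ac half_gt_zero[OF e]]) (rule that)
    have "N \<in> sets lebesgue" using N negligible_imp_sets by blast
    then obtain U where U: "open U" "N \<subseteq> U" "U - N \<in> lmeasurable" "emeasure lebesgue (U - N) < ennreal d"
      using sets_lebesgue_outer_open d(1) by meson
    have Ulm: "U \<in> lmeasurable"
      using U N by (metis Diff_partition Un_commute fmeasurable.Un negligible_imp_measurable)
    have "measure lebesgue U = measure lebesgue (U - N)"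
      using N U(2) Ulm by (metis fmeasurableD measure_Diff_null_set negligible_iff_null_sets)
    then have Um: "measure lebesgue U < d"
      using U(3,4) d(1) by (simp add: emeasure_eq_measure2 ennreal_less_iff)
    have "\<exists>r>0. \<forall>s\<in>{a..b}. norm (s - t) < r \<longrightarrow> norm (x s - x t - (s - t) *\<^sub>R g t) \<le> e1 * norm (s - t)"
      if "t \<in> {a..b} - N" for t
      using deriv[OF that] e1(1) unfolding has_vector_derivative_def has_derivative_within_alt by blast
    then obtain r where r: "\<And>t. t \<in> {a..b} - N \<Longrightarrow> r t > 0"
      "\<And>t s. t \<in> {a..b} - N \<Longrightarrow> s \<in> {a..b} \<Longrightarrow> norm (s - t) < r t \<Longrightarrow>
         norm (x s - x t - (s - t) *\<^sub>R g t) \<le> e1 * norm (s - t)"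
      by metis
    define \<gamma> where "\<gamma> t = (if t \<in> N then U else if t \<in> {a..b} then ball t (r t) else UNIV)" for t
    have "gauge \<gamma>"
      using U r(1) by (auto simp: gauge_def \<gamma>_def)
    moreover have main: "norm ((\<Sum>(t, K)\<in>p. measure lborel K *\<^sub>R h t) - (x b - x a)) < e"
      if p: "p tagged_division_of cbox a b" and fine: "\<gamma> fine p" for p
    proof -
      have pf: "finite p" using p by blast
      define w where "w K = x (Sup K) - x (Inf K)" for K
      have K: "\<exists>u v. K = {u..v} \<and> u \<le> v \<and> t \<in> {u..v} \<and> {u..v} \<subseteq> {a..b} \<and> measure lborel K = v - u \<and> w K = x v - x u"
        if tK: "(t, K) \<in> p" for t K
      proof -
        obtain u v where "K = cbox u v" "t \<in> K" "K \<subseteq> cbox a b"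
          using tagged_division_ofD(2-4)[OF p tK] by blast
        then show ?thesis by (intro exI[of _ u] exI[of _ v]) (auto simp: w_def)
      qed
      define p1 p2 where "p1 = {z \<in> p. fst z \<in> N}" and "p2 = {z \<in> p. fst z \<notin> N}"
      have split: "p = p1 \<union> p2" "p1 \<inter> p2 = {}" "finite p1" "finite p2"
        using pf by (auto simp: p1_def p2_def)
      have "(\<Sum>(t, K)\<in>p. measure lborel K *\<^sub>R h t) - (x b - x a) = (\<Sum>(t, K)\<in>p. measure lborel K *\<^sub>R h t - w K)"
        using additive_tagged_division_1[OF ab, of p x] p
        by (simp add: sum_subtractf case_prod_unfold w_def)
      also have "\<dots> = (\<Sum>(t, K)\<in>p1. measure lborel K *\<^sub>R h t - w K) + (\<Sum>(t, K)\<in>p2. measure lborel K *\<^sub>R h t - w K)"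
        using split by (simp add: sum.union_disjoint)
      also have "norm \<dots> \<le> (\<Sum>(t, K)\<in>p1. norm (w K)) + (\<Sum>(t, K)\<in>p2. e1 * measure lborel K)"
      proof (intro norm_triangle_mono)
        have "norm (\<Sum>(t, K)\<in>p1. measure lborel K *\<^sub>R h t - w K) \<le> (\<Sum>z\<in>p1. norm (case z of (t, K) \<Rightarrow> measure lborel K *\<^sub>R h t - w K))"
          by (rule norm_sum)
        also have "\<dots> = (\<Sum>(t, K)\<in>p1. norm (w K))"
          by (intro sum.cong) (auto simp: p1_def h_def)
        finally show "norm (\<Sum>(t, K)\<in>p1. measure lborel K *\<^sub>R h t - w K) \<le> (\<Sum>(t, K)\<in>p1. norm (w K))" .
        have "norm (\<Sum>(t, K)\<in>p2. measure lborel K *\<^sub>R h t - w K) \<le> (\<Sum>z\<in>p2. norm (case z of (t, K) \<Rightarrow> measure lborel K *\<^sub>R h t - w K))"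
          by (rule norm_sum)
        also have "\<dots> \<le> (\<Sum>(t, K)\<in>p2. e1 * measure lborel K)"
        proof (rule sum_mono, clarify)
          fix t K assume "(t, K) \<in> p2"
          then have tK: "(t, K) \<in> p" "t \<notin> N" by (auto simp: p2_def)
          obtain u v where uv: "K = {u..v}" "u \<le> v" "t \<in> {u..v}" "{u..v} \<subseteq> {a..b}" "measure lborel K = v - u" "w K = x v - x u"
            using K[OF tK(1)] by blast
          have "K \<subseteq> \<gamma> t" using fine tK(1) by (auto simp: fine_def)
          then have sub: "K \<subseteq> ball t (r t)" using tK uv by (auto simp: \<gamma>_def split: if_splits)
          have t: "t \<in> {a..b} - N" using uv tK by auto
          have "u \<in> ball t (r t)" "v \<in> ball t (r t)"
            using sub uv(2) unfolding uv(1) by (meson atLeastAtMost_iff order_refl subsetD)+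
          then have inc: "norm (x u - x t - (u - t) *\<^sub>R g t) \<le> e1 * norm (u - t)"
            "norm (x v - x t - (v - t) *\<^sub>R g t) \<le> e1 * norm (v - t)"
            using r(2)[OF t, of u] r(2)[OF t, of v] uv by (auto simp: dist_norm norm_minus_commute)
          \<comment> \<open>Straddle argument: the increment is split at the tag \<open>t\<close>,
            which lies between \<open>u\<close> and \<open>v\<close>, so the two errors add up to
            \<open>e1 * (v - u)\<close> exactly.\<close>
          moreover have "measure lborel K *\<^sub>R h t - w K =
             (x u - x t - (u - t) *\<^sub>R g t) - (x v - x t - (v - t) *\<^sub>R g t)"
            using tK uv by (simp add: h_def algebra_simps)
          ultimately have "norm (measure lborel K *\<^sub>R h t - w K) \<le> e1 * norm (u - t) + e1 * norm (v - t)"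
            by (simp only:) (rule order_trans[OF norm_triangle_ineq4 add_mono[OF inc]])
          also have "\<dots> = e1 * measure lborel K"
            using uv by (simp add: algebra_simps)
          finally show "norm (measure lborel K *\<^sub>R h t - w K) \<le> e1 * measure lborel K" .
        qed
        finally show "norm (\<Sum>(t, K)\<in>p2. measure lborel K *\<^sub>R h t - w K) \<le> (\<Sum>(t, K)\<in>p2. e1 * measure lborel K)" .
      qed
      also have "(\<Sum>(t, K)\<in>p2. e1 * measure lborel K) < e / 2"
      proof -
        have "(\<Sum>(t, K)\<in>p2. e1 * measure lborel K) \<le> (\<Sum>(t, K)\<in>p. e1 * measure lborel K)"
          using split pf e1(1) by (intro sum_mono2) auto
        also have "\<dots> = e1 * (\<Sum>(t, K)\<in>p. measure lborel K)"
          by (simp add: sum_distrib_left case_prod_unfold)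
        also have "\<dots> = e1 * (b - a)"
          using additive_content_tagged_division[OF p] ab by simp
        finally show ?thesis using e1(2) by simp
      qed
      also have "(\<Sum>(t, K)\<in>p1. norm (w K)) < e / 2"
      proof -
        have p1: "p1 tagged_division_of (\<Union>(snd ` p1))"
        proof (rule tagged_partial_division_of_Union_self)
          show "p1 tagged_partial_division_of cbox a b"
            using p split(1) by (metis Un_upper1 tagged_division_of_def tagged_partial_division_subset)
        qed
        have div: "snd ` p1 division_of \<Union>(snd ` p1)"
          by (rule division_of_tagged_division[OF p1])
        have sub: "\<Union>(snd ` p1) \<subseteq> {a..b}" "\<Union>(snd ` p1) \<subseteq> U"
          using K fine by (fastforce simp: p1_def fine_def \<gamma>_def)+
        have nonempty: "K \<noteq> {}" if "(t, K) \<in> p1" for t K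
          using that K[of t K] by (auto simp: p1_def)
        \<comment> \<open>To pass from tagged pairs to intervals the summand must vanish on every
          interval with empty interior. \<open>Sup {}\<close> and \<open>Inf {}\<close> carry no
          information, so the empty interval gets the value 0 by definition.\<close>
        define w' where "w' K = (if K = {} then 0 else norm (w K))" for K
        have "(\<Sum>(t, K)\<in>p1. norm (w K)) = (\<Sum>(t, K)\<in>p1. w' K)"
          by (intro sum.cong) (auto simp: w'_def dest: nonempty)
        also have "\<dots> = (\<Sum>K\<in>snd ` p1. w' K)"
        proof (rule sum.over_tagged_division_lemma[OF p1])
          fix u v :: real assume "box u v = {}"
          then show "w' (cbox u v) = 0"
            by (cases "u = v") (auto simp: w'_def w_def)
        qed
        also have "\<dots> = (\<Sum>K\<in>snd ` p1. norm (x (Sup K) - x (Inf K)))"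
          by (intro sum.cong) (auto simp: w'_def w_def dest: nonempty)
        also have "\<dots> < e / 2"
        proof (rule d(2)[OF div sub(1)])
          have "(\<Sum>K\<in>snd ` p1. Sup K - Inf K) = (\<Sum>K\<in>snd ` p1. measure lebesgue K)"
            using K by (intro sum.cong) (fastforce simp: p1_def)+
          also have "\<dots> = measure lebesgue (\<Union>(snd ` p1))"
            using content_division[OF div] .
          also have "\<dots> \<le> measure lebesgue U"
            using sub(2) Ulm div by (intro measure_mono_fmeasurable) (auto dest: lmeasurable_division)
          finally show "(\<Sum>K\<in>snd ` p1. Sup K - Inf K) < d" using Um by simp
        qed
        finally show ?thesis .
      qed
      finally show ?thesis by simp
    qed
    ultimately show "\<exists>\<gamma>. gauge \<gamma> \<and> (\<forall>p. p tagged_division_of cbox a b \<and> \<gamma> fine p \<longrightarrow>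
        norm ((\<Sum>(t, K)\<in>p. measure lborel K *\<^sub>R h t) - (x b - x a)) < e)" by (intro exI[of _ \<gamma>] conjI allI impI main) (auto simp only:)
  qed
  then show ?thesis
    using has_integral_spike[OF N, of "{a..b}" g h] by (simp add: h_def)
qed

text \<open>The differentiation theorem that is used concerns averages over
  \<open>{t..t + h}\<close> only. Applied to the reflected function
  \<open>\<lambda>s. g (- s)\<close> it yields the averages to the left of \<open>t\<close>; the
  second exceptional set is reflected back.\<close>

lemma indefinite_integral_has_vector_derivative_AE:
  fixes f :: "real \<Rightarrow> 'a::euclidean_space"
  assumes f: "f integrable_on {a..b}"
  obtains N where "negligible N"
    "\<And>t. t \<in> {a..b} - N \<Longrightarrow> ((\<lambda>t. integral {a..t} f) has_vector_derivative f t) (at t within {a..b})"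
proof -
  \<comment> \<open>Extension by 0 makes the averages at points near the end points of
    \<open>{a..b}\<close> meaningful.\<close>
  define g where "g t = (if t \<in> {a..b} then f t else 0)" for t
  have "g integrable_on UNIV"
    using f unfolding g_def by (simp only: integrable_restrict_UNIV)
  then have gi: "g integrable_on cbox u v" for u v
    using integrable_on_subcbox by blast
  have gi': "(\<lambda>t. g (- t)) integrable_on cbox u v" for u v :: real
    using gi[of "- v" "- u"] Henstock_Kurzweil_Integration.integrable_reflect_real[where f=g and a="-v" and b="-u"] by simp
  obtain N1 where N1: "negligible N1"
    "\<And>t e. t \<notin> N1 \<Longrightarrow> 0 < e \<Longrightarrow> \<exists>d>0. \<forall>h. 0 < h \<and> h < d \<longrightarrow>
       norm (integral {t..t + h} g /\<^sub>R h - g t) < e"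
    using integrable_ccontinuous_explicit[where f=g, OF gi] by auto
  obtain N2 where N2: "negligible N2"
    "\<And>t e. t \<notin> N2 \<Longrightarrow> 0 < e \<Longrightarrow> \<exists>d>0. \<forall>h. 0 < h \<and> h < d \<longrightarrow>
       norm (integral {t..t + h} (\<lambda>s. g (- s)) /\<^sub>R h - g (- t)) < e"
    using integrable_ccontinuous_explicit[where f="\<lambda>s. g (- s)", OF gi'] by auto
  define N where "N = N1 \<union> uminus ` N2"
  have "negligible (uminus ` N2)"
    using N2(1) by (intro negligible_differentiable_image_negligible) (auto intro!: derivative_intros)
  then have N: "negligible N" using N1 by (simp add: N_def)
  have split: "integral {a..t} f - integral {a..s} f = integral {s..t} g"
    if "a \<le> s" "s \<le> t" "t \<le> b" for s t
  proof -
    have "integral {a..s} f + integral {s..t} f = integral {a..t} f"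
      using that f by (intro Henstock_Kurzweil_Integration.integral_combine) (auto intro: integrable_subinterval_real)
    moreover have "integral {s..t} f = integral {s..t} g"
      using that by (intro Henstock_Kurzweil_Integration.integral_cong) (auto simp: g_def)
    ultimately show ?thesis by (simp add: algebra_simps)
  qed
  have "((\<lambda>t. integral {a..t} f) has_vector_derivative f t) (at t within {a..b})"
    if t: "t \<in> {a..b} - N" for t
    unfolding has_vector_derivative_def has_derivative_within_alt
  proof (intro conjI allI impI)
    fix e :: real assume e: "e > 0"
    have tN: "t \<notin> N1" "- t \<notin> N2"
      using t by (auto simp: N_def image_iff minus_equation_iff)
    obtain d1 where d1: "d1 > 0" "\<And>h. 0 < h \<Longrightarrow> h < d1 \<Longrightarrow> norm (integral {t..t + h} g /\<^sub>R h - g t) < e"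
      using N1(2)[OF tN(1) e] by blast
    obtain d2 where d2: "d2 > 0" "\<And>h. 0 < h \<Longrightarrow> h < d2 \<Longrightarrow>
        norm (integral {-t..-t + h} (\<lambda>s. g (- s)) /\<^sub>R h - g t) < e"
      using N2(2)[OF tN(2) e] by auto
    have scale: "norm (I - h *\<^sub>R f t) \<le> e * h" if "0 < h" "norm (I /\<^sub>R h - f t) < e" for I h
    proof -
      have "I - h *\<^sub>R f t = h *\<^sub>R (I /\<^sub>R h - f t)"
        using that(1) by (simp add: algebra_simps)
      then have "norm (I - h *\<^sub>R f t) = h * norm (I /\<^sub>R h - f t)"
        using that(1) by simp
      then show ?thesis using that by simp
    qed
    show "\<exists>d>0. \<forall>s\<in>{a..b}. norm (s - t) < d \<longrightarrow>
        norm (integral {a..s} f - integral {a..t} f - (s - t) *\<^sub>R f t) \<le> e * norm (s - t)"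
    proof (intro exI[of _ "min d1 d2"] conjI ballI impI)
      fix s assume s: "s \<in> {a..b}" "norm (s - t) < min d1 d2"
      have gt: "g t = f t" using t by (simp add: g_def)
      consider "s = t" | "t < s" | "s < t" by linarith
      then show "norm (integral {a..s} f - integral {a..t} f - (s - t) *\<^sub>R f t) \<le> e * norm (s - t)"
      proof cases
        case 2
        then have "norm (integral {t..t + (s - t)} g /\<^sub>R (s - t) - f t) < e"
          using d1(2)[of "s - t"] s gt by (simp add: abs_if)
        from scale[OF _ this] 2 show ?thesis
          using split[of t s] s t by simp
      next
        case 3
        have "integral {-t..-t + (t - s)} (\<lambda>r. g (- r)) = integral {s..t} g"
          using integral_reflect_real[of t s g] by simp
        then have "norm (integral {s..t} g /\<^sub>R (t - s) - f t) < e"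
          using d2(2)[of "t - s"] s 3 gt by (simp add: abs_if)
        from scale[OF _ this] 3 have "norm (integral {s..t} g - (t - s) *\<^sub>R f t) \<le> e * (t - s)"
          by simp
        moreover have "integral {a..s} f - integral {a..t} f - (s - t) *\<^sub>R f t = - (integral {s..t} g - (t - s) *\<^sub>R f t)"
          using split[of s t] s t 3 by (simp add: algebra_simps)
        ultimately show ?thesis
          using 3 by (simp only: norm_minus_cancel) (simp add: abs_if)
      qed simp
    qed (use d1 d2 in auto)
  qed (simp add: bounded_linear_scaleR_left)
  with N show ?thesis using that by blast
qed

text \<open>Truncation: \<open>norm (f t) \<le> n + h n t\<close>, where the excess
  \<open>h n\<close> has small integral for large \<open>n\<close> by dominated convergence. On a
  set of small total length the constant part contributes at most \<open>n * d\<close>, and the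
  excess at most its whole integral.\<close>

lemma absolutely_continuous_fun_indefinite_integral:
  fixes f :: "real \<Rightarrow> 'a::euclidean_space"
  assumes f: "f absolutely_integrable_on {a..b}"
  shows "absolutely_continuous_fun a b (\<lambda>t. integral {a..t} f)"
  unfolding absolutely_continuous_fun_def
proof (intro allI impI)
  fix e :: real assume e: "e > 0"
  have nf: "(\<lambda>t. norm (f t)) absolutely_integrable_on {a..b}"
    using f absolutely_integrable_norm by (simp add: comp_def)
  define h where "h n t = max 0 (norm (f t) - real n)" for n t
  have nfL: "integrable (lebesgue_on {a..b}) (\<lambda>t. norm (f t))"
    using nf by (intro absolutely_integrable_imp_integrable) auto
  have hm: "h n \<in> borel_measurable (lebesgue_on {a..b})" for n
    using nfL unfolding h_def by measurable
  have hL: "integrable (lebesgue_on {a..b}) (h n)" for n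
    by (rule Bochner_Integration.integrable_bound[OF nfL hm]) (auto simp: h_def)
  have "(\<lambda>n. LINT t|lebesgue_on {a..b}. h n t) \<longlonglongrightarrow> (LINT t|lebesgue_on {a..b}. 0)"
  proof (rule integral_dominated_convergence[OF _ hm nfL])
    show "AE t in lebesgue_on {a..b}. (\<lambda>n. h n t) \<longlonglongrightarrow> 0"
    proof (intro AE_I2)
      fix t
      obtain n0 where n0: "norm (f t) \<le> real n0" using real_arch_simple by blast
      show "(\<lambda>n. h n t) \<longlonglongrightarrow> 0"
        by (rule tendsto_eventually, rule eventually_sequentiallyI[of n0]) (use n0 in \<open>auto simp: h_def\<close>)
    qed
  qed (auto simp: h_def)
  then have "(\<lambda>n. LINT t|lebesgue_on {a..b}. h n t) \<longlonglongrightarrow> 0" by simp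
  then obtain n where n: "(LINT t|lebesgue_on {a..b}. h n t) < e / 2"
    using e by (metis (no_types, lifting) eventually_happens half_gt_zero order_tendstoD(2) sequentially_bot)
  have hi: "h n integrable_on {a..b}" using integrable_on_lebesgue_on[OF hL] by simp
  have hn: "integral {a..b} (h n) < e / 2"
    using n lebesgue_integral_eq_integral[OF hL[of n]] by simp
  define d where "d = e / (2 * (real n + 1))"
  have d: "d > 0" "real n * d < e / 2" using e by (auto simp: d_def field_simps)
  show "\<exists>d>0. \<forall>D S. D division_of S \<and> S \<subseteq> {a..b} \<and> (\<Sum>K\<in>D. Sup K - Inf K) < d \<longrightarrow>
      (\<Sum>K\<in>D. norm (integral {a..Sup K} f - integral {a..Inf K} f)) < e"
  proof (intro exI[of _ d] conjI allI impI)
    fix D S assume "D division_of S \<and> S \<subseteq> {a..b} \<and> (\<Sum>K\<in>D. Sup K - Inf K) < d"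
    then have D: "D division_of S" "S \<subseteq> {a..b}" "(\<Sum>K\<in>D. Sup K - Inf K) < d" by auto
    have K: "\<exists>u v. K = {u..v} \<and> u \<le> v \<and> {u..v} \<subseteq> {a..b}" if "K \<in> D" for K
      using D that by (metis atLeastatMost_empty_iff2 box_real(2) division_ofD(2,3,4) linorder_not_le subset_trans)
    have "(\<Sum>K\<in>D. norm (integral {a..Sup K} f - integral {a..Inf K} f)) \<le>
          (\<Sum>K\<in>D. real n * (Sup K - Inf K) + integral K (h n))"
    proof (rule sum_mono)
      fix K assume "K \<in> D"
      then obtain u v where uv: "K = {u..v}" "u \<le> v" "{u..v} \<subseteq> {a..b}" using K by blast
      have fi: "f integrable_on {u..v}"
        using f uv(3) by (meson absolutely_integrable_on_def integrable_subinterval_real)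
      have hi': "h n integrable_on {u..v}"
        using hi uv(3) by (meson integrable_subinterval_real)
      have "integral {a..u} f + integral {u..v} f = integral {a..v} f"
        using uv f by (intro Henstock_Kurzweil_Integration.integral_combine)
          (auto simp: absolutely_integrable_on_def intro: integrable_subinterval_real)
      then have "norm (integral {a..Sup K} f - integral {a..Inf K} f) = norm (integral {u..v} f)"
        using uv by (metis add_diff_cancel_left' cInf_atLeastAtMost cSup_atLeastAtMost)
      also have "\<dots> \<le> integral {u..v} (\<lambda>t. real n + h n t)"
      proof (rule Henstock_Kurzweil_Integration.integral_norm_bound_integral[OF fi])
        show "(\<lambda>t. real n + h n t) integrable_on {u..v}"
          using hi' by (intro Henstock_Kurzweil_Integration.integrable_add) auto
      qed (auto simp: h_def)
      also have "\<dots> = real n * (v - u) + integral {u..v} (h n)"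
        using hi' uv(2) by (subst Henstock_Kurzweil_Integration.integral_add) auto
      finally show "norm (integral {a..Sup K} f - integral {a..Inf K} f) \<le> real n * (Sup K - Inf K) + integral K (h n)"
        using uv by simp
    qed
    also have "\<dots> = real n * (\<Sum>K\<in>D. Sup K - Inf K) + (\<Sum>K\<in>D. integral K (h n))"
      by (simp add: sum.distrib sum_distrib_left)
    also have "(\<Sum>K\<in>D. integral K (h n)) = integral S (h n)"
      using K hi by (intro integral_combine_division_bottomup[OF D(1), symmetric]) (metis integrable_subinterval_real)
    also have "\<dots> \<le> integral {a..b} (h n)"
      using D(2) hi by (intro integral_subset_le integrable_on_subdivision[OF D(1)]) (auto simp: h_def)
    also have "real n * (\<Sum>K\<in>D. Sup K - Inf K) \<le> real n * d"
      using D(3) by (intro mult_left_mono) auto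
    finally show "(\<Sum>K\<in>D. norm (integral {a..Sup K} f - integral {a..Inf K} f)) < e"
      using hn d(2) by simp
  qed (fact d(1))
qed

section \<open>Integral equations\<close>

lemma AE_lebesgue_on_iff_negligible:
  assumes "S \<in> sets lebesgue"
  shows "(AE t in lebesgue_on S. P t) \<longleftrightarrow> negligible {t \<in> S. \<not> P t}"
proof -
  have "(AE t in lebesgue_on S. P t) \<longleftrightarrow> (AE t in lebesgue. t \<in> S \<longrightarrow> P t)"
    using assms by (simp add: AE_restrict_space_iff)
  also have "\<dots> \<longleftrightarrow> negligible {t \<in> S. \<not> P t}"
    by (simp add: completion.AE_iff_null_sets negligible_iff_null_sets)
  finally show ?thesis .
qed

lemma absolutely_integrable_on_iff_lebesgue_on:
  fixes f :: "real \<Rightarrow> 'a::euclidean_space"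
  shows "f absolutely_integrable_on {a..b} \<longleftrightarrow> integrable (lebesgue_on {a..b}) f"
  by (simp add: set_integrable_def integrable_restrict_space)

lemma absolutely_integrable_subinterval:
  fixes f :: "real \<Rightarrow> 'a::euclidean_space"
  assumes "f absolutely_integrable_on {a..b}" "{c..d} \<subseteq> {a..b}"
  shows "f absolutely_integrable_on {c..d}"
  using assms by (intro set_integrable_subset[OF assms(1)]) auto

lemma absolutely_integrable_scaleR_continuous:
  fixes b :: "real \<Rightarrow> real" and x :: "real \<Rightarrow> 'a::euclidean_space"
  assumes b: "b absolutely_integrable_on {c..d}" and x: "continuous_on {c..d} x"
  shows "(\<lambda>t. b t *\<^sub>R x t) absolutely_integrable_on {c..d}"
proof (rule absolutely_integrable_bounded_measurable_product[where h="\<lambda>x r. r *\<^sub>R x" and f=x and g=b])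
  show "bilinear (\<lambda>x r. r *\<^sub>R x :: 'a)"
    by (simp add: bilinear_def linear_iff algebra_simps)
  show "bounded (x ` {c..d})"
    using x compact_continuous_image compact_imp_bounded by blast
qed (use x b in \<open>auto intro: continuous_imp_measurable_on_sets_lebesgue\<close>)

section \<open>Gronwall's inequality and Picard's theorem for an integrable Lipschitz rate
  \<open>b\<close>\<close>

context
  fixes b :: "real \<Rightarrow> real" and T :: real
  assumes b_int: "b absolutely_integrable_on {0..T}" and b_nonneg: "\<And>t. t \<in> {0..T} \<Longrightarrow> 0 \<le> b t"
begin

text \<open>A Bielecki weight. The factor 2 is chosen so that the integral of
  \<open>b * exp_weight\<close> is \<open>(exp_weight - 1) / 2\<close>, which makes the Volterra
  operator with kernel \<open>b\<close> a contraction with factor 1/2 in the weighted supremum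
  norm.\<close>

definition exp_weight :: "real \<Rightarrow> real" where
  "exp_weight t = exp (2 * integral {0..t} b)"

lemma integral_kernel_bounds:
  assumes "t \<in> {0..T}"
  shows "0 \<le> integral {0..t} b" "integral {0..t} b \<le> integral {0..T} b"
proof -
  have bi: "b integrable_on {0..T}" "b integrable_on {0..t}"
    using b_int assms by (auto simp: absolutely_integrable_on_def intro: integrable_subinterval_real)
  show "0 \<le> integral {0..t} b"
    using b_nonneg assms bi by (intro Henstock_Kurzweil_Integration.integral_nonneg) auto
  show "integral {0..t} b \<le> integral {0..T} b"
    using assms bi b_nonneg by (intro integral_subset_le) auto
qed

lemma exp_weight_ge_1: "t \<in> {0..T} \<Longrightarrow> 1 \<le> exp_weight t"
  using integral_kernel_bounds(1) by (simp add: exp_weight_def)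

lemma continuous_on_exp_weight: "continuous_on {0..T} exp_weight"
  unfolding exp_weight_def
  using b_int by (intro continuous_intros indefinite_integral_continuous_1) (auto simp: absolutely_integrable_on_def)

text \<open>Since \<open>b\<close> is merely integrable, the weight is differentiable only almost
  everywhere. It is absolutely continuous, because the exponential is Lipschitz on the bounded range
  of the primitive of \<open>b\<close>.\<close>

lemma exp_weight_has_integral:
  assumes t: "t \<in> {0..T}"
  shows "((\<lambda>s. b s * exp_weight s) has_integral (exp_weight t - 1) / 2) {0..t}"
proof -
  define B where "B s = integral {0..s} b" for s
  have bi: "b absolutely_integrable_on {0..t}"
    by (rule absolutely_integrable_subinterval[OF b_int]) (use t in auto)
  obtain N where N: "negligible N"
    "\<And>s. s \<in> {0..t} - N \<Longrightarrow> (B has_vector_derivative b s) (at s within {0..t})"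
    unfolding B_def using bi indefinite_integral_has_vector_derivative_AE[of b 0 t]
    by (auto simp: absolutely_integrable_on_def)
  define M where "M = integral {0..T} b"
  have BM: "0 \<le> B s" "B s \<le> M" if "s \<in> {0..t}" for s
    using integral_kernel_bounds[of s] that t by (auto simp: B_def M_def)
  have lip: "norm (exp (2 * r) - exp (2 * s)) \<le> 2 * exp (2 * M) * norm (r - s)"
    if "r \<in> {0..M}" "s \<in> {0..M}" for r s :: real
  proof (rule field_differentiable_bound[OF convex_real_interval(5)[of 0 M] _ _ that])
    show "((\<lambda>r. exp (2 * r)) has_field_derivative 2 * exp (2 * z)) (at z within {0..M})" for z :: real
      by (auto intro!: derivative_eq_intros)
    show "norm (2 * exp (2 * z)) \<le> 2 * exp (2 * M)" if "z \<in> {0..M}" for z :: real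
      using that by simp
  qed
  have "absolutely_continuous_fun 0 t (\<lambda>s. exp (2 * B s))"
  proof (rule absolutely_continuous_fun_dominated[where x=B])
    show "absolutely_continuous_fun 0 t B"
      unfolding B_def by (rule absolutely_continuous_fun_indefinite_integral[OF bi])
    show "norm (exp (2 * B r) - exp (2 * B s)) \<le> 2 * exp (2 * M) * norm (B r - B s)"
      if "r \<in> {0..t}" "s \<in> {0..t}" for r s
      using BM that by (intro lip) auto
  qed simp
  moreover have "((\<lambda>s. exp (2 * B s)) has_vector_derivative 2 * b s * exp (2 * B s)) (at s within {0..t})"
    if "s \<in> {0..t} - N" for s
  proof -
    have "(B has_field_derivative b s) (at s within {0..t})"
      using N(2)[OF that] by (simp add: has_real_derivative_iff_has_vector_derivative)
    then have "((\<lambda>s. exp (2 * B s)) has_field_derivative 2 * b s * exp (2 * B s)) (at s within {0..t})"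
      by (auto intro!: derivative_eq_intros)
    then show ?thesis by (simp add: has_real_derivative_iff_has_vector_derivative)
  qed
  ultimately have "((\<lambda>s. 2 * b s * exp (2 * B s)) has_integral (exp (2 * B t) - exp (2 * B 0))) {0..t}"
    using t N(1) by (intro fundamental_theorem_of_calculus_absolutely_continuous) auto
  from has_integral_mult_right[OF this, of "1/2"] show ?thesis
    by (simp add: exp_weight_def B_def mult.assoc)
qed

text \<open>A maximum argument instead of differentiation: at a maximum point \<open>r\<close> of
  \<open>\<phi> / exp_weight\<close> the hypothesis yields
  \<open>m * exp_weight r + m \<le> 2 * \<alpha>\<close> for the maximum \<open>m\<close>. The
  factors 2 come from the weight and are not optimal.\<close>

lemma gronwall:
  assumes T: "0 \<le> T" and \<phi>: "continuous_on {0..T} \<phi>" and \<alpha>: "0 \<le> \<alpha>"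
    and le: "\<And>t. t \<in> {0..T} \<Longrightarrow> \<phi> t \<le> \<alpha> + integral {0..t} (\<lambda>s. b s * \<phi> s)"
    and t: "t \<in> {0..T}"
  shows "\<phi> t \<le> 2 * \<alpha> * exp (2 * integral {0..T} b)"
proof -
  define \<psi> where "\<psi> s = \<phi> s / exp_weight s" for s
  have pos: "exp_weight s > 0" for s by (simp add: exp_weight_def)
  have "continuous_on {0..T} \<psi>"
    unfolding \<psi>_def using \<phi> continuous_on_exp_weight pos
    by (intro continuous_intros) (auto simp: less_imp_neq[symmetric])
  then obtain r where r: "r \<in> {0..T}" "\<And>s. s \<in> {0..T} \<Longrightarrow> \<psi> s \<le> \<psi> r"
    using continuous_attains_sup[of "{0..T}" \<psi>] T by auto
  \<comment> \<open>The sign of \<open>\<phi>\<close> is not prescribed; only a nonnegative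
    \<open>m\<close> lets the pointwise bound be multiplied through the integral and
    \<open>m \<le> m * exp_weight r\<close> hold.\<close>
  define m where "m = max 0 (\<psi> r)"
  have m: "\<phi> s \<le> m * exp_weight s" if "s \<in> {0..T}" for s
  proof -
    have "\<psi> s \<le> m" using r(2)[OF that] by (simp add: m_def)
    then show ?thesis using pos[of s] by (simp add: \<psi>_def pos_divide_le_eq)
  qed
  have "m \<le> 2 * \<alpha>"
  proof (cases "\<psi> r \<le> 0")
    case False
    have bi: "b absolutely_integrable_on {0..r}"
      by (rule absolutely_integrable_subinterval[OF b_int]) (use r(1) in auto)
    have "(\<lambda>s. b s *\<^sub>R \<phi> s) absolutely_integrable_on {0..r}"
      using bi \<phi> r(1) by (intro absolutely_integrable_scaleR_continuous) (auto intro: continuous_on_subset)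
    then have i1: "(\<lambda>s. b s * \<phi> s) integrable_on {0..r}"
      by (simp add: absolutely_integrable_on_def)
    have "((\<lambda>s. m * (b s * exp_weight s)) has_integral m * ((exp_weight r - 1) / 2)) {0..r}"
      by (intro has_integral_mult_right exp_weight_has_integral r(1))
    moreover have "b s * \<phi> s \<le> m * (b s * exp_weight s)" if "s \<in> {0..r}" for s
      using mult_left_mono[OF m b_nonneg, of s s] that r(1) by (simp add: mult_ac)
    ultimately have "integral {0..r} (\<lambda>s. b s * \<phi> s) \<le> m * ((exp_weight r - 1) / 2)"
      using i1 by (intro has_integral_le[OF integrable_integral])
    then have "\<phi> r \<le> \<alpha> + m * ((exp_weight r - 1) / 2)"
      using le[OF r(1)] by simp
    moreover have "\<phi> r = m * exp_weight r"
      using False pos[of r] by (simp add: m_def \<psi>_def)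
    ultimately have "m * exp_weight r + m \<le> 2 * \<alpha>" by (simp add: field_simps)
    moreover have "m * 1 \<le> m * exp_weight r"
      using exp_weight_ge_1[OF r(1)] by (intro mult_left_mono) (auto simp: m_def)
    moreover have "0 \<le> m" by (simp add: m_def)
    ultimately show ?thesis by simp
  qed (use \<alpha> in \<open>auto simp: m_def\<close>)
  then have "\<phi> t \<le> 2 * \<alpha> * exp_weight t"
    using m[OF t] pos[of t] by (meson dual_order.trans less_imp_le mult_right_mono)
  also have "\<dots> \<le> 2 * \<alpha> * exp (2 * integral {0..T} b)"
    using integral_kernel_bounds(2)[OF t] \<alpha> by (intro mult_left_mono) (auto simp: exp_weight_def)
  finally show ?thesis .
qed

text \<open>The Picard operator is a contraction for the supremum norm weighted by \<^const>\<open>exp_weight\<close>.\<close>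

lemma integral_equation_solvable:
  fixes \<Phi> :: "real \<Rightarrow> 'a::euclidean_space \<Rightarrow> 'a" and x0 :: 'a
  assumes T: "0 \<le> T"
    and lip: "\<And>t x y. t \<in> {0..T} \<Longrightarrow> norm (\<Phi> t x - \<Phi> t y) \<le> b t * norm (x - y)"
    and int: "\<And>x. continuous_on {0..T} x \<Longrightarrow> (\<lambda>t. \<Phi> t (x t)) absolutely_integrable_on {0..T}"
  shows "\<exists>x. continuous_on {0..T} x \<and> (\<forall>t\<in>{0..T}. x t = x0 + integral {0..t} (\<lambda>s. \<Phi> s (x s)))"
proof -
  \<comment> \<open>The unknown is \<open>y = x / exp_weight\<close>, so that the ordinary supremum
    distance of bounded continuous functions is the weighted distance of the solutions.\<close>
  define G :: "(real \<Rightarrow>\<^sub>C 'a) \<Rightarrow> real \<Rightarrow> 'a" where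
    "G y t = (1 / exp_weight t) *\<^sub>R (x0 + integral {0..t} (\<lambda>s. \<Phi> s (exp_weight s *\<^sub>R y s)))" for y t
  have pos: "exp_weight s > 0" for s by (simp add: exp_weight_def)
  have yi: "(\<lambda>s. \<Phi> s (exp_weight s *\<^sub>R y s)) absolutely_integrable_on {0..T}" for y :: "real \<Rightarrow>\<^sub>C 'a"
    using continuous_on_exp_weight by (intro int continuous_intros) auto
  have "continuous_on {0..T} (G y)" for y
    unfolding G_def using continuous_on_exp_weight pos yi[of y]
    by (intro continuous_intros indefinite_integral_continuous_1)
      (auto simp: less_imp_neq[symmetric] absolutely_integrable_on_def)
  \<comment> \<open>\<open>clamp\<close> extends the function from \<open>[0,T]\<close> to the whole
    line by its end-point values, which turns it into an element of the complete space of bounded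
    continuous functions.\<close>
  then have "\<exists>g :: real \<Rightarrow>\<^sub>C 'a. \<forall>t. g t = G y (clamp 0 T t)" for y
    by (metis continuous_on_cbox_bcontfunE interval_cbox)
  then obtain P :: "(real \<Rightarrow>\<^sub>C 'a) \<Rightarrow> real \<Rightarrow>\<^sub>C 'a" where P: "\<And>y t. P y t = G y (clamp 0 T t)"
    by metis
  have "dist (P y) (P z) \<le> 1 / 2 * dist y z" for y z
  proof (rule dist_bound)
    fix t' :: real
    define t where "t = clamp 0 T t'"
    have t: "t \<in> {0..T}" using clamp_in_interval[of 0 T t'] T by (simp add: t_def)
    have i: "(\<lambda>s. \<Phi> s (exp_weight s *\<^sub>R y s)) integrable_on {0..t}" for y :: "real \<Rightarrow>\<^sub>C 'a"
      using yi[of y] t by (auto simp: absolutely_integrable_on_def intro: integrable_subinterval_real)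
    have hi: "((\<lambda>s. dist y z * (b s * exp_weight s)) has_integral dist y z * ((exp_weight t - 1) / 2)) {0..t}"
      by (intro has_integral_mult_right exp_weight_has_integral t)
    have "norm (integral {0..t} (\<lambda>s. \<Phi> s (exp_weight s *\<^sub>R y s)) - integral {0..t} (\<lambda>s. \<Phi> s (exp_weight s *\<^sub>R z s)))
       = norm (integral {0..t} (\<lambda>s. \<Phi> s (exp_weight s *\<^sub>R y s) - \<Phi> s (exp_weight s *\<^sub>R z s)))"
      using i by (subst Henstock_Kurzweil_Integration.integral_diff) auto
    also have "\<dots> \<le> integral {0..t} (\<lambda>s. dist y z * (b s * exp_weight s))"
    proof (rule Henstock_Kurzweil_Integration.integral_norm_bound_integral)
      fix s assume "s \<in> {0..t}"
      then have s: "s \<in> {0..T}" using t by auto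
      have "norm (\<Phi> s (exp_weight s *\<^sub>R y s) - \<Phi> s (exp_weight s *\<^sub>R z s))
          \<le> b s * norm (exp_weight s *\<^sub>R (y s - z s))"
        using lip[OF s] by (metis scaleR_diff_right)
      also have "\<dots> = b s * exp_weight s * dist (y s) (z s)"
        using pos[of s] by (simp add: dist_norm)
      also have "\<dots> \<le> b s * exp_weight s * dist y z"
        using b_nonneg[OF s] pos[of s] dist_bounded[of y s z] by (intro mult_left_mono) auto
      finally show "norm (\<Phi> s (exp_weight s *\<^sub>R y s) - \<Phi> s (exp_weight s *\<^sub>R z s)) \<le> dist y z * (b s * exp_weight s)"
        by (simp add: mult_ac)
    qed (use i hi in \<open>auto intro: Henstock_Kurzweil_Integration.integrable_diff\<close>)
    also have "\<dots> = dist y z * ((exp_weight t - 1) / 2)"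
      using hi by (rule integral_unique)
    finally have *: "norm (integral {0..t} (\<lambda>s. \<Phi> s (exp_weight s *\<^sub>R y s)) - integral {0..t} (\<lambda>s. \<Phi> s (exp_weight s *\<^sub>R z s)))
        \<le> dist y z * ((exp_weight t - 1) / 2)" .
    have "dist (P y t') (P z t') = (1 / exp_weight t) *
        norm (integral {0..t} (\<lambda>s. \<Phi> s (exp_weight s *\<^sub>R y s)) - integral {0..t} (\<lambda>s. \<Phi> s (exp_weight s *\<^sub>R z s)))"
      using pos[of t] by (simp add: P G_def t_def[symmetric] dist_norm flip: scaleR_diff_right)
    also have "\<dots> \<le> (1 / exp_weight t) * (dist y z * ((exp_weight t - 1) / 2))"
      using * pos[of t] by (intro mult_left_mono) auto
    also have "\<dots> \<le> 1 / 2 * dist y z"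
      using pos[of t] zero_le_dist[of y z] by (simp add: field_simps)
    finally show "dist (P y t') (P z t') \<le> 1 / 2 * dist y z" .
  qed
  then obtain y where y: "P y = y"
    using banach_fix_type[of "1/2" P] by auto
  define x where "x t = exp_weight t *\<^sub>R y t" for t
  have "continuous_on {0..T} x"
    unfolding x_def using continuous_on_exp_weight by (intro continuous_intros) auto
  moreover have "x t = x0 + integral {0..t} (\<lambda>s. \<Phi> s (x s))" if t: "t \<in> {0..T}" for t
  proof -
    have "y t = G y t"
      using P[of y t] y t by (metis clamp_cancel_cbox interval_cbox)
    then show ?thesis using pos[of t] by (simp add: x_def G_def)
  qed
  ultimately show ?thesis by blast
qed

end

text \<open>With its converse below, this trades the a.e. differential equation of a Caratheodory
  solution for an integral equation.\<close>

lemma integral_equation_imp_absolutely_continuous: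
  fixes x :: "real \<Rightarrow> 'a::euclidean_space"
  assumes g: "g absolutely_integrable_on {0..T}"
    and x: "\<And>t. t \<in> {0..T} \<Longrightarrow> x t = c + integral {0..t} g"
  shows "absolutely_continuous_fun 0 T x"
    "AE t in lebesgue_on {0..T}. (x has_vector_derivative g t) (at t within {0..T})"
proof -
  show "absolutely_continuous_fun 0 T x"
    by (rule absolutely_continuous_fun_dominated[OF absolutely_continuous_fun_indefinite_integral[OF g], where M=1])
      (use x in auto)
  have "g integrable_on {0..T}" using g by (simp add: absolutely_integrable_on_def)
  then obtain N where N: "negligible N"
    "\<And>t. t \<in> {0..T} - N \<Longrightarrow> ((\<lambda>t. integral {0..t} g) has_vector_derivative g t) (at t within {0..T})"
    by (rule indefinite_integral_has_vector_derivative_AE) (rule that)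
  have "(x has_vector_derivative g t) (at t within {0..T})" if "t \<in> {0..T} - N" for t
  proof -
    have "((\<lambda>t. c + integral {0..t} g) has_vector_derivative g t) (at t within {0..T})"
      using N(2)[OF that] by (auto intro!: derivative_eq_intros)
    then show ?thesis
      using has_vector_derivative_transform[of t "{0..T}" x] x that by auto
  qed
  then have "{t \<in> {0..T}. \<not> (x has_vector_derivative g t) (at t within {0..T})} \<subseteq> N" by blast
  then show "AE t in lebesgue_on {0..T}. (x has_vector_derivative g t) (at t within {0..T})"
    using N(1) by (subst AE_lebesgue_on_iff_negligible) (auto intro: negligible_subset)
qed

lemma absolutely_continuous_imp_integral_equation:
  fixes x :: "real \<Rightarrow> 'a::euclidean_space"
  assumes ac: "absolutely_continuous_fun 0 T x"
    and deriv: "AE t in lebesgue_on {0..T}. (x has_vector_derivative g t) (at t within {0..T})"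
    and t: "t \<in> {0..T}"
  shows "x t = x 0 + integral {0..t} g"
proof -
  define N where "N = {t \<in> {0..T}. \<not> (x has_vector_derivative g t) (at t within {0..T})}"
  have N: "negligible N"
    using deriv by (simp add: N_def AE_lebesgue_on_iff_negligible)
  have "(g has_integral (x t - x 0)) {0..t}"
  proof (rule fundamental_theorem_of_calculus_absolutely_continuous[OF _ _ N])
    show "absolutely_continuous_fun 0 t x"
      by (rule absolutely_continuous_fun_dominated[OF ac, where M=1]) (use t in auto)
    fix s assume s: "s \<in> {0..t} - N"
    then have "(x has_vector_derivative g s) (at s within {0..T})"
      using t by (auto simp: N_def)
    then show "(x has_vector_derivative g s) (at s within {0..t})"
      using t by (auto intro: has_vector_derivative_within_subset)
  qed (use t in auto)
  from integral_unique[OF this] show ?thesis by simp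
qed

section \<open>The spaces $L^p$\<close>

lemma convex_combination_powr_le:
  fixes a b s p :: real
  assumes "1 \<le> p" "0 \<le> a" "0 \<le> b" "0 \<le> s" "s \<le> 1"
  shows "((1 - s) * a + s * b) powr p \<le> (1 - s) * a powr p + s * b powr p"
proof -
  have le: "(r * x) powr p \<le> r * x powr p" if "0 \<le> r" "r \<le> 1" "0 \<le> x" for r x :: real
  proof -
    have "r powr p \<le> r powr 1"
      using that assms(1) by (intro powr_mono') auto
    then show ?thesis using that by (simp add: powr_mult mult_right_mono)
  qed
  consider "a = 0" | "b = 0" | "a > 0" "b > 0" using assms by linarith
  then show ?thesis
  proof cases
    case 1 then show ?thesis using le[of s b] assms by simp
  next
    case 2 then show ?thesis using le[of "1 - s" a] assms by simp
  next
    case 3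
    then show ?thesis
      using convex_onD[OF powr_convex[OF assms(1)], of s a b] assms by simp
  qed
qed

lemma norm_midpoint_powr_le:
  fixes x y :: "'a::real_normed_vector"
  assumes "1 \<le> p"
  shows "norm ((1/2) *\<^sub>R (x + y)) powr p \<le> (norm x powr p + norm y powr p) / 2"
proof -
  have "norm ((1/2) *\<^sub>R (x + y)) powr p \<le> ((1 - 1/2) * norm x + (1/2) * norm y) powr p"
    using norm_triangle_ineq[of x y] assms by (intro powr_mono2) auto
  also have "\<dots> \<le> (1 - 1/2) * norm x powr p + (1/2) * norm y powr p"
    by (rule convex_combination_powr_le) (use assms in auto)
  finally show ?thesis by simp
qed

lemma norm_diff_powr_le:
  fixes x y :: "'a::real_normed_vector"
  assumes "1 \<le> p"
  shows "norm (x - y) powr p \<le> 2 powr p * (norm x powr p + norm y powr p)"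
proof -
  have "norm (x - y) = 2 * norm ((1/2) *\<^sub>R (x + (- y)))" by simp
  then have "norm (x - y) powr p = 2 powr p * norm ((1/2) *\<^sub>R (x + (- y))) powr p"
    by (metis norm_ge_zero powr_mult zero_le_numeral)
  also have "\<dots> \<le> 2 powr p * ((norm x powr p + norm (- y) powr p) / 2)"
    using norm_midpoint_powr_le[OF assms, of x "- y"] by (intro mult_left_mono) auto
  also have "\<dots> \<le> 2 powr p * (norm x powr p + norm y powr p)"
    by (intro mult_left_mono) auto
  finally show ?thesis .
qed

text \<open>Truncation at a level \<open>K\<close> replaces Hoelder's inequality throughout: the
  part above \<open>K\<close> of a function in a ball of radius \<open>R\<close> has integral at
  most \<open>K powr (1 - p) * R powr p\<close>. As \<open>p > 1\<close>, this tends to 0 for large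
  \<open>K\<close>, uniformly over the ball.\<close>

lemma tail_le_powr:
  fixes r K p :: real
  assumes "1 < p" "0 < K" "K \<le> r"
  shows "r \<le> K powr (1 - p) * r powr p"
proof -
  have "r = r powr (1 - p) * r powr p"
    using assms by (simp flip: powr_add)
  also have "\<dots> \<le> K powr (1 - p) * r powr p"
    using assms by (intro mult_right_mono powr_mono2') auto
  finally show ?thesis .
qed

lemma le_const_plus_powr:
  fixes r K p :: real
  assumes "1 < p" "0 < K" "0 \<le> r"
  shows "r \<le> K + K powr (1 - p) * r powr p"
  using tail_le_powr[OF assms(1,2), of r] assms
  by (cases "K \<le> r") (auto intro: add_increasing2 order_trans[of r K])

lemma tail_factor_small:
  fixes p R e :: real
  assumes "1 < p" "0 < e"
  obtains K where "0 < K" "K powr (1 - p) * R < e"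
proof -
  have "((\<lambda>K. K powr (1 - p) * R) \<longlongrightarrow> 0 * R) at_top"
    using assms by (intro tendsto_mult tendsto_neg_powr filterlim_ident tendsto_const) auto
  then have "\<forall>\<^sub>F K in at_top. K powr (1 - p) * R < e"
    using assms(2) by (auto dest: order_tendstoD(2))
  then have "\<forall>\<^sub>F K in at_top. K powr (1 - p) * R < e \<and> 0 < K"
    using eventually_gt_at_top by (rule eventually_conj)
  then show thesis using that eventually_happens'[OF trivial_limit_at_top_linorder] by blast
qed

lemma finite_measure_lebesgue_on_interval: "finite_measure (lebesgue_on {a..b::real})"
  by (intro finite_measure_lebesgue_on) auto

lemma integrable_const_interval [simp]: "integrable (lebesgue_on {a..b::real}) (\<lambda>_. c::'a::euclidean_space)"
  using finite_measure.integrable_const[OF finite_measure_lebesgue_on_interval] by blast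

lemma integral_const_interval:
  assumes "a \<le> b" shows "(LINT t|lebesgue_on {a..b}. c) = (b - a) * (c::real)"
  using assms by (simp add: measure_restrict_space)

lemma Lp_funD:
  assumes "u \<in> Lp_fun p T"
  shows "u \<in> borel_measurable (lebesgue_on {0..T})" "integrable (lebesgue_on {0..T}) (\<lambda>t. norm (u t) powr p)"
  using assms by (auto simp: Lp_fun_def)

lemma Lp_fun_imp_integrable:
  fixes u :: "real \<Rightarrow> 'a::euclidean_space"
  assumes u: "u \<in> Lp_fun p T" and p: "1 < p"
  shows "integrable (lebesgue_on {0..T}) u"
proof (rule Bochner_Integration.integrable_bound)
  show "integrable (lebesgue_on {0..T}) (\<lambda>t. 1 + norm (u t) powr p)"
    using Lp_funD(2)[OF u] by simp
  have "norm (u t) \<le> 1 + norm (u t) powr p" for t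
    using le_const_plus_powr[OF p, of 1 "norm (u t)"] by simp
  then show "AE t in lebesgue_on {0..T}. norm (u t) \<le> norm (1 + norm (u t) powr p)"
    by (intro AE_I2) (auto intro: order_trans)
qed (use Lp_funD(1)[OF u] in auto)

lemma Lp_fun_dominated:
  fixes u :: "real \<Rightarrow> 'a::euclidean_space"
  assumes "u \<in> borel_measurable (lebesgue_on {0..T})" "integrable (lebesgue_on {0..T}) h"
    and "\<And>t. norm (u t) powr p \<le> h t"
  shows "u \<in> Lp_fun p T"
proof -
  have "integrable (lebesgue_on {0..T}) (\<lambda>t. norm (u t) powr p)"
  proof (rule Bochner_Integration.integrable_bound[OF assms(2)])
    show "(\<lambda>t. norm (u t) powr p) \<in> borel_measurable (lebesgue_on {0..T})"
      using assms(1) by measurable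
    show "AE t in lebesgue_on {0..T}. norm (norm (u t) powr p) \<le> norm (h t)"
      using assms(3) by (intro AE_I2) (metis abs_ge_self abs_of_nonneg order_trans powr_ge_zero real_norm_def)
  qed
  then show ?thesis using assms(1) by (simp add: Lp_fun_def)
qed

lemma Lp_fun_diff:
  fixes u v :: "real \<Rightarrow> 'a::euclidean_space"
  assumes "u \<in> Lp_fun p T" "v \<in> Lp_fun p T" "1 \<le> p"
  shows "(\<lambda>t. u t - v t) \<in> Lp_fun p T"
  using Lp_funD[OF assms(1)] Lp_funD[OF assms(2)] norm_diff_powr_le[OF assms(3)]
  by (intro Lp_fun_dominated[where h="\<lambda>t. 2 powr p * (norm (u t) powr p + norm (v t) powr p)"]) auto

lemma Lp_fun_midpoint:
  fixes u v :: "real \<Rightarrow> 'a::euclidean_space"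
  assumes "u \<in> Lp_fun p T" "v \<in> Lp_fun p T" "1 \<le> p"
  shows "(\<lambda>t. (1/2) *\<^sub>R (u t + v t)) \<in> Lp_fun p T"
  using Lp_funD[OF assms(1)] Lp_funD[OF assms(2)] norm_midpoint_powr_le[OF assms(3)]
  by (intro Lp_fun_dominated[where h="\<lambda>t. (norm (u t) powr p + norm (v t) powr p) / 2"]) auto

lemma Lp_norm_nonneg: "0 \<le> Lp_norm p T u"
  by (simp add: Lp_norm_def)

lemma Lp_norm_minus_commute: "Lp_norm p T (\<lambda>t. u t - v t) = Lp_norm p T (\<lambda>t. v t - u t)"
  by (simp add: Lp_norm_def norm_minus_commute)

lemma Lp_norm_powr:
  assumes "0 < p"
  shows "Lp_norm p T u powr p = (LINT t|lebesgue_on {0..T}. norm (u t) powr p)"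
  using assms by (simp add: Lp_norm_def powr_powr)

lemma Lp_norm_le_iff:
  assumes "0 < p" "0 \<le> R"
  shows "Lp_norm p T u \<le> R \<longleftrightarrow> (LINT t|lebesgue_on {0..T}. norm (u t) powr p) \<le> R powr p"
proof
  assume "Lp_norm p T u \<le> R"
  then have "Lp_norm p T u powr p \<le> R powr p"
    using assms Lp_norm_nonneg[of p T u] by (intro powr_mono2) auto
  then show "(LINT t|lebesgue_on {0..T}. norm (u t) powr p) \<le> R powr p"
    by (simp add: Lp_norm_powr[OF assms(1)])
next
  assume "(LINT t|lebesgue_on {0..T}. norm (u t) powr p) \<le> R powr p"
  then have "(LINT t|lebesgue_on {0..T}. norm (u t) powr p) powr (1/p) \<le> (R powr p) powr (1/p)"
    using assms by (intro powr_mono2) auto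
  then show "Lp_norm p T u \<le> R" using assms by (simp add: Lp_norm_def powr_powr)
qed

definition Lp_ball :: "real \<Rightarrow> real \<Rightarrow> real \<Rightarrow> (real \<Rightarrow> 'a::euclidean_space) set" where
  "Lp_ball p T R = {u \<in> Lp_fun p T. Lp_norm p T u \<le> R}"

lemma Lp_ballD:
  assumes "u \<in> Lp_ball p T R" "0 < p"
  shows "u \<in> Lp_fun p T" "(LINT t|lebesgue_on {0..T}. norm (u t) powr p) \<le> R powr p"
proof -
  have "0 \<le> R" using assms(1) Lp_norm_nonneg[of p T u] by (auto simp: Lp_ball_def)
  then show "u \<in> Lp_fun p T" "(LINT t|lebesgue_on {0..T}. norm (u t) powr p) \<le> R powr p"
    using assms by (auto simp: Lp_ball_def Lp_norm_le_iff)
qed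

lemma Lp_ballI:
  assumes "u \<in> Lp_fun p T" "(LINT t|lebesgue_on {0..T}. norm (u t) powr p) \<le> R powr p" "0 < p" "0 \<le> R"
  shows "u \<in> Lp_ball p T R"
  using assms by (simp add: Lp_ball_def Lp_norm_le_iff)

lemma Lp_ball_radius_nonneg: "u \<in> Lp_ball p T R \<Longrightarrow> 0 \<le> R"
  using Lp_norm_nonneg[of p T u] by (auto simp: Lp_ball_def)

lemma Lp_ball_midpoint:
  assumes u: "u \<in> Lp_ball p T R" and v: "v \<in> Lp_ball p T R" and p: "1 \<le> p"
  shows "(\<lambda>t. (1/2) *\<^sub>R (u t + v t)) \<in> Lp_ball p T R"
proof (rule Lp_ballI)
  have p0: "0 < p" using p by simp
  note uD = Lp_ballD[OF u p0] and vD = Lp_ballD[OF v p0]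
  show L: "(\<lambda>t. (1/2) *\<^sub>R (u t + v t)) \<in> Lp_fun p T"
    using uD vD p by (intro Lp_fun_midpoint) auto
  have "(LINT t|lebesgue_on {0..T}. norm ((1/2) *\<^sub>R (u t + v t)) powr p)
      \<le> (LINT t|lebesgue_on {0..T}. (norm (u t) powr p + norm (v t) powr p) / 2)"
    using Lp_funD(2)[OF L] Lp_funD(2)[OF uD(1)] Lp_funD(2)[OF vD(1)] norm_midpoint_powr_le[OF p]
    by (intro integral_mono) auto
  also have "\<dots> = ((LINT t|lebesgue_on {0..T}. norm (u t) powr p) + (LINT t|lebesgue_on {0..T}. norm (v t) powr p)) / 2"
    using Lp_funD(2)[OF uD(1)] Lp_funD(2)[OF vD(1)] by simp
  also have "\<dots> \<le> R powr p" using uD vD by simp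
  finally show "(LINT t|lebesgue_on {0..T}. norm ((1/2) *\<^sub>R (u t + v t)) powr p) \<le> R powr p" .
  show "0 \<le> R" using Lp_ball_radius_nonneg[OF u] .
qed (use p in auto)

text \<open>Minkowski's inequality from convexity of the power: for bounds \<open>a\<close> and
  \<open>b\<close> of the two norms, \<open>norm (u t) + norm (v t)\<close> is \<open>a + b\<close>
  times the convex combination of \<open>norm (u t) / a\<close> and \<open>norm (v t) / b\<close>
  with weights \<open>a / (a + b)\<close> and \<open>b / (a + b)\<close>.\<close>

lemma Lp_norm_triangle:
  fixes u v :: "real \<Rightarrow> 'a::euclidean_space"
  assumes p: "1 \<le> p" and u: "u \<in> Lp_fun p T" and v: "v \<in> Lp_fun p T"
  shows "Lp_norm p T (\<lambda>t. u t + v t) \<le> Lp_norm p T u + Lp_norm p T v"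
proof -
  let ?M = "lebesgue_on {0..T}"
  have le: "Lp_norm p T (\<lambda>t. u t + v t) \<le> a + b"
    if a: "0 < a" "Lp_norm p T u \<le> a" and b: "0 < b" "Lp_norm p T v \<le> b" for a b
  proof -
    define s where "s = b / (a + b)"
    have s: "0 \<le> s" "s \<le> 1" "(1 - s) * (1 / a) = 1 / (a + b)" "s * (1 / b) = 1 / (a + b)"
      using a b by (auto simp: s_def field_simps)
    have ua: "(LINT t|?M. norm (u t) powr p) \<le> a powr p" "(LINT t|?M. norm (v t) powr p) \<le> b powr p"
      using that p by (auto simp: Lp_norm_le_iff[symmetric])
    have pt: "norm (u t + v t) powr p \<le> (a + b) powr p * ((1 - s) * (norm (u t) powr p / a powr p) + s * (norm (v t) powr p / b powr p))" for t
    proof -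
      have "norm (u t + v t) powr p \<le> (norm (u t) + norm (v t)) powr p"
        using p norm_triangle_ineq by (intro powr_mono2) auto
      also have "norm (u t) + norm (v t) = (a + b) * ((1 - s) * (norm (u t) / a) + s * (norm (v t) / b))"
      proof -
        have "1 - s = a / (a + b)" using a b by (simp add: s_def field_simps)
        then show ?thesis using a b by (simp add: s_def add_divide_distrib[symmetric])
      qed
      also have "\<dots> powr p = (a + b) powr p * ((1 - s) * (norm (u t) / a) + s * (norm (v t) / b)) powr p"
        by (rule powr_mult)
      also have "\<dots> \<le> (a + b) powr p * ((1 - s) * (norm (u t) / a) powr p + s * (norm (v t) / b) powr p)"
        using a b s p by (intro mult_left_mono convex_combination_powr_le) auto
      finally show ?thesis using a b by (simp add: powr_divide)
    qed
    have i: "integrable ?M (\<lambda>t. norm (u t) powr p)" "integrable ?M (\<lambda>t. norm (v t) powr p)"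
      using u v by (auto simp: Lp_funD)
    have L: "(\<lambda>t. u t + v t) \<in> Lp_fun p T"
      using Lp_funD(1)[OF u] Lp_funD(1)[OF v] i pt by (intro Lp_fun_dominated[OF _ _ pt]) auto
    have "(LINT t|?M. norm (u t + v t) powr p)
      \<le> (LINT t|?M. (a + b) powr p * ((1 - s) * (norm (u t) powr p / a powr p) + s * (norm (v t) powr p / b powr p)))"
      using pt i Lp_funD(2)[OF L] by (intro integral_mono) auto
    also have "\<dots> = (a + b) powr p * ((1 - s) * ((LINT t|?M. norm (u t) powr p) / a powr p) + s * ((LINT t|?M. norm (v t) powr p) / b powr p))"
      using i by simp
    also have "\<dots> \<le> (a + b) powr p * ((1 - s) * 1 + s * 1)"
      using ua a b s by (intro mult_left_mono add_mono) (auto simp: divide_le_eq_1)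
    finally show ?thesis using a b p by (simp add: Lp_norm_le_iff)
  qed
  \<comment> \<open>The norms themselves may vanish and cannot be divided by; they are enlarged by
    \<open>e / 2\<close>.\<close>
  show ?thesis
  proof (rule field_le_epsilon)
    fix e :: real assume "0 < e"
    then show "Lp_norm p T (\<lambda>t. u t + v t) \<le> Lp_norm p T u + Lp_norm p T v + e"
      using le[of "Lp_norm p T u + e / 2" "Lp_norm p T v + e / 2"] Lp_norm_nonneg[of p T u] Lp_norm_nonneg[of p T v]
      by simp
  qed
qed

lemma Lp_norm_triangle_diff:
  fixes u v w :: "real \<Rightarrow> 'a::euclidean_space"
  assumes "1 \<le> p" "u \<in> Lp_fun p T" "v \<in> Lp_fun p T" "w \<in> Lp_fun p T"
  shows "Lp_norm p T (\<lambda>t. u t - w t) \<le> Lp_norm p T (\<lambda>t. u t - v t) + Lp_norm p T (\<lambda>t. v t - w t)"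
  using Lp_norm_triangle[OF assms(1) Lp_fun_diff Lp_fun_diff, of u T v v w] assms by simp

text \<open>Compactness is transferred from the metric space of representatives \<open>q u\<close>.\<close>

lemma compactin_closure_Lp_topology:
  fixes S :: "(real \<Rightarrow> 'a::euclidean_space) set"
  assumes p: "1 \<le> p" and S: "S \<subseteq> Lp_fun p T"
    and seq: "\<And>s :: nat \<Rightarrow> real \<Rightarrow> 'a. range s \<subseteq> S \<Longrightarrow>
      \<exists>v\<in>Lp_fun p T. \<exists>r. strict_mono r \<and> (\<lambda>n. Lp_norm p T (\<lambda>t. s (r n) t - v t)) \<longlonglongrightarrow> 0"
  shows "compactin (Lp_topology p T) (Lp_topology p T closure_of S)"
proof -
  define d where "d u v = Lp_norm p T (\<lambda>t. u t - v t)" for u v :: "real \<Rightarrow> 'a"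
  define L :: "(real \<Rightarrow> 'a) set" where "L = Lp_fun p T"
  have d0: "0 \<le> d u v" "d u v = d v u" "d u u = 0" for u v
  proof -
    show "d u v = d v u" unfolding d_def by (rule Lp_norm_minus_commute)
    show "d u u = 0" by (simp add: d_def Lp_norm_def)
  qed (simp add: d_def Lp_norm_nonneg)
  have dtri: "d u w \<le> d u v + d v w" if "u \<in> L" "v \<in> L" "w \<in> L" for u v w
    using that Lp_norm_triangle_diff[OF p] by (simp add: d_def L_def)
  \<comment> \<open>The described set depends only on the distances from \<open>u\<close>, so
    functions at distance 0 share one set and \<open>SOME\<close> picks the same member for both. On
    these picks the pseudometric \<open>d\<close> is a metric.\<close>
  define q where "q u = (SOME w. w \<in> L \<and> (\<forall>v\<in>L. d u v = d w v))" for u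
  have q: "q u \<in> L" "v \<in> L \<Longrightarrow> d u v = d (q u) v" if "u \<in> L" for u v
    using someI[of "\<lambda>w. w \<in> L \<and> (\<forall>v\<in>L. d u v = d w v)" u] that by (auto simp: q_def)
  have q_eq: "q u = q v" if "u \<in> L" "v \<in> L" "d u v = 0" for u v
  proof -
    have "d u w = d v w" if "w \<in> L" for w
      using dtri[of u v w] dtri[of v u w] \<open>u \<in> L\<close> \<open>v \<in> L\<close> \<open>d u v = 0\<close> d0(2)[of u v] that by simp
    then have "(\<lambda>w. w \<in> L \<and> (\<forall>x\<in>L. d u x = d w x)) = (\<lambda>w. w \<in> L \<and> (\<forall>x\<in>L. d v x = d w x))"
      by auto
    then show ?thesis by (simp add: q_def)
  qed
  have dq: "d (q u) (q v) = d u v" if "u \<in> L" "v \<in> L" for u v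
    using q(2)[OF that(1) q(1)[OF that(2)]] q(2)[OF that(2) that(1)] d0(2)[of u v] d0(2)[of u "q v"] by simp
  interpret Q: Metric_space "q ` L" d
  proof
    fix x y assume "x \<in> q ` L" "y \<in> q ` L"
    then obtain u v where "u \<in> L" "v \<in> L" "x = q u" "y = q v" by blast
    then show "d x y = 0 \<longleftrightarrow> x = y"
      using dq[of u v] q_eq[of u v] d0(3)[of "q u"] by metis
  next
    fix x y z assume "x \<in> q ` L" "y \<in> q ` L" "z \<in> q ` L"
    then show "d x z \<le> d x y + d y z" by (intro dtri) (auto intro: q(1))
  qed (rule d0)+
  define K where "K = Lp_topology p T closure_of S"
  have KL: "K \<subseteq> L" using closure_of_subset_topspace[of "Lp_topology p T" S] by (simp add: K_def L_def)
  have K_iff: "u \<in> K \<longleftrightarrow> (\<forall>e>0. \<exists>v\<in>S. d v u < e)" if u: "u \<in> L" for u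
  proof
    assume uK: "u \<in> K"
    show "\<forall>e>0. \<exists>v\<in>S. d v u < e"
    proof (intro allI impI)
      fix e :: real assume e: "e > 0"
      have "openin (Lp_topology p T) {v \<in> L. d v u < e}"
        unfolding openin_Lp_topology
      proof (intro conjI ballI)
        fix v assume v: "v \<in> {v \<in> L. d v u < e}"
        show "\<exists>e'>0. \<forall>w\<in>Lp_fun p T. Lp_norm p T (\<lambda>t. w t - v t) < e' \<longrightarrow> w \<in> {v \<in> L. d v u < e}"
        proof (intro exI[of _ "e - d v u"] conjI ballI impI)
          fix w assume w: "w \<in> Lp_fun p T" "Lp_norm p T (\<lambda>t. w t - v t) < e - d v u"
          then have "d w v < e - d v u" "w \<in> L" by (auto simp: d_def L_def)
          then show "w \<in> {v \<in> L. d v u < e}" using dtri[of w v u] v u by auto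
        qed (use v in auto)
      qed (auto simp: L_def)
      moreover have "u \<in> {v \<in> L. d v u < e}" using u e d0(3)[of u] by simp
      moreover have "\<And>U. u \<in> U \<Longrightarrow> openin (Lp_topology p T) U \<Longrightarrow> \<exists>y. y \<in> S \<and> y \<in> U"
        using uK by (simp add: K_def in_closure_of)
      ultimately have "\<exists>y. y \<in> S \<and> y \<in> {v \<in> L. d v u < e}" by (simp only:)
      then show "\<exists>v\<in>S. d v u < e" by auto
    qed
  next
    assume near: "\<forall>e>0. \<exists>v\<in>S. d v u < e"
    show "u \<in> K"
      unfolding K_def in_closure_of
    proof (intro conjI allI impI)
      fix U assume U: "u \<in> U \<and> openin (Lp_topology p T) U"
      then obtain e where e: "e > 0" "\<forall>v\<in>Lp_fun p T. Lp_norm p T (\<lambda>t. v t - u t) < e \<longrightarrow> v \<in> U"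
        unfolding openin_Lp_topology by blast
      obtain v where "v \<in> S" "d v u < e" using near e(1) by blast
      then have "v \<in> U" using e(2) S by (auto simp: d_def)
      then show "\<exists>y. y \<in> S \<and> y \<in> U" using \<open>v \<in> S\<close> by blast
    qed (use u in \<open>simp add: L_def\<close>)
  qed
  have "compactin Q.mtopology (q ` K)"
    unfolding Q.compactin_sequentially
  proof (intro conjI allI impI)
    show "q ` K \<subseteq> q ` L" using KL by blast
    fix \<sigma> :: "nat \<Rightarrow> real \<Rightarrow> 'a" assume "range \<sigma> \<subseteq> q ` K"
    then have "\<exists>k. k \<in> K \<and> \<sigma> n = q k" for n by blast
    then obtain k where k: "\<And>n. k n \<in> K" "\<And>n. \<sigma> n = q (k n)" by metis
    \<comment> \<open>The hypothesis \<open>seq\<close> concerns sequences in \<open>S\<close>; a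
      sequence in the closure is followed by one in \<open>S\<close> at distance tending to
      0.\<close>
    have "\<exists>s. s \<in> S \<and> d s (k n) < inverse (real (Suc n))" for n
    proof -
      have "k n \<in> L" using k(1) KL by (rule subsetD[rotated])
      from iffD1[OF K_iff[OF this] k(1), rule_format, of "inverse (real (Suc n))"] show ?thesis by auto
    qed
    then obtain s where s: "\<And>n. s n \<in> S" "\<And>n. d (s n) (k n) < inverse (real (Suc n))" by metis
    obtain v r where v: "v \<in> L" "strict_mono r" "(\<lambda>n. d (s (r n)) v) \<longlonglongrightarrow> 0"
    proof -
      have "range s \<subseteq> S" using s(1) by (rule image_subsetI)
      from seq[OF this] that show thesis unfolding d_def L_def by (elim bexE exE conjE)
    qed
    have sL: "s n \<in> L" "k n \<in> L" for n using s(1) S k(1) KL by (auto simp: L_def)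
    have "v \<in> K"
      unfolding K_iff[OF v(1)]
    proof (intro allI impI)
      fix e :: real assume "e > 0"
      then have "\<forall>\<^sub>F n in sequentially. d (s (r n)) v < e" using v(3) by (rule order_tendstoD(2)[rotated])
      then show "\<exists>w\<in>S. d w v < e" using s(1) by (auto simp: eventually_sequentially)
    qed
    have "(\<lambda>n. d (k (r n)) v) \<longlonglongrightarrow> 0"
    proof (rule tendsto_sandwich[OF _ _ tendsto_const])
      show "\<forall>\<^sub>F n in sequentially. 0 \<le> d (k (r n)) v" using d0 by simp
      show "\<forall>\<^sub>F n in sequentially. d (k (r n)) v \<le> inverse (real (Suc (r n))) + d (s (r n)) v"
      proof (intro always_eventually allI)
        fix n show "d (k (r n)) v \<le> inverse (real (Suc (r n))) + d (s (r n)) v"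
          using dtri[OF sL(2)[of "r n"] sL(1)[of "r n"] v(1)] s(2)[of "r n"] d0(2)[of "s (r n)" "k (r n)"] by simp
      qed
      have "(\<lambda>n. inverse (real (Suc (r n)))) \<longlonglongrightarrow> 0"
        using LIMSEQ_subseq_LIMSEQ[OF LIMSEQ_inverse_real_of_nat v(2)] by (simp add: comp_def)
      from tendsto_add[OF this v(3)] show "(\<lambda>n. inverse (real (Suc (r n))) + d (s (r n)) v) \<longlonglongrightarrow> 0" by simp
    qed
    then have "(\<lambda>n. d ((\<sigma> \<circ> r) n) (q v)) \<longlonglongrightarrow> 0"
      using dq[OF sL(2) v(1)] k(2) by simp
    then have "limitin Q.mtopology (\<sigma> \<circ> r) (q v) sequentially"
      unfolding Q.limit_metric_sequentially
    proof (intro conjI allI impI)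
      show "q v \<in> q ` L" using v(1) by (rule imageI)
      fix e :: real assume "e > 0"
      with \<open>(\<lambda>n. d ((\<sigma> \<circ> r) n) (q v)) \<longlonglongrightarrow> 0\<close> have "\<forall>\<^sub>F n in sequentially. d ((\<sigma> \<circ> r) n) (q v) < e"
        by (rule order_tendstoD(2))
      then obtain N where "\<forall>n\<ge>N. d ((\<sigma> \<circ> r) n) (q v) < e"
        unfolding eventually_sequentially by (elim exE)
      moreover have "(\<sigma> \<circ> r) n \<in> q ` L" for n using sL(2) k(2) by simp
      ultimately show "\<exists>N. \<forall>n\<ge>N. (\<sigma> \<circ> r) n \<in> q ` L \<and> d ((\<sigma> \<circ> r) n) (q v) < e"
        by (intro exI[of _ N]) simp
    qed
    then show "\<exists>l r. l \<in> q ` K \<and> strict_mono r \<and> limitin Q.mtopology (\<sigma> \<circ> r) l sequentially"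
      using \<open>v \<in> K\<close> v(2) by blast
  qed
  then have Kc: "compactin Q.mtopology (q ` K)" .
  show ?thesis
    unfolding compactin_def K_def[symmetric]
  proof (intro conjI allI impI)
    show "K \<subseteq> topspace (Lp_topology p T)" using KL by (simp add: L_def)
    fix \<U> assume \<U>: "(\<forall>U\<in>\<U>. openin (Lp_topology p T) U) \<and> K \<subseteq> \<Union>\<U>"
    have ball: "\<exists>e>0. \<forall>w\<in>L. d w v < e \<longrightarrow> w \<in> U" if "U \<in> \<U>" "v \<in> U" for v U
      using \<U> that by (simp add: openin_Lp_topology d_def L_def)
    have sat: "u \<in> U" if "U \<in> \<U>" "v \<in> U" "u \<in> L" "d u v = 0" for u v U
      using ball[OF that(1,2)] that(3,4) by auto
    have UL: "U \<subseteq> L" if "U \<in> \<U>" for U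
      using \<U> that openin_subset[of "Lp_topology p T" U] by (auto simp: L_def)
    have "openin Q.mtopology (q ` U)" if U: "U \<in> \<U>" for U
      unfolding Q.openin_mtopology
    proof (intro conjI allI impI)
      show "q ` U \<subseteq> q ` L" using UL[OF U] by blast
      fix x assume "x \<in> q ` U"
      then obtain v where v: "v \<in> U" "x = q v" by blast
      obtain e where e: "e > 0" "\<And>w. w \<in> L \<Longrightarrow> d w v < e \<Longrightarrow> w \<in> U"
        using ball[OF U v(1)] by auto
      have "Q.mball x e \<subseteq> q ` U"
      proof
        fix y assume "y \<in> Q.mball x e"
        then obtain w where w: "w \<in> L" "y = q w" "d x y < e" by (auto simp: Q.mball_def)
        have "v \<in> L" using v(1) UL[OF U] by blast
        then have "d w v < e" using dq[of v w] w v(2) d0(2)[of v w] by simp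
        then show "y \<in> q ` U" using e(2)[OF w(1)] w(2) by simp
      qed
      then show "\<exists>r>0. Q.mball x r \<subseteq> q ` U" using e(1) by blast
    qed
    moreover have "q ` K \<subseteq> \<Union> ((`) q ` \<U>)" using \<U> by blast
    ultimately obtain \<F> where \<F>: "finite \<F>" "\<F> \<subseteq> (`) q ` \<U>" "q ` K \<subseteq> \<Union>\<F>"
    proof -
      assume "\<And>U. U \<in> \<U> \<Longrightarrow> openin Q.mtopology (q ` U)" and *: "q ` K \<subseteq> \<Union> ((`) q ` \<U>)"
      then have "\<forall>V\<in>(`) q ` \<U>. openin Q.mtopology V" by simp
      with * Kc have "\<exists>\<F>. finite \<F> \<and> \<F> \<subseteq> (`) q ` \<U> \<and> q ` K \<subseteq> \<Union>\<F>"
        unfolding compactin_def by simp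
      with that show thesis by (elim exE conjE)
    qed
    obtain \<V> where \<V>: "\<V> \<subseteq> \<U>" "finite \<V>" "\<F> = (`) q ` \<V>"
      using finite_subset_image[OF \<F>(1,2)] by blast
    have "K \<subseteq> \<Union>\<V>"
    proof
      fix u assume u: "u \<in> K"
      then obtain U v where U: "U \<in> \<V>" "v \<in> U" "q u = q v" using \<F>(3) \<V>(3) by blast
      have "u \<in> L" "v \<in> L" using u U KL UL \<V>(1) by blast+
      then have "d u v = 0" using dq[of u v] U(3) d0(3) by simp
      then show "u \<in> \<Union>\<V>" using sat[of U v u] U \<V>(1) \<open>u \<in> L\<close> by blast
    qed
    then show "\<exists>\<F>. finite \<F> \<and> \<F> \<subseteq> \<U> \<and> K \<subseteq> \<Union>\<F>" using \<V> by blast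
  qed
qed

section \<open>Convex integral functionals\<close>

text \<open>This is completeness of Lebesgue measure. It is needed because \<open>f t\<close> is
  continuous for almost every \<open>t\<close> only.\<close>

lemma borel_measurable_lebesgue_on_AE:
  fixes g h :: "real \<Rightarrow> 'b::euclidean_space"
  assumes S: "S \<in> sets lebesgue" and h: "h \<in> borel_measurable (lebesgue_on S)"
    and ae: "AE t in lebesgue_on S. h t = g t"
  shows "g \<in> borel_measurable (lebesgue_on S)"
proof -
  have "(\<lambda>t. if t \<in> S then h t else 0) \<in> borel_measurable lebesgue"
    using h borel_measurable_if[OF S] by blast
  moreover have "AE t in lebesgue. (if t \<in> S then h t else 0) = (if t \<in> S then g t else 0)"
    using ae S by (auto simp: AE_restrict_space_iff elim!: eventually_mono)
  ultimately have "(\<lambda>t. if t \<in> S then g t else 0) \<in> borel_measurable lebesgue"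
    by (rule borel_measurable_AE)
  then show ?thesis using borel_measurable_if[OF S] by blast
qed

text \<open>For a simple function the composition is pieced together from finitely many measurable
  sections \<open>f t v\<close>. Continuity in the second argument carries this to the limit at
  almost every \<open>t\<close>.\<close>

lemma borel_measurable_caratheodory:
  fixes f :: "real \<Rightarrow> 'a::euclidean_space \<Rightarrow> real"
  assumes S: "S \<in> sets lebesgue"
    and f: "\<And>v. (\<lambda>t. f t v) \<in> borel_measurable (lebesgue_on S)"
    and cont: "AE t in lebesgue_on S. continuous_on UNIV (f t)"
    and u: "u \<in> borel_measurable (lebesgue_on S)"
  shows "(\<lambda>t. f t (u t)) \<in> borel_measurable (lebesgue_on S)"
proof -
  obtain s where s: "\<And>i. simple_function (lebesgue_on S) (s i)" "\<And>t. t \<in> S \<Longrightarrow> (\<lambda>i. s i t) \<longlonglongrightarrow> u t"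
    using borel_measurable_implies_sequence_metric[OF u, of 0] by auto
  have meas: "(\<lambda>t. f t (s i t)) \<in> borel_measurable (lebesgue_on S)" for i
  proof (rule measurable_compose_countable'[where g="s i" and I="s i ` S"])
    show "s i \<in> measurable (lebesgue_on S) (count_space (s i ` S))"
      using s(1)[of i] by (auto simp: simple_function_def measurable_count_space_eq2)
    show "countable (s i ` S)"
      using s(1)[of i] by (simp add: simple_function_def countable_finite)
  qed (rule f)
  have ae: "AE t in lebesgue_on S. lim (\<lambda>i. f t (s i t)) = f t (u t)"
    using cont AE_space
  proof eventually_elim
    case (elim t)
    have "isCont (f t) (u t)" using elim(1) by (simp add: continuous_on_eq_continuous_at)
    moreover have "(\<lambda>i. s i t) \<longlonglongrightarrow> u t" using elim(2) s(2) by simp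
    ultimately have "(\<lambda>i. f t (s i t)) \<longlonglongrightarrow> f t (u t)" by (rule isCont_tendsto_compose)
    then show ?case by (rule limI)
  qed
  have "(\<lambda>t. lim (\<lambda>i. f t (s i t))) \<in> borel_measurable (lebesgue_on S)"
    using meas by (rule borel_measurable_lim_metric)
  from borel_measurable_lebesgue_on_AE[OF S this ae] show ?thesis .
qed

lemma extended_integral_eq_integral:
  assumes "integrable M g"
  shows "extended_integral M g = ereal (integral\<^sup>L M g)"
proof -
  have g: "g \<in> borel_measurable M" using assms by simp
  have fin: "(\<integral>\<^sup>+x. ennreal (g x) \<partial>M) \<noteq> \<infinity>" "(\<integral>\<^sup>+x. ennreal (- g x) \<partial>M) \<noteq> \<infinity>"
    using assms by (auto simp: real_integrable_def)
  have "enn2ereal a = ereal (enn2real a)" if "a \<noteq> \<infinity>" for a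
    using that by (metis enn2ereal_ennreal enn2real_nonneg ennreal_enn2real_if infinity_ennreal_def)
  then show ?thesis
    using fin assms by (simp add: extended_integral_def real_lebesgue_integral_def)
qed

text \<open>The integrable minorant keeps the negative part finite, so a failure of integrability
  must come from the positive part.\<close>

lemma extended_integral_eq_PInf:
  assumes g: "g \<in> borel_measurable M" and c: "integrable M c" and le: "AE x in M. - c x \<le> g x"
    and not: "\<not> integrable M g"
  shows "extended_integral M g = \<infinity>"
proof -
  have "(\<integral>\<^sup>+x. ennreal (- g x) \<partial>M) \<le> (\<integral>\<^sup>+x. ennreal (norm (c x)) \<partial>M)"
    using le by (intro nn_integral_mono_AE) (auto elim!: eventually_mono intro!: ennreal_leI)
  also have "\<dots> < \<infinity>" using c by (simp add: integrable_iff_bounded)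
  finally have neg: "(\<integral>\<^sup>+x. ennreal (- g x) \<partial>M) < \<infinity>" .
  then have "(\<integral>\<^sup>+x. ennreal (g x) \<partial>M) = \<infinity>"
    using not g by (auto simp: real_integrable_def)
  moreover obtain r where "enn2ereal (\<integral>\<^sup>+x. ennreal (- g x) \<partial>M) = ereal r"
    using neg by (metis enn2ereal_ennreal ennreal_cases infinity_ennreal_def less_irrefl)
  ultimately show ?thesis by (simp add: extended_integral_def)
qed

lemma integrable_between:
  fixes g h l :: "'a \<Rightarrow> real"
  assumes "g \<in> borel_measurable M" "integrable M l" "integrable M h"
    "AE x in M. l x \<le> g x" "AE x in M. g x \<le> h x"
  shows "integrable M g"
proof (rule Bochner_Integration.integrable_bound[where f="\<lambda>x. \<bar>l x\<bar> + \<bar>h x\<bar>"])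
  show "AE x in M. norm (g x) \<le> norm (\<bar>l x\<bar> + \<bar>h x\<bar>)"
    using assms(4,5) by eventually_elim auto
qed (use assms in auto)

text \<open>Stated with convergent upper bounds \<open>B n\<close>, so that a convergent part of a
  total cost, such as the end-point cost, can be moved to the right-hand side.\<close>

lemma fatou_integrable:
  fixes g :: "nat \<Rightarrow> 'a \<Rightarrow> real"
  assumes int: "\<And>n. integrable M (g n)" and nonneg: "\<And>n. AE x in M. 0 \<le> g n x"
    and le: "\<And>n. integral\<^sup>L M (g n) \<le> B n" and B: "B \<longlonglongrightarrow> b"
    and h: "h \<in> borel_measurable M" and lim: "AE x in M. (\<lambda>n. g n x) \<longlonglongrightarrow> h x"
  shows "integrable M h" "integral\<^sup>L M h \<le> b"
proof -
  have nn: "AE x in M. \<forall>n. 0 \<le> g n x" using nonneg by (simp add: AE_all_countable)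
  have h0: "AE x in M. 0 \<le> h x"
    using nn lim by eventually_elim (auto intro: LIMSEQ_le_const)
  have B0: "0 \<le> B n" for n
    using le[of n] integral_nonneg_AE[OF nonneg[of n]] by linarith
  have b0: "0 \<le> b" using B B0 by (auto intro: LIMSEQ_le_const)
  have "(\<integral>\<^sup>+x. ennreal (h x) \<partial>M) = (\<integral>\<^sup>+x. liminf (\<lambda>n. ennreal (g n x)) \<partial>M)"
  proof (rule nn_integral_cong_AE)
    show "AE x in M. ennreal (h x) = liminf (\<lambda>n. ennreal (g n x))"
      using lim
    proof eventually_elim
      case (elim x)
      then have "(\<lambda>n. ennreal (g n x)) \<longlonglongrightarrow> ennreal (h x)" by (rule tendsto_ennrealI)
      then show ?case using lim_imp_Liminf trivial_limit_sequentially by metis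
    qed
  qed
  also have "\<dots> \<le> liminf (\<lambda>n. \<integral>\<^sup>+x. ennreal (g n x) \<partial>M)"
    using int by (intro nn_integral_liminf) auto
  also have "\<dots> \<le> liminf (\<lambda>n. ennreal (B n))"
  proof (intro Liminf_mono always_eventually allI)
    fix n
    have "(\<integral>\<^sup>+x. ennreal (g n x) \<partial>M) = ennreal (integral\<^sup>L M (g n))"
      by (rule nn_integral_eq_integral[OF int nonneg])
    then show "(\<integral>\<^sup>+x. ennreal (g n x) \<partial>M) \<le> ennreal (B n)" using le by (simp add: ennreal_leI)
  qed
  also have "\<dots> = ennreal b"
    using B by (intro lim_imp_Liminf tendsto_ennrealI) auto
  finally have *: "(\<integral>\<^sup>+x. ennreal (h x) \<partial>M) \<le> ennreal b" .
  show hi: "integrable M h"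
    using h h0 * by (intro integrableI_nonneg) (auto intro: le_less_trans)
  show "integral\<^sup>L M h \<le> b"
    using * nn_integral_eq_integral[OF hi h0] b0 by (simp add: ennreal_le_iff)
qed

section \<open>The midpoint convexity gap and strict convexity\<close>

definition convexity_gap :: "('a::real_vector \<Rightarrow> real) \<Rightarrow> 'a \<Rightarrow> 'a \<Rightarrow> real" where
  "convexity_gap g x y = (g x + g y) / 2 - g ((1/2) *\<^sub>R (x + y))"

lemma convexity_gap_nonneg:
  assumes "convex_on UNIV g" shows "0 \<le> convexity_gap g x y"
  using convex_onD[OF assms, of "1/2" x y] by (simp add: convexity_gap_def scaleR_add_right)

lemma convexity_gap_pos:
  assumes "strictly_convex g" "x \<noteq> y" shows "0 < convexity_gap g x y"
proof -
  have "g ((1 - 1/2) *\<^sub>R x + (1/2) *\<^sub>R y) < (1 - 1/2) * g x + (1/2) * g y"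
    using assms(1)[unfolded strictly_convex_def, rule_format, OF assms(2), of "1/2"] by simp
  then show ?thesis by (simp add: convexity_gap_def scaleR_add_right)
qed

text \<open>Otherwise compactness of the ball of radius \<open>K\<close> yields limits
  \<open>a\<close> and \<open>b\<close> at distance at least \<open>e\<close> with gap 0. The
  truncation is essential: strict convexity gives no uniform lower bound of the gap for separated
  pairs that escape to infinity.\<close>

lemma truncated_diff_tendsto_0:
  fixes x y :: "nat \<Rightarrow> 'a::euclidean_space"
  assumes g: "strictly_convex g" "continuous_on UNIV g"
    and lim: "(\<lambda>k. convexity_gap g (x k) (y k)) \<longlonglongrightarrow> 0"
  shows "(\<lambda>k. if norm (x k) \<le> K \<and> norm (y k) \<le> K then norm (x k - y k) else 0) \<longlonglongrightarrow> 0"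
    (is "?h \<longlonglongrightarrow> 0")
proof (rule ccontr)
  assume "\<not> ?h \<longlonglongrightarrow> 0"
  then obtain e where e: "e > 0" "\<And>N. \<exists>n\<ge>N. \<not> norm (?h n - 0) < e"
    unfolding LIMSEQ_iff by blast
  have "\<exists>n\<ge>N. norm (x n) \<le> K \<and> norm (y n) \<le> K \<and> e \<le> norm (x n - y n)" for N
    using e(2)[of N] e(1) by (auto split: if_splits)
  \<comment> \<open>\<open>s\<close> need not be monotone; \<open>N \<le> s N\<close> is enough for
    the indices to tend to infinity.\<close>
  then obtain s where s: "\<And>N. N \<le> s N" "\<And>N. norm (x (s N)) \<le> K" "\<And>N. norm (y (s N)) \<le> K"
      "\<And>N. e \<le> norm (x (s N) - y (s N))"
    by metis
  have "compact (cball (0::'a) K \<times> cball (0::'a) K)" by (intro compact_Times compact_cball)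
  moreover have "\<forall>N. (x (s N), y (s N)) \<in> cball 0 K \<times> cball 0 K" using s by simp
  ultimately obtain l r where l: "strict_mono r" "((\<lambda>N. (x (s N), y (s N))) \<circ> r) \<longlonglongrightarrow> l"
    by (meson compact_imp_seq_compact seq_compactE)
  define a b where "a = fst l" and "b = snd l"
  have xa: "(\<lambda>N. x (s (r N))) \<longlonglongrightarrow> a" and yb: "(\<lambda>N. y (s (r N))) \<longlonglongrightarrow> b"
    using tendsto_fst[OF l(2)] tendsto_snd[OF l(2)] by (simp_all add: a_def b_def comp_def)
  have "(\<lambda>N. norm (x (s (r N)) - y (s (r N)))) \<longlonglongrightarrow> norm (a - b)"
    by (intro tendsto_intros xa yb)
  then have "e \<le> norm (a - b)" using s(4) by (intro LIMSEQ_le_const) auto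
  then have pos: "0 < convexity_gap g a b" using e(1) by (intro convexity_gap_pos g) auto
  have cont: "(\<lambda>N. g (z N)) \<longlonglongrightarrow> g c" if "z \<longlonglongrightarrow> c" for z c
    using that g(2) by (intro isCont_tendsto_compose[of _ g]) (auto simp: continuous_on_eq_continuous_at)
  have lim1: "(\<lambda>N. convexity_gap g (x (s (r N))) (y (s (r N)))) \<longlonglongrightarrow> convexity_gap g a b"
    unfolding convexity_gap_def by (intro tendsto_intros cont xa yb) auto
  have "filterlim (\<lambda>N. s (r N)) sequentially sequentially"
  proof (rule filterlim_at_top_mono[OF filterlim_ident])
    show "\<forall>\<^sub>F N in sequentially. N \<le> s (r N)"
      using s(1) seq_suble[OF l(1)] by (intro always_eventually allI) (meson order_trans)
  qed
  then have "(\<lambda>N. convexity_gap g (x (s (r N))) (y (s (r N)))) \<longlonglongrightarrow> 0"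
    by (rule filterlim_compose[OF lim])
  from LIMSEQ_unique[OF lim1 this] pos show False by simp
qed

locale convex_integrand =
  fixes p T C :: real and f :: "real \<Rightarrow> 'a::euclidean_space \<Rightarrow> real" and c :: "real \<Rightarrow> real"
  assumes p: "1 < p" and T: "0 < T" and C: "0 < C"
    and f_measurable: "\<And>v. (\<lambda>t. f t v) \<in> borel_measurable (lebesgue_on {0..T})"
    and f_convex: "AE t in lebesgue_on {0..T}. continuous_on UNIV (f t) \<and> convex_on UNIV (f t)"
    and c_integrable: "integrable (lebesgue_on {0..T}) c"
    and f_coercive: "AE t in lebesgue_on {0..T}. \<forall>v. f t v \<ge> C * norm v powr p - c t"
    and f_strict: "AE t in lebesgue_on {0..T}. strictly_convex (f t)"
begin

abbreviation M :: "real measure" where "M \<equiv> lebesgue_on {0..T}"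

abbreviation running_cost :: "(real \<Rightarrow> 'a) \<Rightarrow> real" where
  "running_cost u \<equiv> LINT t|M. f t (u t)"

lemma p0: "0 < p" using p by simp

lemma f_compose_measurable:
  assumes "u \<in> borel_measurable M"
  shows "(\<lambda>t. f t (u t)) \<in> borel_measurable M"
proof (rule borel_measurable_caratheodory[OF _ f_measurable _ assms])
  show "AE t in M. continuous_on UNIV (f t)"
    using f_convex by eventually_elim simp
qed simp

lemma f_lower: "AE t in M. - c t \<le> f t (u t)"
  using f_coercive
proof eventually_elim
  case (elim t)
  have "0 \<le> C * norm (u t) powr p" using C by simp
  then show ?case using elim[rule_format, of "u t"] by linarith
qed

lemma extended_running_cost:
  assumes "u \<in> borel_measurable M"
  shows "extended_integral M (\<lambda>t. f t (u t)) = (if integrable M (\<lambda>t. f t (u t)) then ereal (running_cost u) else \<infinity>)"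
  using extended_integral_eq_integral extended_integral_eq_PInf[OF f_compose_measurable[OF assms] c_integrable f_lower]
  by auto

lemma running_cost_lower:
  assumes "integrable M (\<lambda>t. f t (u t))"
  shows "- integral\<^sup>L M c \<le> running_cost u"
  using integral_mono_AE[OF _ assms f_lower] c_integrable by simp

text \<open>Convexity squeezes the cost of the midpoint between \<open>- c\<close> and the mean of
  the two given costs, both of which are integrable.\<close>

lemma midpoint_cost:
  assumes u: "u \<in> borel_measurable M" "integrable M (\<lambda>t. f t (u t))"
    and v: "v \<in> borel_measurable M" "integrable M (\<lambda>t. f t (v t))"
  shows "integrable M (\<lambda>t. f t ((1/2) *\<^sub>R (u t + v t)))"
    and "integrable M (\<lambda>t. convexity_gap (f t) (u t) (v t))"
    and "(LINT t|M. convexity_gap (f t) (u t) (v t)) =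
      (running_cost u + running_cost v) / 2 - running_cost (\<lambda>t. (1/2) *\<^sub>R (u t + v t))"
    and "AE t in M. 0 \<le> convexity_gap (f t) (u t) (v t)"
proof -
  show gap: "AE t in M. 0 \<le> convexity_gap (f t) (u t) (v t)"
    using f_convex by eventually_elim (simp add: convexity_gap_nonneg)
  show mid: "integrable M (\<lambda>t. f t ((1/2) *\<^sub>R (u t + v t)))"
  proof (rule integrable_between[where l="\<lambda>t. - c t" and h="\<lambda>t. (f t (u t) + f t (v t)) / 2"])
    show "(\<lambda>t. f t ((1/2) *\<^sub>R (u t + v t))) \<in> borel_measurable M"
      using u(1) v(1) by (intro f_compose_measurable) auto
    show "AE t in M. f t ((1/2) *\<^sub>R (u t + v t)) \<le> (f t (u t) + f t (v t)) / 2"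
      using gap by eventually_elim (simp add: convexity_gap_def)
  qed (use f_lower c_integrable u v in auto)
  show "integrable M (\<lambda>t. convexity_gap (f t) (u t) (v t))"
    "(LINT t|M. convexity_gap (f t) (u t) (v t)) =
      (running_cost u + running_cost v) / 2 - running_cost (\<lambda>t. (1/2) *\<^sub>R (u t + v t))"
    unfolding convexity_gap_def using mid u v by simp_all
qed

text \<open>When the larger of the two norms exceeds \<open>K\<close>, the difference is at most
  twice that norm, to which the tail bound applies. Allowing for either function to be the larger
  one doubles the factor 2 to 4.\<close>

lemma truncation_error:
  fixes u v :: "real \<Rightarrow> 'a"
  assumes u: "u \<in> Lp_ball p T R" and v: "v \<in> Lp_ball p T R" and K: "0 < K"
  defines "h \<equiv> \<lambda>t. if norm (u t) \<le> K \<and> norm (v t) \<le> K then norm (u t - v t) else 0"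
  shows "integrable M h"
    and "(LINT t|M. norm (u t - v t)) \<le> integral\<^sup>L M h + 4 * (K powr (1 - p) * R powr p)"
proof -
  note uD = Lp_ballD[OF u p0] and vD = Lp_ballD[OF v p0]
  note ui = Lp_fun_imp_integrable[OF uD(1) p] and vi = Lp_fun_imp_integrable[OF vD(1) p]
  have [measurable]: "u \<in> borel_measurable M" "v \<in> borel_measurable M"
    using uD vD by (auto dest: Lp_funD)
  have hm: "h \<in> borel_measurable M" unfolding h_def by measurable
  have uvi: "integrable M (\<lambda>t. norm (u t - v t))" using ui vi by auto
  show hi: "integrable M h"
    by (rule Bochner_Integration.integrable_bound[OF uvi hm]) (auto simp: h_def)
  have pt: "norm (x - y) \<le> (if norm x \<le> K \<and> norm y \<le> K then norm (x - y) else 0) +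
      2 * (K powr (1 - p) * norm x powr p + K powr (1 - p) * norm y powr p)" for x y :: 'a
  proof -
    have *: "norm x \<le> K powr (1 - p) * norm x powr p" if "K \<le> norm x" for x :: 'a
      using tail_le_powr[OF p K that] .
    have nn: "0 \<le> K powr (1 - p) * norm x powr p" for x :: 'a by simp
    have tri: "norm (x - y) \<le> norm x + norm y" by (rule norm_triangle_ineq4)
    have if_nonneg: "0 \<le> (if norm x \<le> K \<and> norm y \<le> K then norm (x - y) else 0)" by simp
    consider "norm x \<le> K" "norm y \<le> K" | "K \<le> norm x" "norm y \<le> norm x" | "K \<le> norm y" "norm x \<le> norm y"
      by linarith
    then show ?thesis
    proof cases
      case 1 then show ?thesis using nn[of x] nn[of y] by simp
    next
      case 2
      have "norm (x - y) \<le> 2 * (K powr (1 - p) * norm x powr p)" using *[OF 2(1)] 2(2) tri by linarith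
      then show ?thesis using nn[of y] if_nonneg unfolding distrib_left by linarith
    next
      case 3
      have "norm (x - y) \<le> 2 * (K powr (1 - p) * norm y powr p)" using *[OF 3(1)] 3(2) tri by linarith
      then show ?thesis using nn[of x] if_nonneg unfolding distrib_left by linarith
    qed
  qed
  have i: "integrable M (\<lambda>t. norm (u t) powr p)" "integrable M (\<lambda>t. norm (v t) powr p)"
    using uD vD by (auto dest: Lp_funD)
  have "(LINT t|M. norm (u t - v t)) \<le>
     (LINT t|M. h t + 2 * (K powr (1 - p) * norm (u t) powr p + K powr (1 - p) * norm (v t) powr p))"
  proof (rule integral_mono[OF uvi])
    fix t show "norm (u t - v t) \<le> h t + 2 * (K powr (1 - p) * norm (u t) powr p + K powr (1 - p) * norm (v t) powr p)"
      using pt[of "u t" "v t"] by (simp only: h_def)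
  qed (use hi i in auto)
  also have "\<dots> = integral\<^sup>L M h + 2 * (K powr (1 - p) * (LINT t|M. norm (u t) powr p) + K powr (1 - p) * (LINT t|M. norm (v t) powr p))"
    using hi i by simp
  also have "\<dots> \<le> integral\<^sup>L M h + 2 * (K powr (1 - p) * R powr p + K powr (1 - p) * R powr p)"
    using uD vD by (intro add_left_mono mult_left_mono add_mono) auto
  finally show "(LINT t|M. norm (u t - v t)) \<le> integral\<^sup>L M h + 4 * (K powr (1 - p) * R powr p)" by (simp add: mult.commute)
qed

text \<open>
  A sequence of pairs with vanishing mean convexity gap has, along a subsequence, an almost
  everywhere vanishing gap; strict convexity and dominated convergence give convergence of the
  truncated differences.
\<close>

lemma L1_diff_small:
  assumes u: "\<And>k. u k \<in> Lp_ball p T R" "\<And>k. integrable M (\<lambda>t. f t (u k t))"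
    and v: "\<And>k. v k \<in> Lp_ball p T R" "\<And>k. integrable M (\<lambda>t. f t (v k t))"
    and gap: "(\<lambda>k. LINT t|M. convexity_gap (f t) (u k t) (v k t)) \<longlonglongrightarrow> 0"
    and e: "0 < e"
  shows "\<exists>k. (LINT t|M. norm (u k t - v k t)) < e"
proof -
  have um: "u k \<in> borel_measurable M" and vm: "v k \<in> borel_measurable M" for k
    using u(1)[of k] v(1)[of k] p0 by (auto dest!: Lp_ballD(1) Lp_funD(1))
  note mc = midpoint_cost[OF um u(2) vm v(2)]
  have "(LINT t|M. norm (convexity_gap (f t) (u k t) (v k t))) = (LINT t|M. convexity_gap (f t) (u k t) (v k t))" for k
    using mc(4)[of k k] mc(2)[of k k] by (intro integral_cong_AE) (auto elim!: eventually_mono)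
  then have "(\<lambda>k. LINT t|M. norm (convexity_gap (f t) (u k t) (v k t))) \<longlonglongrightarrow> 0" using gap by simp
  from tendsto_L1_AE_subseq[OF mc(2) this]
  obtain r where r: "strict_mono r" "AE t in M. (\<lambda>k. convexity_gap (f t) (u (r k) t) (v (r k) t)) \<longlonglongrightarrow> 0"
    by blast
  \<comment> \<open>The truncation error carries the factor 4, so \<open>e / 8\<close> leaves
    \<open>e / 2\<close> for the truncated integral.\<close>
  obtain K where K: "0 < K" "K powr (1 - p) * R powr p < e / 8"
    using tail_factor_small[OF p, of "e / 8" "R powr p"] e by auto
  define h where "h k t = (if norm (u (r k) t) \<le> K \<and> norm (v (r k) t) \<le> K then norm (u (r k) t - v (r k) t) else 0)" for k t
  have hi: "integrable M (h k)" for k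
    unfolding h_def by (rule truncation_error(1)[OF u(1) v(1) K(1)])
  have "(\<lambda>k. integral\<^sup>L M (h k)) \<longlonglongrightarrow> (LINT t|M. 0)"
  proof (rule integral_dominated_convergence[where w="\<lambda>_. 2 * K"])
    show "AE t in M. (\<lambda>k. h k t) \<longlonglongrightarrow> 0"
      using r(2) f_strict f_convex
      by eventually_elim (auto simp: h_def intro!: truncated_diff_tendsto_0)
    have "norm (h k t) \<le> 2 * K" for k t
      using norm_triangle_ineq4[of "u (r k) t" "v (r k) t"] K(1) by (auto simp: h_def)
    then show "AE t in M. norm (h k t) \<le> 2 * K" for k by simp
  qed (use hi in auto)
  then have "(\<lambda>k. integral\<^sup>L M (h k)) \<longlonglongrightarrow> 0" by simp
  then have "\<forall>\<^sub>F k in sequentially. integral\<^sup>L M (h k) < e / 2"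
    using e by (intro order_tendstoD(2)) auto
  then obtain k where "integral\<^sup>L M (h k) < e / 2"
    using eventually_happens'[OF sequentially_bot] by blast
  moreover have "(LINT t|M. norm (u (r k) t - v (r k) t)) \<le> integral\<^sup>L M (h k) + 4 * (K powr (1 - p) * R powr p)"
    unfolding h_def by (rule truncation_error(2)[OF u(1) v(1) K(1)])
  ultimately have "(LINT t|M. norm (u (r k) t - v (r k) t)) < e" using K(2) by simp
  then show ?thesis by blast
qed

text \<open>A Scheffe argument for the nonnegative functions \<open>f + c\<close>: a.e. convergence
  and an upper bound on the limit of the integrals give convergence in \<open>L1\<close>. Coercivity
  bounds the \<open>p\<close>-th powers of the controls by these functions, and a dominated
  convergence with varying majorants finishes.\<close>

lemma Lp_tendsto_of_cost_tendsto:
  assumes u: "\<And>n. u n \<in> Lp_fun p T" "\<And>n. integrable M (\<lambda>t. f t (u n t))"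
    and v: "v \<in> Lp_fun p T" "integrable M (\<lambda>t. f t (v t))"
    and ae: "AE t in M. (\<lambda>n. u n t) \<longlonglongrightarrow> v t"
    and le: "\<And>n. running_cost (u n) \<le> running_cost v + \<delta> n" and \<delta>: "\<delta> \<longlonglongrightarrow> 0"
  shows "(\<lambda>n. Lp_norm p T (\<lambda>t. u n t - v t)) \<longlonglongrightarrow> 0"
proof -
  define h where "h n t = f t (u n t) + c t" for n t
  define g where "g t = f t (v t) + c t" for t
  have hi: "integrable M (h n)" for n unfolding h_def using u(2) c_integrable by auto
  have gi: "integrable M g" unfolding g_def using v(2) c_integrable by auto
  have um: "u n \<in> borel_measurable M" for n using u(1) by (rule Lp_funD(1))
  have vm: "v \<in> borel_measurable M" using v(1) by (rule Lp_funD(1))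
  have lim: "AE t in M. (\<lambda>n. h n t) \<longlonglongrightarrow> g t"
    using ae f_convex
  proof eventually_elim
    case (elim t)
    then have "(\<lambda>n. f t (u n t)) \<longlonglongrightarrow> f t (v t)"
      by (intro isCont_tendsto_compose[of _ "f t"]) (auto simp: continuous_on_eq_continuous_at)
    then show ?case by (auto simp: h_def g_def intro: tendsto_intros)
  qed
  have hn: "AE t in M. C * norm (u n t) powr p \<le> h n t" for n
    using f_coercive by eventually_elim (simp add: h_def diff_le_eq)
  have gn: "AE t in M. C * norm (v t) powr p \<le> g t"
    using f_coercive by eventually_elim (simp add: g_def diff_le_eq)
  have nonneg: "0 \<le> C * norm (x::'a) powr p" for x using C by simp
  have hn0: "AE t in M. 0 \<le> h n t" for n using hn[of n] by eventually_elim (rule order_trans[OF nonneg])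
  have gn0: "AE t in M. 0 \<le> g t" using gn by eventually_elim (rule order_trans[OF nonneg])
  \<comment> \<open>The positive part of \<open>g - h n\<close> is dominated by \<open>g\<close>, so
    its integral tends to 0. The identity
    \<open>\<bar>h n t - g t\<bar> = (h n t - g t) + 2 * z n t\<close> then reduces
    \<open>L1\<close> convergence to the assumed cost bound.\<close>
  define z where "z n t = max 0 (g t - h n t)" for n t
  have zi: "integrable M (z n)" for n unfolding z_def using gi hi by auto
  have "(\<lambda>n. integral\<^sup>L M (z n)) \<longlonglongrightarrow> (LINT t|M. 0)"
  proof (rule integral_dominated_convergence[OF _ _ gi])
    show "AE t in M. (\<lambda>n. z n t) \<longlonglongrightarrow> 0"
      using lim
    proof eventually_elim
      case (elim t)
      have "(\<lambda>n. max 0 (g t - h n t)) \<longlonglongrightarrow> max 0 (g t - g t)" by (intro tendsto_intros elim)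
      then show ?case by (simp add: z_def)
    qed
    show "AE t in M. norm (z n t) \<le> g t" for n
      using hn0[of n] gn0 by eventually_elim (auto simp: z_def)
  qed (use zi in auto)
  then have z0: "(\<lambda>n. integral\<^sup>L M (z n)) \<longlonglongrightarrow> 0" by simp
  have l1: "(LINT t|M. \<bar>h n t - g t\<bar>) \<le> \<delta> n + 2 * integral\<^sup>L M (z n)" for n
  proof -
    have "(LINT t|M. \<bar>h n t - g t\<bar>) = (LINT t|M. (h n t - g t) + 2 * z n t)"
      by (intro Bochner_Integration.integral_cong) (auto simp: z_def max_def abs_if)
    also have "\<dots> = (integral\<^sup>L M (h n) - integral\<^sup>L M g) + 2 * integral\<^sup>L M (z n)"
      using hi gi zi by simp
    also have "integral\<^sup>L M (h n) - integral\<^sup>L M g = running_cost (u n) - running_cost v"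
      unfolding h_def g_def using u(2) v(2) c_integrable by simp
    finally show ?thesis using le[of n] by simp
  qed
  \<comment> \<open>The factor \<open>2 powr p\<close> comes from estimating the power of a
    difference, and \<open>1 / C\<close> from coercivity.\<close>
  define K where "K = 2 powr p / C"
  have K: "0 < K" using C by (simp add: K_def)
  define d where "d n t = norm (u n t - v t) powr p" for n t
  have di: "integrable M (d n)" for n
    unfolding d_def using Lp_funD(2)[OF Lp_fun_diff[OF u(1) v(1)]] p by simp
  have dK: "AE t in M. d n t \<le> K * \<bar>h n t - g t\<bar> + 2 * K * g t" for n
    using hn[of n] gn
  proof eventually_elim
    case (elim t)
    have "d n t \<le> 2 powr p * (norm (u n t) powr p + norm (v t) powr p)"
      unfolding d_def using p by (intro norm_diff_powr_le) auto
    also have "\<dots> = K * (C * norm (u n t) powr p + C * norm (v t) powr p)"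
      using C by (simp add: K_def distrib_left)
    also have "\<dots> \<le> K * (h n t + g t)"
      using elim K by (intro mult_left_mono) auto
    also have "\<dots> \<le> K * (\<bar>h n t - g t\<bar> + 2 * g t)"
      using K by (intro mult_left_mono) auto
    finally show ?case by (simp add: distrib_left)
  qed
  \<comment> \<open>Subtracting the part of the majorant that varies with \<open>n\<close> leaves a
    function dominated by the fixed \<open>2 * K * g\<close>; the subtracted part vanishes in
    \<open>L1\<close>.\<close>
  define q where "q n t = max 0 (d n t - K * \<bar>h n t - g t\<bar>)" for n t
  have qi: "integrable M (q n)" for n unfolding q_def using di hi gi by auto
  have "(\<lambda>n. integral\<^sup>L M (q n)) \<longlonglongrightarrow> (LINT t|M. 0)"
  proof (rule integral_dominated_convergence[where w="\<lambda>t. 2 * K * g t"])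
    show "AE t in M. (\<lambda>n. q n t) \<longlonglongrightarrow> 0"
      using ae lim
    proof eventually_elim
      case (elim t)
      have "(\<lambda>n. norm (u n t - v t)) \<longlonglongrightarrow> 0"
        using elim(1) by (simp add: tendsto_norm_zero LIM_zero)
      then have "(\<lambda>n. d n t) \<longlonglongrightarrow> 0"
        unfolding d_def using p0 by (intro tendsto_zero_powrI[where b=p]) auto
      moreover have "(\<lambda>n. \<bar>h n t - g t\<bar>) \<longlonglongrightarrow> 0"
        using elim(2) by (simp add: tendsto_rabs_zero LIM_zero)
      ultimately have "(\<lambda>n. max 0 (d n t - K * \<bar>h n t - g t\<bar>)) \<longlonglongrightarrow> max 0 (0 - K * 0)"
        by (intro tendsto_intros)
      then show ?case by (simp add: q_def)
    qed
    show "AE t in M. norm (q n t) \<le> 2 * K * g t" for n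
      using dK[of n] gn0
    proof eventually_elim
      case (elim t)
      moreover have "0 \<le> 2 * K * g t" using K elim(2) by simp
      ultimately show ?case by (auto simp: q_def)
    qed
  qed (use qi gi in auto)
  then have q0: "(\<lambda>n. integral\<^sup>L M (q n)) \<longlonglongrightarrow> 0" by simp
  have dle: "integral\<^sup>L M (d n) \<le> integral\<^sup>L M (q n) + K * (\<delta> n + 2 * integral\<^sup>L M (z n))" for n
  proof -
    have "integral\<^sup>L M (d n) \<le> (LINT t|M. q n t + K * \<bar>h n t - g t\<bar>)"
      using di qi hi gi by (intro integral_mono) (auto simp: q_def)
    also have "\<dots> = integral\<^sup>L M (q n) + K * (LINT t|M. \<bar>h n t - g t\<bar>)"
      using qi hi gi by simp
    also have "\<dots> \<le> integral\<^sup>L M (q n) + K * (\<delta> n + 2 * integral\<^sup>L M (z n))"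
      using l1[of n] K by (intro add_left_mono mult_left_mono) auto
    finally show ?thesis .
  qed
  have "(\<lambda>n. integral\<^sup>L M (q n) + K * (\<delta> n + 2 * integral\<^sup>L M (z n))) \<longlonglongrightarrow> 0 + K * (0 + 2 * 0)"
    by (intro tendsto_intros q0 \<delta> z0)
  then have up: "(\<lambda>n. integral\<^sup>L M (q n) + K * (\<delta> n + 2 * integral\<^sup>L M (z n))) \<longlonglongrightarrow> 0" by simp
  have "(\<lambda>n. integral\<^sup>L M (d n)) \<longlonglongrightarrow> 0"
    by (rule tendsto_sandwich[OF _ _ tendsto_const up])
      (use dle in \<open>auto simp: d_def intro!: always_eventually\<close>)
  then have "(\<lambda>n. integral\<^sup>L M (d n) powr (1/p)) \<longlonglongrightarrow> 0"
    using p0 by (intro tendsto_zero_powrI[where b="1/p"]) (auto simp: d_def intro!: always_eventually)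
  then show ?thesis by (simp add: Lp_norm_def d_def[abs_def])
qed

end

section \<open>Equicontinuity of the primitives of a ball of controls\<close>

lemma integral_norm_interval_le:
  fixes u :: "real \<Rightarrow> 'a::euclidean_space"
  assumes p: "1 < p" and u: "u \<in> Lp_ball p T R" and st: "0 \<le> s" "s \<le> t" "t \<le> T" and K: "0 < K"
  shows "(LINT r|lebesgue_on {s..t}. norm (u r)) \<le> K * (t - s) + K powr (1 - p) * R powr p"
proof -
  have p0: "0 < p" using p by simp
  note uD = Lp_ballD[OF u p0]
  have sub: "{s..t} \<subseteq> {0..T}" using st by auto
  have up: "(\<lambda>r. norm (u r) powr p) absolutely_integrable_on {0..T}"
    using Lp_funD(2)[OF uD(1)] by (simp add: absolutely_integrable_on_iff_lebesgue_on)
  have ui: "u absolutely_integrable_on {0..T}"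
    using Lp_fun_imp_integrable[OF uD(1) p] by (simp add: absolutely_integrable_on_iff_lebesgue_on)
  have up': "integrable (lebesgue_on {s..t}) (\<lambda>r. norm (u r) powr p)"
    using absolutely_integrable_subinterval[OF up sub] by (simp add: absolutely_integrable_on_iff_lebesgue_on)
  have ui': "integrable (lebesgue_on {s..t}) u"
    using absolutely_integrable_subinterval[OF ui sub] by (simp add: absolutely_integrable_on_iff_lebesgue_on)
  have "(LINT r|lebesgue_on {s..t}. norm (u r)) \<le> (LINT r|lebesgue_on {s..t}. K + K powr (1 - p) * norm (u r) powr p)"
    using ui' up' le_const_plus_powr[OF p K] by (intro integral_mono) auto
  also have "\<dots> = K * (t - s) + K powr (1 - p) * (LINT r|lebesgue_on {s..t}. norm (u r) powr p)"
    using up' integral_const_interval[OF st(2), of K] by (simp add: mult.commute)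
  also have "(LINT r|lebesgue_on {s..t}. norm (u r) powr p) \<le> (LINT r|lebesgue_on {0..T}. norm (u r) powr p)"
    using integral_subset_le[OF sub, of "\<lambda>r. norm (u r) powr p"] up up' Lp_funD(2)[OF uD(1)]
    by (simp add: lebesgue_integral_eq_integral integrable_on_lebesgue_on)
  also have "\<dots> \<le> R powr p" by (rule uD(2))
  finally show ?thesis by (simp add: mult_left_mono)
qed

lemma norm_primitive_diff_le:
  fixes u :: "real \<Rightarrow> 'a::euclidean_space"
  assumes p: "1 < p" and u: "u \<in> Lp_ball p T R" and st: "0 \<le> s" "s \<le> t" "t \<le> T" and K: "0 < K"
  shows "norm (integral {0..t} u - integral {0..s} u) \<le> K * (t - s) + K powr (1 - p) * R powr p"
proof -
  have sub: "{s..t} \<subseteq> {0..T}" "{0..t} \<subseteq> {0..T}" using st by auto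
  have ui: "u absolutely_integrable_on {0..T}"
    using Lp_fun_imp_integrable[OF Lp_ballD(1)[OF u] p] p by (simp add: absolutely_integrable_on_iff_lebesgue_on)
  have ui': "integrable (lebesgue_on {s..t}) u"
    using absolutely_integrable_subinterval[OF ui sub(1)] by (simp add: absolutely_integrable_on_iff_lebesgue_on)
  have "u integrable_on {0..t}"
    using absolutely_integrable_subinterval[OF ui sub(2)] by (simp add: absolutely_integrable_on_def)
  then have "integral {0..s} u + integral {s..t} u = integral {0..t} u"
    using st by (intro Henstock_Kurzweil_Integration.integral_combine) auto
  then have "integral {0..t} u - integral {0..s} u = (LINT r|lebesgue_on {s..t}. u r)"
    using ui' by (simp add: lebesgue_integral_eq_integral algebra_simps)
  then have "norm (integral {0..t} u - integral {0..s} u) \<le> (LINT r|lebesgue_on {s..t}. norm (u r))"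
    using integral_norm_bound[of "lebesgue_on {s..t}" u] by simp
  with integral_norm_interval_le[OF assms] show ?thesis by linarith
qed

text \<open>The tail estimate bounds an increment by \<open>K * \<bar>t - t'\<bar>\<close> plus a
  tail that is small for large \<open>K\<close>, uniformly in the control, so Arzela-Ascoli applies.
  The limit \<open>U\<close> is not identified as a primitive: it serves to make the primitives of
  the subsequence mutually close.\<close>

lemma Lp_ball_primitives_convergent_subseq:
  fixes u :: "nat \<Rightarrow> real \<Rightarrow> 'a::euclidean_space"
  assumes p: "1 < p" and T: "0 < T" and u: "\<And>n. u n \<in> Lp_ball p T R"
  shows "\<exists>(r :: nat \<Rightarrow> nat) U. strict_mono r \<and>
    (\<forall>e>0. \<exists>N. \<forall>n\<ge>N. \<forall>t\<in>{0..T}. norm (integral {0..t} (u (r n)) - U t) < e)"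
proof -
  define V where "V n t = integral {0..t} (u n)" for n t
  have bound: "norm (V n t) \<le> 1 * T + 1 powr (1 - p) * R powr p" if "t \<in> {0..T}" for n t
    using norm_primitive_diff_le[OF p u[of n], of 0 t 1] that by (simp add: V_def)
  have equi: "\<exists>d>0. \<forall>n t'. t' \<in> {0..T} \<and> norm (t - t') < d \<longrightarrow> norm (V n t - V n t') < e"
    if t: "t \<in> {0..T}" and e: "0 < e" for t e
  proof -
    obtain K where K: "0 < K" "K powr (1 - p) * R powr p < e / 2"
      using tail_factor_small[OF p, of "e / 2" "R powr p"] e by auto
    show ?thesis
    proof (intro exI[of _ "e / (2 * K)"] conjI allI impI)
      fix n t' assume t': "t' \<in> {0..T} \<and> norm (t - t') < e / (2 * K)"
      have "norm (V n t - V n t') \<le> K * \<bar>t - t'\<bar> + K powr (1 - p) * R powr p"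
        using norm_primitive_diff_le[OF p u, of t' t K] norm_primitive_diff_le[OF p u, of t t' K] t t' K(1)
        by (cases "t' \<le> t") (auto simp: V_def norm_minus_commute)
      moreover have "K * \<bar>t - t'\<bar> < e / 2" using t' K(1) by (simp add: field_simps)
      ultimately show "norm (V n t - V n t') < e" using K(2) by simp
    qed (use e K in auto)
  qed
  show ?thesis
  proof (rule Arzela_Ascoli[of "{0..T}" V, OF compact_Icc bound equi])
    fix U and r :: "nat \<Rightarrow> nat"
    assume "strict_mono r" "\<And>e. 0 < e \<Longrightarrow> \<exists>N. \<forall>n t. n \<ge> N \<and> t \<in> {0..T} \<longrightarrow> norm (V (r n) t - U t) < e"
    note r = this
    show ?thesis
    proof (intro exI[of _ r] exI[of _ U] conjI allI impI r(1))
      fix e :: real assume "0 < e"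
      from r(2)[OF this] show "\<exists>N. \<forall>n\<ge>N. \<forall>t\<in>{0..T}. norm (integral {0..t} (u (r n)) - U t) < e"
        by (simp add: V_def Ball_def) blast
    qed
  qed
qed

section \<open>Strong compactness of almost minimizers\<close>

context convex_integrand
begin

lemma almost_minimizers_convergent:
  fixes u :: "nat \<Rightarrow> real \<Rightarrow> 'a" and A :: "nat \<Rightarrow> (real \<Rightarrow> 'a) \<Rightarrow> real"
  assumes u: "\<And>n. u n \<in> Lp_ball p T R" "\<And>n. integrable M (\<lambda>t. f t (u n t))"
    and stable: "\<And>e. 0 < e \<Longrightarrow> \<exists>d>0. \<forall>n. \<forall>v\<in>Lp_ball p T R. \<forall>w\<in>Lp_ball p T R.
        (\<forall>t\<in>{0..T}. norm (integral {0..t} v - integral {0..t} w) \<le> d) \<longrightarrow> \<bar>A n v - A n w\<bar> \<le> e"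
    and min: "\<And>n w. w \<in> Lp_ball p T R \<Longrightarrow> integrable M (\<lambda>t. f t (w t)) \<Longrightarrow>
        A n (u n) + running_cost (u n) \<le> A n w + running_cost w + \<epsilon> n"
    and \<epsilon>: "\<epsilon> \<longlonglongrightarrow> 0"
    and U: "\<And>e. 0 < e \<Longrightarrow> \<exists>N. \<forall>n\<ge>N. \<forall>t\<in>{0..T}. norm (integral {0..t} (u n) - U t) < e"
  shows "\<exists>v\<in>Lp_ball p T R. \<exists>r. strict_mono r \<and> (\<lambda>n. Lp_norm p T (\<lambda>t. u (r n) t - v t)) \<longlonglongrightarrow> 0"
proof -
  have uL: "u n \<in> Lp_fun p T" for n using Lp_ballD(1)[OF u(1) p0] .
  have um: "u n \<in> borel_measurable M" for n using Lp_funD(1)[OF uL] .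
  have ui: "integrable M (u n)" for n using Lp_fun_imp_integrable[OF uL p] .
  define mid where "mid n m t = (1/2) *\<^sub>R (u n t + u m t)" for n m t
  have mid_ball: "mid n m \<in> Lp_ball p T R" for n m
    using Lp_ball_midpoint[OF u(1) u(1)] p by (simp add: mid_def[abs_def])
  note mc = midpoint_cost[OF um u(2) um u(2), folded mid_def]
  \<comment> \<open>Each \<open>u n\<close> is tested against a midpoint under its own functional
    \<open>A n\<close>. The primitives of \<open>u n\<close> and of the midpoint are close, so the
    end-point costs nearly cancel and a comparison of running costs remains.\<close>
  have close: "\<exists>N. \<forall>n\<ge>N. \<forall>m\<ge>N. running_cost (u n) \<le> running_cost (mid n m) + e" if e: "0 < e" for e
  proof -
    obtain d where d: "d > 0" "\<And>n v w. v \<in> Lp_ball p T R \<Longrightarrow> w \<in> Lp_ball p T R \<Longrightarrow>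
        (\<forall>t\<in>{0..T}. norm (integral {0..t} v - integral {0..t} w) \<le> d) \<Longrightarrow> \<bar>A n v - A n w\<bar> \<le> e / 2"
      using stable[of "e / 2"] e by auto
    obtain N1 where N1: "\<And>n t. n \<ge> N1 \<Longrightarrow> t \<in> {0..T} \<Longrightarrow> norm (integral {0..t} (u n) - U t) < d"
      using U[OF d(1)] by blast
    have "\<forall>\<^sub>F n in sequentially. \<epsilon> n < e / 2"
      using \<epsilon> e by (intro order_tendstoD(2)) auto
    then obtain N2 where N2: "\<And>n. n \<ge> N2 \<Longrightarrow> \<epsilon> n < e / 2"
      unfolding eventually_sequentially by blast
    show ?thesis
    proof (intro exI[of _ "max N1 N2"] allI impI)
      fix n m assume nm: "max N1 N2 \<le> n" "max N1 N2 \<le> m"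
      have "norm (integral {0..t} (mid n m) - integral {0..t} (u n)) \<le> d" if t: "t \<in> {0..T}" for t
      proof -
        have i: "u k integrable_on {0..t}" for k
          using ui[of k] t by (auto simp: absolutely_integrable_on_def simp flip: absolutely_integrable_on_iff_lebesgue_on
              intro: integrable_subinterval_real)
        have "integral {0..t} (mid n m) = (1/2) *\<^sub>R (integral {0..t} (u n) + integral {0..t} (u m))"
          unfolding mid_def using i by (simp add: Henstock_Kurzweil_Integration.integral_add)
        then have "integral {0..t} (mid n m) - integral {0..t} (u n) =
            (1/2) *\<^sub>R ((integral {0..t} (u m) - U t) - (integral {0..t} (u n) - U t))"
          by (simp add: algebra_simps flip: scaleR_add_left)
        then have "norm (integral {0..t} (mid n m) - integral {0..t} (u n)) =
            norm ((integral {0..t} (u m) - U t) - (integral {0..t} (u n) - U t)) / 2"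
          by simp
        also have "\<dots> \<le> (norm (integral {0..t} (u m) - U t) + norm (integral {0..t} (u n) - U t)) / 2"
          by (intro divide_right_mono norm_triangle_ineq4) simp
        also have "\<dots> \<le> d" using N1[of n t] N1[of m t] nm t by simp
        finally show ?thesis .
      qed
      then have "\<bar>A n (mid n m) - A n (u n)\<bar> \<le> e / 2"
        by (intro d(2) mid_ball u(1) ballI)
      moreover have "A n (u n) + running_cost (u n) \<le> A n (mid n m) + running_cost (mid n m) + \<epsilon> n"
        using min[OF mid_ball mc(1)] .
      moreover have "\<epsilon> n < e / 2" using N2 nm by simp
      ultimately show "running_cost (u n) \<le> running_cost (mid n m) + e" by linarith
    qed
  qed
  have mid_commute: "mid n m = mid m n" for n m by (simp add: mid_def[abs_def] add.commute)
  \<comment> \<open>The midpoint is symmetric in the two indices, so the minimality of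
    \<open>u n\<close> for \<open>A n\<close> and that of \<open>u m\<close> for \<open>A m\<close>
    both bound the same running cost from below. Their mean is the convexity gap.\<close>
  have gap: "\<exists>N. \<forall>n\<ge>N. \<forall>m\<ge>N. (LINT t|M. convexity_gap (f t) (u n t) (u m t)) \<le> e" if e: "0 < e" for e
  proof -
    obtain N where N: "\<And>n m. n \<ge> N \<Longrightarrow> m \<ge> N \<Longrightarrow> running_cost (u n) \<le> running_cost (mid n m) + e"
      using close[OF e] by blast
    have "(LINT t|M. convexity_gap (f t) (u n t) (u m t)) \<le> e" if nm: "n \<ge> N" "m \<ge> N" for n m
    proof -
      have "(x + y) / 2 - z \<le> e" if "x \<le> z + e" "y \<le> z + e" for x y z :: real
        using that by (simp add: field_simps)
      from this[OF N[OF nm] N[OF nm(2,1), unfolded mid_commute[of m n]]] show ?thesis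
        unfolding mc(3) .
    qed
    then show ?thesis by blast
  qed
  have gap0: "0 \<le> (LINT t|M. convexity_gap (f t) (u n t) (u m t))" for n m
    using mc(4) by (rule integral_nonneg_AE)
  \<comment> \<open>If the Cauchy property failed, pairs with large indices would stay
    \<open>e\<close> apart although their mean gap vanishes; \<open>L1_diff_small\<close> produces
    one pair that is closer.\<close>
  have L1: "\<exists>N. \<forall>n\<ge>N. \<forall>m\<ge>N. (LINT t|M. norm (u n t - u m t)) < e" if e: "0 < e" for e
  proof (rule ccontr)
    assume "\<not> ?thesis"
    then have "\<forall>N. \<exists>n m. n \<ge> N \<and> m \<ge> N \<and> e \<le> (LINT t|M. norm (u n t - u m t))"
      by (auto simp: not_less)
    then obtain n m where nm: "\<And>k. n k \<ge> k" "\<And>k. m k \<ge> k"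
      "\<And>k. e \<le> (LINT t|M. norm (u (n k) t - u (m k) t))" by metis
    have "(\<lambda>k. LINT t|M. convexity_gap (f t) (u (n k) t) (u (m k) t)) \<longlonglongrightarrow> 0"
    proof (rule LIMSEQ_I)
      fix e' :: real assume "0 < e'"
      then obtain N where N: "\<And>n m. n \<ge> N \<Longrightarrow> m \<ge> N \<Longrightarrow> (LINT t|M. convexity_gap (f t) (u n t) (u m t)) \<le> e' / 2"
        using gap[of "e' / 2"] by auto
      have "norm ((LINT t|M. convexity_gap (f t) (u (n k) t) (u (m k) t)) - 0) < e'" if "k \<ge> N" for k
        using N[of "n k" "m k"] gap0[of "n k" "m k"] nm(1,2)[of k] that \<open>0 < e'\<close> by simp
      then show "\<exists>N. \<forall>k\<ge>N. norm ((LINT t|M. convexity_gap (f t) (u (n k) t) (u (m k) t)) - 0) < e'" by blast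
    qed
    from L1_diff_small[OF u u this e] obtain k where "(LINT t|M. norm (u (n k) t - u (m k) t)) < e" by blast
    with nm(3)[of k] show False by simp
  qed
  obtain r where r: "strict_mono r" "AE t in M. Cauchy (\<lambda>i. u (r i) t)"
    using cauchy_L1_AE_cauchy_subseq[of M u, OF ui L1] by blast
  define v where "v t = lim (\<lambda>i. u (r i) t)" for t
  have vm: "v \<in> borel_measurable M"
    unfolding v_def using um by (intro borel_measurable_lim_metric)
  have lim: "AE t in M. (\<lambda>i. u (r i) t) \<longlonglongrightarrow> v t"
    using r(2) by eventually_elim (simp add: v_def Cauchy_convergent_iff convergent_LIMSEQ_iff)
  have v_ball: "v \<in> Lp_ball p T R"
  proof -
    have meas: "(\<lambda>t. norm (v t) powr p) \<in> borel_measurable M" using vm by measurable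
    have "AE t in M. (\<lambda>i. norm (u (r i) t) powr p) \<longlonglongrightarrow> norm (v t) powr p"
      using lim
    proof eventually_elim
      case (elim t)
      show ?case
        by (rule tendsto_powr2) (use elim p0 in \<open>auto intro!: tendsto_intros\<close>)
    qed
    note vp = fatou_integrable[OF Lp_funD(2)[OF uL] _ Lp_ballD(2)[OF u(1) p0] tendsto_const meas this]
    show ?thesis
      using vm vp Lp_ball_radius_nonneg[OF u(1)] p0 by (intro Lp_ballI) (auto simp: Lp_fun_def)
  qed
  have vL: "v \<in> Lp_fun p T" using Lp_ballD(1)[OF v_ball p0] .
  have vi: "integrable M v" using Lp_fun_imp_integrable[OF vL p] .
  have L1v: "\<exists>N. \<forall>i\<ge>N. (LINT t|M. norm (u (r i) t - v t)) \<le> e" if e: "0 < e" for e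
  proof -
    obtain N where N: "\<And>n m. n \<ge> N \<Longrightarrow> m \<ge> N \<Longrightarrow> (LINT t|M. norm (u n t - u m t)) < e"
      using L1[OF e] by blast
    have "(LINT t|M. norm (u (r i) t - v t)) \<le> e" if i: "i \<ge> N" for i
    proof (rule fatou_integrable(2)[where g="\<lambda>j t. norm (u (r i) t - u (r (j + N)) t)" and B="\<lambda>_. e"])
      show "(LINT t|M. norm (u (r i) t - u (r (j + N)) t)) \<le> e" for j
        using N[of "r i" "r (j + N)"] seq_suble[OF r(1), of i] seq_suble[OF r(1), of "j + N"] i by simp
      show "AE t in M. (\<lambda>j. norm (u (r i) t - u (r (j + N)) t)) \<longlonglongrightarrow> norm (u (r i) t - v t)"
        using lim
      proof eventually_elim
        case (elim t)
        from LIMSEQ_ignore_initial_segment[OF elim, of N] show ?case by (intro tendsto_intros)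
      qed
    qed (use ui vi in auto)
    then show ?thesis by blast
  qed
  \<comment> \<open>The modulus of \<open>A\<close> is expressed through primitives, and
    \<open>L1\<close> distance controls these uniformly in \<open>t\<close>. This is what allows the
    limit to be compared with the sequence.\<close>
  have prim: "norm (integral {0..t} (u n) - integral {0..t} v) \<le> (LINT t|M. norm (u n t - v t))" if t: "t \<in> {0..T}" for n t
  proof -
    have i: "(\<lambda>t. u n t - v t) absolutely_integrable_on {0..T}"
      using ui vi by (simp add: absolutely_integrable_on_iff_lebesgue_on)
    have sub: "{0..t} \<subseteq> {0..T}" using t by auto
    have "u n integrable_on {0..t}" "v integrable_on {0..t}"
      using ui[of n] vi t by (auto simp: absolutely_integrable_on_def simp flip: absolutely_integrable_on_iff_lebesgue_on
              intro: integrable_subinterval_real)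
    then have "norm (integral {0..t} (u n) - integral {0..t} v) = norm (integral {0..t} (\<lambda>t. u n t - v t))"
      by (simp add: Henstock_Kurzweil_Integration.integral_diff)
    also have "\<dots> \<le> integral {0..t} (\<lambda>t. norm (u n t - v t))"
      using absolutely_integrable_subinterval[OF i sub]
      by (intro Henstock_Kurzweil_Integration.integral_norm_bound_integral) (auto simp: absolutely_integrable_on_def)
    also have "\<dots> \<le> integral {0..T} (\<lambda>t. norm (u n t - v t))"
      using i absolutely_integrable_subinterval[OF i sub] sub
      by (intro integral_subset_le) (auto simp: absolutely_integrable_on_def)
    also have "\<dots> = (LINT t|M. norm (u n t - v t))"
      using ui vi by (intro lebesgue_integral_eq_integral[symmetric]) auto
    finally show ?thesis .
  qed
  \<comment> \<open>Nonnegativity of the gap bounds the cost of the midpoint of \<open>u n\<close>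
    and \<open>u N\<close> by the mean of the two costs; inserted into \<open>close\<close> with
    tolerance 1, this leaves \<open>running_cost (u N) + 2\<close>.\<close>
  have bounded: "\<exists>N B. \<forall>n\<ge>N. running_cost (u n) \<le> B"
  proof -
    obtain N where N: "\<And>n m. n \<ge> N \<Longrightarrow> m \<ge> N \<Longrightarrow> running_cost (u n) \<le> running_cost (mid n m) + 1"
      using close[of 1] by auto
    have "running_cost (u n) \<le> running_cost (u N) + 2" if "n \<ge> N" for n
      using N[of n N] that mc(3)[of n N] gap0[of n N] by simp
    then show ?thesis by blast
  qed
  have vcost: "integrable M (\<lambda>t. f t (v t))"
  proof -
    obtain N B where B: "\<And>n. n \<ge> N \<Longrightarrow> running_cost (u n) \<le> B" using bounded by blast
    have "integrable M (\<lambda>t. f t (v t) + c t)"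
    proof (rule fatou_integrable(1)[where g="\<lambda>n t. f t (u (r (n + N)) t) + c t" and B="\<lambda>_. B + integral\<^sup>L M c"])
      show "(LINT t|M. f t (u (r (n + N)) t) + c t) \<le> B + integral\<^sup>L M c" for n
        using B[of "r (n + N)"] seq_suble[OF r(1), of "n + N"] u(2) c_integrable by simp
      show "AE t in M. 0 \<le> f t (u (r (n + N)) t) + c t" for n
        using f_lower[of "u (r (n + N))"] by eventually_elim simp
      show "AE t in M. (\<lambda>n. f t (u (r (n + N)) t) + c t) \<longlonglongrightarrow> f t (v t) + c t"
        using lim f_convex
      proof eventually_elim
        case (elim t)
        have "(\<lambda>n. f t (u (r (n + N)) t)) \<longlonglongrightarrow> f t (v t)"
          using elim(2) LIMSEQ_ignore_initial_segment[OF elim(1), of N]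
          by (intro isCont_tendsto_compose[of _ "f t"]) (auto simp: continuous_on_eq_continuous_at)
        then show ?case by (intro tendsto_intros)
      qed
    qed (use u(2) c_integrable f_compose_measurable[OF vm] in auto)
    then have "integrable M (\<lambda>t. (f t (v t) + c t) - c t)" using c_integrable by (rule Bochner_Integration.integrable_diff)
    then show ?thesis by simp
  qed
  \<comment> \<open>The excess is an upper bound on the cost of \<open>u (r i)\<close> over that of
    \<open>v\<close>. It vanishes because \<open>v\<close> competes with \<open>u (r i)\<close>
    under the functional of index \<open>r i\<close>.\<close>
  define \<delta> where "\<delta> i = max 0 (running_cost (u (r i)) - running_cost v)" for i
  have "\<delta> \<longlonglongrightarrow> 0"
  proof (rule LIMSEQ_I)
    fix e :: real assume e: "0 < e"
    obtain d where d: "d > 0" "\<And>n v w. v \<in> Lp_ball p T R \<Longrightarrow> w \<in> Lp_ball p T R \<Longrightarrow>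
        (\<forall>t\<in>{0..T}. norm (integral {0..t} v - integral {0..t} w) \<le> d) \<Longrightarrow> \<bar>A n v - A n w\<bar> \<le> e / 3"
      using stable[of "e / 3"] e by auto
    obtain N1 where N1: "\<And>i. i \<ge> N1 \<Longrightarrow> (LINT t|M. norm (u (r i) t - v t)) \<le> d"
      using L1v[OF d(1)] by blast
    have "\<forall>\<^sub>F n in sequentially. \<epsilon> n < e / 3"
      using \<epsilon> e by (intro order_tendstoD(2)) auto
    then obtain N2 where N2: "\<And>n. n \<ge> N2 \<Longrightarrow> \<epsilon> n < e / 3"
      unfolding eventually_sequentially by blast
    have "norm (\<delta> i - 0) < e" if i: "i \<ge> max N1 N2" for i
    proof -
      have "\<bar>A (r i) (u (r i)) - A (r i) v\<bar> \<le> e / 3"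
        using prim N1[of i] i by (intro d(2) u(1) v_ball ballI) (auto intro: order_trans)
      moreover have "A (r i) (u (r i)) + running_cost (u (r i)) \<le> A (r i) v + running_cost v + \<epsilon> (r i)"
        by (rule min[OF v_ball vcost])
      moreover have "\<epsilon> (r i) < e / 3" using N2[of "r i"] seq_suble[OF r(1), of i] i by simp
      ultimately have "running_cost (u (r i)) - running_cost v < e" by linarith
      then show ?thesis using e by (auto simp: \<delta>_def)
    qed
    then show "\<exists>N. \<forall>i\<ge>N. norm (\<delta> i - 0) < e" by blast
  qed
  then have "(\<lambda>i. Lp_norm p T (\<lambda>t. u (r i) t - v t)) \<longlonglongrightarrow> 0"
    by (intro Lp_tendsto_of_cost_tendsto[OF uL u(2) vL vcost lim]) (auto simp: \<delta>_def)
  then show ?thesis using v_ball r(1) by blast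
qed

theorem almost_minimizers_precompact:
  fixes u :: "nat \<Rightarrow> real \<Rightarrow> 'a" and A :: "nat \<Rightarrow> (real \<Rightarrow> 'a) \<Rightarrow> real"
  assumes u: "\<And>n. u n \<in> Lp_ball p T R" "\<And>n. integrable M (\<lambda>t. f t (u n t))"
    and stable: "\<And>e. 0 < e \<Longrightarrow> \<exists>d>0. \<forall>n. \<forall>v\<in>Lp_ball p T R. \<forall>w\<in>Lp_ball p T R.
        (\<forall>t\<in>{0..T}. norm (integral {0..t} v - integral {0..t} w) \<le> d) \<longrightarrow> \<bar>A n v - A n w\<bar> \<le> e"
    and min: "\<And>n w. w \<in> Lp_ball p T R \<Longrightarrow> integrable M (\<lambda>t. f t (w t)) \<Longrightarrow>
        A n (u n) + running_cost (u n) \<le> A n w + running_cost w + \<epsilon> n"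
    and \<epsilon>: "\<epsilon> \<longlonglongrightarrow> 0"
  shows "\<exists>v\<in>Lp_ball p T R. \<exists>r. strict_mono r \<and> (\<lambda>n. Lp_norm p T (\<lambda>t. u (r n) t - v t)) \<longlonglongrightarrow> 0"
proof -
  obtain s :: "nat \<Rightarrow> nat" and U where s': "strict_mono s"
    "\<forall>e>0. \<exists>N. \<forall>n\<ge>N. \<forall>t\<in>{0..T}. norm (integral {0..t} (u (s n)) - U t) < e"
    using Lp_ball_primitives_convergent_subseq[where u=u, OF p T u(1)] by blast
  note s = s'(1) s'(2)[rule_format]
  have "\<exists>d>0. \<forall>n. \<forall>v\<in>Lp_ball p T R. \<forall>w\<in>Lp_ball p T R.
      (\<forall>t\<in>{0..T}. norm (integral {0..t} v - integral {0..t} w) \<le> d) \<longrightarrow> \<bar>A (s n) v - A (s n) w\<bar> \<le> e"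
    if "0 < e" for e
    using stable[OF that] by (elim exE conjE) (intro exI conjI, assumption, blast)
  moreover have "(\<lambda>n. \<epsilon> (s n)) \<longlonglongrightarrow> 0"
    using LIMSEQ_subseq_LIMSEQ[OF \<epsilon> s(1)] by (simp add: comp_def)
  ultimately obtain v r where v: "v \<in> Lp_ball p T R" "strict_mono r"
      "(\<lambda>n. Lp_norm p T (\<lambda>t. u (s (r n)) t - v t)) \<longlonglongrightarrow> 0"
    using almost_minimizers_convergent[of "\<lambda>n. u (s n)" R "\<lambda>n. A (s n)" "\<lambda>n. \<epsilon> (s n)" U] u min s(2) by auto
  then show ?thesis
    using strict_mono_compose[OF s(1) v(2)] by (intro bexI[of _ v] exI[of _ "\<lambda>n. s (r n)"]) (auto simp: comp_def)
qed

end

section \<open>The ensemble of trajectories\<close>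

text \<open>The function \<open>g\<close> is replaced by its values at the points of the grid of mesh \<open>\<eta>\<close>.\<close>

lemma norm_integral_product_le:
  fixes h :: "real \<Rightarrow> real" and g :: "real \<Rightarrow> 'a::euclidean_space"
  assumes h: "h absolutely_integrable_on {0..T}" and g: "continuous_on {0..T} g"
    and B: "\<And>s. s \<in> {0..T} \<Longrightarrow> norm (g s) \<le> B"
    and osc: "\<And>s s'. s \<in> {0..T} \<Longrightarrow> s' \<in> {0..T} \<Longrightarrow> \<bar>s - s'\<bar> \<le> \<eta> \<Longrightarrow> norm (g s - g s') \<le> \<omega>"
    and \<delta>: "\<And>s. s \<in> {0..T} \<Longrightarrow> \<bar>integral {0..s} h\<bar> \<le> \<delta>"
    and \<eta>: "0 \<le> \<eta>" and t: "t \<in> {0..T}" "t \<le> real m * \<eta>"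
  shows "norm (integral {0..t} (\<lambda>s. h s *\<^sub>R g s)) \<le> \<omega> * integral {0..t} (\<lambda>s. \<bar>h s\<bar>) + real m * (2 * \<delta> * B)"
  using t
proof (induction m arbitrary: t)
  case 0
  then have "t = 0" by simp
  then show ?case by simp
next
  case (Suc m)
  have \<delta>0: "0 \<le> \<delta>" using \<delta>[OF Suc.prems(1)] by linarith
  have B0: "0 \<le> B" using B[OF Suc.prems(1)] norm_ge_zero order_trans by blast
  have hg: "(\<lambda>s. h s *\<^sub>R g s) absolutely_integrable_on {0..T}"
    by (rule absolutely_integrable_scaleR_continuous[OF h g])
  have sub: "k integrable_on {p..q}" if "k absolutely_integrable_on {0..T}" "{p..q} \<subseteq> {0..T}"
    for k :: "real \<Rightarrow> 'b::euclidean_space" and p q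
    using absolutely_integrable_subinterval[OF that] by (simp add: absolutely_integrable_on_def)
  have ha: "(\<lambda>s. \<bar>h s\<bar>) absolutely_integrable_on {0..T}"
    using absolutely_integrable_norm[OF h] by (simp add: comp_def)
  show ?case
  proof (cases "t \<le> real m * \<eta>")
    case True
    have "real m * (2 * \<delta> * B) \<le> real (Suc m) * (2 * \<delta> * B)"
      using \<delta>0 B0 by (intro mult_right_mono) auto
    with Suc.IH[OF Suc.prems(1) True] show ?thesis by linarith
  next
    case False
    define q where "q = real m * \<eta>"
    have q: "q \<in> {0..T}" "q \<le> t" "t - q \<le> \<eta>"
      using False Suc.prems \<eta> by (auto simp: q_def algebra_simps)
    have qt: "{q..t} \<subseteq> {0..T}" "{0..t} \<subseteq> {0..T}" "{0..q} \<subseteq> {0..T}" using q Suc.prems(1) by auto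
    have split: "integral {0..t} k = integral {0..q} k + integral {q..t} k"
      if "k absolutely_integrable_on {0..T}" for k :: "real \<Rightarrow> 'b::euclidean_space"
      using q sub[OF that qt(2)] by (intro Henstock_Kurzweil_Integration.integral_combine[symmetric]) auto
    have IH: "norm (integral {0..q} (\<lambda>s. h s *\<^sub>R g s)) \<le> \<omega> * integral {0..q} (\<lambda>s. \<bar>h s\<bar>) + real m * (2 * \<delta> * B)"
      by (rule Suc.IH[OF q(1)]) (simp add: q_def)
    have gq: "continuous_on {0..T} (\<lambda>s. g s - g q)" using g by (intro continuous_intros)
    have hgq: "(\<lambda>s. h s *\<^sub>R (g s - g q)) absolutely_integrable_on {0..T}"
      by (rule absolutely_integrable_scaleR_continuous[OF h gq])
    have hq: "(\<lambda>s. h s *\<^sub>R g q) integrable_on {q..t}"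
      using sub[OF absolutely_integrable_scaleR_continuous[OF h continuous_on_const] qt(1)] .
    have "integral {q..t} (\<lambda>s. h s *\<^sub>R g s) = integral {q..t} (\<lambda>s. h s *\<^sub>R (g s - g q) + h s *\<^sub>R g q)"
      by (simp add: algebra_simps)
    also have "\<dots> = integral {q..t} (\<lambda>s. h s *\<^sub>R (g s - g q)) + integral {q..t} h *\<^sub>R g q"
      using hq sub[OF hgq qt(1)] integral_unique[OF has_integral_scaleR_left[OF integrable_integral[OF sub[OF h qt(1)]]]]
      by (simp add: Henstock_Kurzweil_Integration.integral_add)
    finally have "norm (integral {q..t} (\<lambda>s. h s *\<^sub>R g s)) \<le>
        norm (integral {q..t} (\<lambda>s. h s *\<^sub>R (g s - g q))) + norm (integral {q..t} h *\<^sub>R g q)"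
      by (simp only:) (rule norm_triangle_ineq)
    also have "norm (integral {q..t} (\<lambda>s. h s *\<^sub>R (g s - g q))) \<le> integral {q..t} (\<lambda>s. \<omega> * \<bar>h s\<bar>)"
    proof (rule Henstock_Kurzweil_Integration.integral_norm_bound_integral[OF sub[OF hgq qt(1)]])
      show "(\<lambda>s. \<omega> * \<bar>h s\<bar>) integrable_on {q..t}"
        using sub[OF ha qt(1)] by (rule integrable_on_mult_right)
      fix s assume s: "s \<in> {q..t}"
      have "norm (g s - g q) \<le> \<omega>" using s q qt by (intro osc) auto
      then show "norm (h s *\<^sub>R (g s - g q)) \<le> \<omega> * \<bar>h s\<bar>"
        using mult_left_mono[of "norm (g s - g q)" \<omega> "\<bar>h s\<bar>"] by (simp add: mult.commute)
    qed
    also have "\<dots> = \<omega> * integral {q..t} (\<lambda>s. \<bar>h s\<bar>)" by simp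
    also have "norm (integral {q..t} h *\<^sub>R g q) \<le> (2 * \<delta>) * B"
    proof -
      have "integral {q..t} h = integral {0..t} h - integral {0..q} h" using split[OF h] by simp
      then have "\<bar>integral {q..t} h\<bar> \<le> 2 * \<delta>" using \<delta>[OF q(1)] \<delta>[OF Suc.prems(1)] by linarith
      then show ?thesis using B[OF q(1)] \<delta>0 by (simp add: mult_mono)
    qed
    finally have "norm (integral {q..t} (\<lambda>s. h s *\<^sub>R g s)) \<le> \<omega> * integral {q..t} (\<lambda>s. \<bar>h s\<bar>) + 2 * \<delta> * B"
      by simp
    moreover have "norm (integral {0..t} (\<lambda>s. h s *\<^sub>R g s)) \<le>
        norm (integral {0..q} (\<lambda>s. h s *\<^sub>R g s)) + norm (integral {q..t} (\<lambda>s. h s *\<^sub>R g s))"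
      unfolding split[OF hg] by (rule norm_triangle_ineq)
    ultimately show ?thesis using IH unfolding split[OF ha] by (simp add: algebra_simps)
  qed
qed

lemma field_matrix_vector_mult:
  "field_matrix F x \<theta> *v w = (\<Sum>i\<in>UNIV. w $ i *\<^sub>R F i x \<theta>)"
  by (simp add: field_matrix_def matrix_vector_mult_def vec_eq_iff mult.commute)

locale control_ensemble =
  fixes T L :: real and \<Theta> :: "(real^'l) set"
    and F0 :: "real^'d \<Rightarrow> real^'l \<Rightarrow> real^'d"
    and F :: "'k::finite \<Rightarrow> real^'d \<Rightarrow> real^'l \<Rightarrow> real^'d"
    and x0 :: "real^'l \<Rightarrow> real^'d"
  assumes T: "0 < T" and L: "0 < L" and \<Theta>: "compact \<Theta>"
    and F0_lipschitz: "\<And>x1 x2 \<theta>1 \<theta>2. \<theta>1 \<in> \<Theta> \<Longrightarrow> \<theta>2 \<in> \<Theta> \<Longrightarrow>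
      norm (F0 x1 \<theta>1 - F0 x2 \<theta>2) \<le> L * (norm (x1 - x2) + norm (x1 + x2) * norm (\<theta>1 - \<theta>2))"
    and F_lipschitz: "\<And>i x1 x2 \<theta>1 \<theta>2. \<theta>1 \<in> \<Theta> \<Longrightarrow> \<theta>2 \<in> \<Theta> \<Longrightarrow>
      norm (F i x1 \<theta>1 - F i x2 \<theta>2) \<le> L * (norm (x1 - x2) + norm (x1 + x2) * norm (\<theta>1 - \<theta>2))"
    and x0: "continuous_on \<Theta> x0"
begin

definition velocity :: "real^'l \<Rightarrow> real^'k \<Rightarrow> real^'d \<Rightarrow> real^'d" where
  "velocity \<theta> w x = F0 x \<theta> + field_matrix F x \<theta> *v w"

text \<open>The 1 stands for the drift and the other term bounds the sum of the components of
  \<open>w\<close> in absolute value. Thus \<open>L * weight w\<close> is a Lipschitz constant of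
  the velocity in the state.\<close>

definition weight :: "real^'k \<Rightarrow> real" where
  "weight w = 1 + real CARD('k) * norm w"

lemma weight_ge_1: "1 \<le> weight w" by (simp add: weight_def)

lemma norm_control_sum_le:
  assumes "\<And>i. norm (z i) \<le> B"
  shows "norm (\<Sum>i\<in>UNIV. (w :: real^'k) $ i *\<^sub>R (z i :: real^'d)) \<le> real CARD('k) * norm w * B"
proof -
  have "norm (\<Sum>i\<in>UNIV. w $ i *\<^sub>R z i) \<le> (\<Sum>i\<in>(UNIV::'k set). norm w * B)"
    using assms component_le_norm_cart[of w] by (intro sum_norm_le) (auto intro!: mult_mono)
  then show ?thesis by simp
qed

lemma velocity_diff:
  assumes "\<theta>1 \<in> \<Theta>" "\<theta>2 \<in> \<Theta>"
  shows "norm (velocity \<theta>1 w x - velocity \<theta>2 w y) \<le> L * weight w * (norm (x - y) + norm (x + y) * norm (\<theta>1 - \<theta>2))"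
proof -
  define B where "B = L * (norm (x - y) + norm (x + y) * norm (\<theta>1 - \<theta>2))"
  have "velocity \<theta>1 w x - velocity \<theta>2 w y = (F0 x \<theta>1 - F0 y \<theta>2) + (\<Sum>i\<in>UNIV. w $ i *\<^sub>R (F i x \<theta>1 - F i y \<theta>2))"
    by (simp add: velocity_def field_matrix_vector_mult scaleR_diff_right sum_subtractf)
  also have "norm \<dots> \<le> B + real CARD('k) * norm w * B"
    unfolding B_def using assms by (intro norm_triangle_mono norm_control_sum_le F0_lipschitz F_lipschitz)
  also have "\<dots> = L * weight w * (norm (x - y) + norm (x + y) * norm (\<theta>1 - \<theta>2))"
    by (simp add: B_def weight_def algebra_simps)
  finally show ?thesis .
qed

lemma velocity_lipschitz:
  "\<theta> \<in> \<Theta> \<Longrightarrow> norm (velocity \<theta> w x - velocity \<theta> w y) \<le> L * weight w * norm (x - y)"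
  using velocity_diff[of \<theta> \<theta>] by simp

text \<open>For \<open>x\<^sub>1 = x\<^sub>2 = 0\<close> the Lipschitz condition makes the fields at the origin independent of the parameter.\<close>

lemma field_growth:
  obtains G where "0 \<le> G"
    "\<And>\<theta> x. \<theta> \<in> \<Theta> \<Longrightarrow> norm (F0 x \<theta>) \<le> G + L * norm x"
    "\<And>\<theta> x i. \<theta> \<in> \<Theta> \<Longrightarrow> norm (F i x \<theta>) \<le> G + L * norm x"
proof (cases "\<Theta> = {}")
  case False
  then obtain \<theta>0 where \<theta>0: "\<theta>0 \<in> \<Theta>" by blast
  define G where "G = norm (F0 0 \<theta>0) + (\<Sum>i\<in>UNIV. norm (F i 0 \<theta>0))"
  have "norm (F0 x \<theta>) \<le> G + L * norm x" if "\<theta> \<in> \<Theta>" for \<theta> x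
  proof -
    have "F0 0 \<theta> = F0 0 \<theta>0" using F0_lipschitz[OF that \<theta>0, of 0 0] by simp
    moreover have "norm (F0 x \<theta> - F0 0 \<theta>) \<le> L * norm x" using F0_lipschitz[OF that that, of x 0] by simp
    moreover have "0 \<le> (\<Sum>i\<in>UNIV. norm (F i 0 \<theta>0))" by (intro sum_nonneg) auto
    ultimately show ?thesis using norm_triangle_sub[of "F0 x \<theta>" "F0 0 \<theta>"] by (simp add: G_def)
  qed
  moreover have "norm (F i x \<theta>) \<le> G + L * norm x" if "\<theta> \<in> \<Theta>" for \<theta> x i
  proof -
    have "norm (F i 0 \<theta>) = norm (F i 0 \<theta>0)" using F_lipschitz[OF that \<theta>0, of i 0 0] by simp
    moreover have "norm (F i x \<theta> - F i 0 \<theta>) \<le> L * norm x" using F_lipschitz[OF that that, of i x 0] by simp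
    moreover have "norm (F i 0 \<theta>0) \<le> (\<Sum>i\<in>UNIV. norm (F i 0 \<theta>0))" by (intro member_le_sum) auto
    ultimately show ?thesis using norm_triangle_sub[of "F i x \<theta>" "F i 0 \<theta>"] norm_ge_zero[of "F0 0 \<theta>0"]
      unfolding G_def by linarith
  qed
  moreover have "0 \<le> G" by (simp add: G_def sum_nonneg)
  ultimately show thesis using that by blast
qed (use that[of 0] in auto)

lemma velocity_growth:
  assumes "norm (F0 x \<theta>) \<le> G + L * norm x" and "\<And>i. norm (F i x \<theta>) \<le> G + L * norm x"
  shows "norm (velocity \<theta> w x) \<le> weight w * (G + L * norm x)"
proof -
  have "norm (velocity \<theta> w x) \<le> (G + L * norm x) + real CARD('k) * norm w * (G + L * norm x)"
    unfolding velocity_def field_matrix_vector_mult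
    using assms by (intro norm_triangle_mono norm_control_sum_le) auto
  then show ?thesis by (simp add: weight_def algebra_simps)
qed

abbreviation state :: "(real \<Rightarrow> real^'k) \<Rightarrow> real \<Rightarrow> real^'l \<Rightarrow> real^'d" where
  "state \<equiv> trajectory T F0 F x0"

lemma continuous_on_field:
  assumes \<theta>: "\<theta> \<in> \<Theta>" and x: "continuous_on {0..T} x"
  shows "continuous_on {0..T} (\<lambda>t. F0 (x t) \<theta>)" "continuous_on {0..T} (\<lambda>t. F i (x t) \<theta>)"
proof -
  have cont: "continuous_on {0..T} (\<lambda>t. H (x t))"
    if "\<And>x y. norm (H x - H y) \<le> L * norm (x - y)" for H :: "real^'d \<Rightarrow> real^'d"
  proof -
    have "L-lipschitz_on UNIV H"
      using that L by (intro lipschitz_onI) (auto simp: dist_norm)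
    from continuous_on_compose2[OF lipschitz_on_continuous_on[OF this] x] show ?thesis by simp
  qed
  show "continuous_on {0..T} (\<lambda>t. F0 (x t) \<theta>)"
    using F0_lipschitz[OF \<theta> \<theta>] by (intro cont[of "\<lambda>x. F0 x \<theta>"]) simp
  show "continuous_on {0..T} (\<lambda>t. F i (x t) \<theta>)"
    using F_lipschitz[OF \<theta> \<theta>] by (intro cont[of "\<lambda>x. F i x \<theta>"]) simp
qed

context
  fixes u :: "real \<Rightarrow> real^'k"
  assumes u: "u absolutely_integrable_on {0..T}"
begin

lemma weight_integrable: "(\<lambda>t. weight (u t)) absolutely_integrable_on {0..T}"
  using u unfolding weight_def absolutely_integrable_on_iff_lebesgue_on by simp

lemma gain_integrable: "(\<lambda>t. L * weight (u t)) absolutely_integrable_on {0..T}"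
  using weight_integrable unfolding absolutely_integrable_on_iff_lebesgue_on by simp

lemma gain_nonneg: "0 \<le> L * weight (u t)"
  using L weight_ge_1[of "u t"] by simp

lemma velocity_integrable:
  assumes \<theta>: "\<theta> \<in> \<Theta>" and x: "continuous_on {0..T} x"
  shows "(\<lambda>t. velocity \<theta> (u t) (x t)) absolutely_integrable_on {0..T}"
proof -
  have "(\<lambda>t. u t $ i) absolutely_integrable_on {0..T}" for i
    using absolutely_integrable_linear[OF u bounded_linear_vec_nth[of i]] by (simp add: comp_def)
  from absolutely_integrable_scaleR_continuous[OF this continuous_on_field(2)[OF \<theta> x]]
  have "(\<lambda>t. \<Sum>i\<in>UNIV. u t $ i *\<^sub>R F i (x t) \<theta>) absolutely_integrable_on {0..T}"
    by (intro absolutely_integrable_sum) auto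
  with absolutely_integrable_continuous_real[OF continuous_on_field(1)[OF \<theta> x]] show ?thesis
    unfolding velocity_def field_matrix_vector_mult by (rule set_integral_add(1))
qed

lemma velocity_integrable_on:
  assumes "\<theta> \<in> \<Theta>" "continuous_on {0..T} x" "{r..t} \<subseteq> {0..T}"
  shows "(\<lambda>s. velocity \<theta> (u s) (x s)) integrable_on {r..t}"
  using absolutely_integrable_subinterval[OF velocity_integrable[OF assms(1,2)] assms(3)]
  by (simp add: absolutely_integrable_on_def)

lemma norm_integral_le_weight:
  fixes g :: "real \<Rightarrow> real^'d"
  assumes sub: "{r..t} \<subseteq> {0..T}" and g: "g integrable_on {r..t}"
    and le: "\<And>s. s \<in> {r..t} \<Longrightarrow> norm (g s) \<le> weight (u s) * H"
  shows "norm (integral {r..t} g) \<le> H * integral {r..t} (\<lambda>s. weight (u s))"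
proof -
  have "(\<lambda>s. weight (u s) * H) integrable_on {r..t}"
    using absolutely_integrable_subinterval[OF weight_integrable sub]
    by (intro integrable_on_mult_left) (simp add: absolutely_integrable_on_def)
  from Henstock_Kurzweil_Integration.integral_norm_bound_integral[OF g this le] show ?thesis
    by (simp add: mult.commute)
qed

text \<open>Picard's theorem shows that the choice in \<open>trajectory\<close> is made from a
  nonempty set. Whichever solution is chosen, absolute continuity yields the integral equation, and
  the later estimates start from there.\<close>

lemma state_solves:
  assumes \<theta>: "\<theta> \<in> \<Theta>"
  shows "continuous_on {0..T} (\<lambda>t. state u t \<theta>)"
    and "\<And>t. t \<in> {0..T} \<Longrightarrow> state u t \<theta> = x0 \<theta> + integral {0..t} (\<lambda>s. velocity \<theta> (u s) (state u s \<theta>))"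
proof -
  define x where "x t = state u t \<theta>" for t
  obtain y where y: "continuous_on {0..T} y"
    "\<And>t. t \<in> {0..T} \<Longrightarrow> y t = x0 \<theta> + integral {0..t} (\<lambda>s. velocity \<theta> (u s) (y s))"
    using integral_equation_solvable[OF gain_integrable gain_nonneg, of "\<lambda>t. velocity \<theta> (u t)" "x0 \<theta>"]
      velocity_lipschitz[OF \<theta>] velocity_integrable[OF \<theta>] T by auto
  have "caratheodory_solution T F0 F x0 u \<theta> y"
    using integral_equation_imp_absolutely_continuous[OF velocity_integrable[OF \<theta> y(1)] y(2)] y(2)[of 0] T
    by (simp add: caratheodory_solution_def velocity_def)
  then have "caratheodory_solution T F0 F x0 u \<theta> (SOME x. caratheodory_solution T F0 F x0 u \<theta> x)"
    using someI[of "caratheodory_solution T F0 F x0 u \<theta>" y] by blast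
  then have x: "caratheodory_solution T F0 F x0 u \<theta> x"
    by (simp add: x_def[abs_def] trajectory_def)
  then show "continuous_on {0..T} (\<lambda>t. state u t \<theta>)"
    by (simp add: caratheodory_solution_def absolutely_continuous_fun_imp_continuous_on flip: x_def)
  show "state u t \<theta> = x0 \<theta> + integral {0..t} (\<lambda>s. velocity \<theta> (u s) (state u s \<theta>))" if "t \<in> {0..T}" for t
    using absolutely_continuous_imp_integral_equation[of T x "\<lambda>s. velocity \<theta> (u s) (x s)" t] x that
    by (simp add: caratheodory_solution_def velocity_def flip: x_def)
qed

text \<open>The common perturbation estimate: \<open>y\<close> is an approximate solution whose
  defect in the integral equation is at most \<open>\<alpha>\<close>. Taking for \<open>y\<close>
  the zero function, the state of another control, or the state of another parameter gives
  boundedness, stability and continuity in the parameter.\<close>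

lemma norm_state_diff_le:
  assumes \<theta>: "\<theta> \<in> \<Theta>" and y: "continuous_on {0..T} y"
    and defect: "\<And>t. t \<in> {0..T} \<Longrightarrow> norm (x0 \<theta> + integral {0..t} (\<lambda>s. velocity \<theta> (u s) (y s)) - y t) \<le> \<alpha>"
    and W: "integral {0..T} (\<lambda>s. weight (u s)) \<le> W" and t: "t \<in> {0..T}"
  shows "norm (state u t \<theta> - y t) \<le> 2 * \<alpha> * exp (2 * (L * W))"
proof -
  define x where "x t = state u t \<theta>" for t
  note x = state_solves[OF \<theta>, folded x_def]
  have \<alpha>: "0 \<le> \<alpha>" using defect[OF t] norm_ge_zero order_trans by blast
  have xy: "continuous_on {0..T} (\<lambda>s. norm (x s - y s))" using x(1) y by (intro continuous_intros)
  have "norm (x t - y t) \<le> 2 * \<alpha> * exp (2 * integral {0..T} (\<lambda>s. L * weight (u s)))"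
  proof (rule gronwall[OF gain_integrable gain_nonneg _ xy \<alpha> _ t])
    fix t assume t: "t \<in> {0..T}"
    have sub: "{0..t} \<subseteq> {0..T}" using t by auto
    note i = velocity_integrable_on[OF \<theta> x(1) sub] velocity_integrable_on[OF \<theta> y sub]
    have g: "(\<lambda>s. L * weight (u s) * norm (x s - y s)) integrable_on {0..t}"
      using absolutely_integrable_subinterval[OF absolutely_integrable_scaleR_continuous[OF gain_integrable xy] sub]
      by (simp add: absolutely_integrable_on_def)
    have split: "x t - y t = (x0 \<theta> + integral {0..t} (\<lambda>s. velocity \<theta> (u s) (y s)) - y t) +
        integral {0..t} (\<lambda>s. velocity \<theta> (u s) (x s) - velocity \<theta> (u s) (y s))"
      unfolding Henstock_Kurzweil_Integration.integral_diff[OF i] by (subst x(2)[OF t]) simp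
    show "norm (x t - y t) \<le> \<alpha> + integral {0..t} (\<lambda>s. L * weight (u s) * norm (x s - y s))"
      unfolding split using velocity_lipschitz[OF \<theta>]
      by (intro norm_triangle_mono defect t Henstock_Kurzweil_Integration.integral_norm_bound_integral
          Henstock_Kurzweil_Integration.integrable_diff i g) auto
  qed (use T in simp)
  also have "\<dots> \<le> 2 * \<alpha> * exp (2 * (L * W))"
    using W L \<alpha> by (intro mult_left_mono) auto
  finally show ?thesis by (simp add: x_def)
qed

end

end

section \<open>Hausdorff distance and comparison of suprema\<close>

lemma hausdorff_distance_less_imp:
  fixes A B :: "'a::real_normed_vector set"
  assumes A: "bounded A" and B: "bounded B" "B \<noteq> {}" and d: "hausdorff_distance A B < d" and a: "a \<in> A"
  shows "\<exists>b\<in>B. norm (a - b) < d"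
proof -
  obtain MA MB where M: "\<And>x. x \<in> A \<Longrightarrow> norm x \<le> MA" "\<And>x. x \<in> B \<Longrightarrow> norm x \<le> MB"
    using A B(1) by (auto simp: bounded_iff)
  have below: "bdd_below ((\<lambda>b. norm (x - b)) ` B)" for x
    by (intro bdd_belowI[of _ 0]) auto
  \<comment> \<open>A real supremum bounds its members only if the set is bounded above; boundedness
    of \<open>A\<close> and \<open>B\<close> supplies this.\<close>
  have "(INF b\<in>B. norm (x - b)) \<le> MA + MB" if "x \<in> A" for x
  proof -
    obtain b where b: "b \<in> B" using B(2) by blast
    have "(INF b\<in>B. norm (x - b)) \<le> norm (x - b)" by (rule cINF_lower[OF below b])
    also have "\<dots> \<le> MA + MB" using norm_triangle_ineq4[of x b] M(1)[OF that] M(2)[OF b] by linarith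
    finally show ?thesis .
  qed
  then have "bdd_above ((\<lambda>x. INF b\<in>B. norm (x - b)) ` A)" by (intro bdd_aboveI[of _ "MA + MB"]) auto
  then have "(INF b\<in>B. norm (a - b)) \<le> (SUP x\<in>A. INF b\<in>B. norm (x - b))" using a by (rule cSUP_upper[rotated])
  also have "\<dots> < d" using d by (simp add: hausdorff_distance_def)
  finally show ?thesis using cINF_less_iff[OF B(2) below] by blast
qed

lemma hausdorff_distance_commute: "hausdorff_distance A B = hausdorff_distance B A"
  by (simp add: hausdorff_distance_def max.commute)

text \<open>The two-sided matching serves both a change of control over one parameter set and a
  change of parameter set under one control.\<close>

lemma abs_SUP_diff_le:
  fixes g h :: "'a \<Rightarrow> real"
  assumes ne: "A \<noteq> {}" "B \<noteq> {}" and bdd: "bdd_above (g ` A)" "bdd_above (h ` B)"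
    and 1: "\<And>x. x \<in> A \<Longrightarrow> \<exists>y\<in>B. g x \<le> h y + e" and 2: "\<And>y. y \<in> B \<Longrightarrow> \<exists>x\<in>A. h y \<le> g x + e"
  shows "\<bar>(SUP x\<in>A. g x) - (SUP y\<in>B. h y)\<bar> \<le> e"
proof -
  have "(SUP x\<in>A. g x) \<le> (SUP y\<in>B. h y) + e"
  proof (rule cSUP_least[OF ne(1)])
    fix x assume "x \<in> A"
    then obtain y where "y \<in> B" "g x \<le> h y + e" using 1 by blast
    then show "g x \<le> (SUP y\<in>B. h y) + e" using cSUP_upper[OF _ bdd(2), of y] by linarith
  qed
  moreover have "(SUP y\<in>B. h y) \<le> (SUP x\<in>A. g x) + e"
  proof (rule cSUP_least[OF ne(2)])
    fix y assume "y \<in> B"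
    then obtain x where "x \<in> A" "h y \<le> g x + e" using 2 by blast
    then show "h y \<le> (SUP x\<in>A. g x) + e" using cSUP_upper[OF _ bdd(1), of x] by linarith
  qed
  ultimately show ?thesis by linarith
qed

section \<open>Estimates of the states, uniform over a ball of controls and over the
  parameters\<close>

context control_ensemble
begin

text \<open>The value comes from truncation at level \<open>K = 1\<close>, by which the integral of
  \<open>norm u\<close> over \<open>[0,T]\<close> is at most \<open>T + R powr p\<close>.\<close>

definition weight_bound :: "real \<Rightarrow> real \<Rightarrow> real" where
  "weight_bound p R = T + real CARD('k) * (T + R powr p)"

lemma Lp_ball_absolutely_integrable:
  assumes "1 < p" "u \<in> Lp_ball p T R"
  shows "u absolutely_integrable_on {0..T}"
  using Lp_fun_imp_integrable[OF Lp_ballD(1)[OF assms(2)] assms(1)] assms(1)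
  by (simp add: absolutely_integrable_on_iff_lebesgue_on)

lemma integral_weight_interval_le:
  fixes u :: "real \<Rightarrow> real^'k"
  assumes p: "1 < p" and u: "u \<in> Lp_ball p T R" and st: "0 \<le> s" "s \<le> t" "t \<le> T" and K: "0 < K"
  shows "integral {s..t} (\<lambda>r. weight (u r)) \<le> (t - s) + real CARD('k) * (K * (t - s) + K powr (1 - p) * R powr p)"
proof -
  have sub: "{s..t} \<subseteq> {0..T}" using st by auto
  have ui: "integrable (lebesgue_on {s..t}) u"
    using absolutely_integrable_subinterval[OF Lp_ball_absolutely_integrable[OF p u] sub]
    by (simp add: absolutely_integrable_on_iff_lebesgue_on)
  then have wi: "integrable (lebesgue_on {s..t}) (\<lambda>r. weight (u r))" by (simp add: weight_def)
  have "integral {s..t} (\<lambda>r. weight (u r)) = (LINT r|lebesgue_on {s..t}. 1 + real CARD('k) * norm (u r))"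
    using lebesgue_integral_eq_integral[OF wi] by (simp add: weight_def)
  also have "\<dots> = (t - s) + real CARD('k) * (LINT r|lebesgue_on {s..t}. norm (u r))"
    using ui integral_const_interval[OF st(2), of 1] by simp
  also have "\<dots> \<le> (t - s) + real CARD('k) * (K * (t - s) + K powr (1 - p) * R powr p)"
    using integral_norm_interval_le[OF p u st K] by (intro add_left_mono mult_left_mono) auto
  finally show ?thesis .
qed

lemma integral_weight_le:
  fixes u :: "real \<Rightarrow> real^'k"
  assumes "1 < p" "u \<in> Lp_ball p T R" and t: "t \<in> {0..T}"
  shows "integral {0..t} (\<lambda>r. weight (u r)) \<le> weight_bound p R"
proof -
  have "integral {0..t} (\<lambda>r. weight (u r)) \<le> t + real CARD('k) * (t + R powr p)"
    using integral_weight_interval_le[OF assms(1,2), of 0 t 1] t by simp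
  also have "\<dots> \<le> weight_bound p R"
    unfolding weight_bound_def using t by (intro add_mono mult_left_mono) auto
  finally show ?thesis .
qed

text \<open>The zero function serves as approximate solution. Its defect is bounded because
  \<open>x0\<close> is bounded on the compact \<open>\<Theta>\<close> and the velocity at the origin
  is at most \<open>G\<close> times the weight.\<close>

lemma state_bounded:
  assumes p: "1 < p"
  shows "\<exists>B\<ge>0. \<forall>u\<in>Lp_ball p T R. \<forall>\<theta>\<in>\<Theta>. \<forall>t\<in>{0..T}. norm (state u t \<theta>) \<le> B"
proof -
  obtain G where G: "0 \<le> G" "\<And>\<theta> x. \<theta> \<in> \<Theta> \<Longrightarrow> norm (F0 x \<theta>) \<le> G + L * norm x"
    "\<And>\<theta> x i. \<theta> \<in> \<Theta> \<Longrightarrow> norm (F i x \<theta>) \<le> G + L * norm x"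
    using field_growth by metis
  have "bounded (x0 ` \<Theta>)"
    using compact_continuous_image[OF x0 \<Theta>] by (rule compact_imp_bounded)
  then obtain X where X: "0 \<le> X" "\<And>\<theta>. \<theta> \<in> \<Theta> \<Longrightarrow> norm (x0 \<theta>) \<le> X"
    unfolding bounded_pos by (metis image_eqI less_imp_le)
  define \<alpha> where "\<alpha> = X + G * weight_bound p R"
  have "norm (state u t \<theta> - 0) \<le> 2 * \<alpha> * exp (2 * (L * weight_bound p R))"
    if u: "u \<in> Lp_ball p T R" and \<theta>: "\<theta> \<in> \<Theta>" and t: "t \<in> {0..T}" for u \<theta> t
  proof (rule norm_state_diff_le[OF Lp_ball_absolutely_integrable[OF p u] \<theta> continuous_on_const _ integral_weight_le[OF p u] t])
    fix t assume t: "t \<in> {0..T}"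
    then have sub: "{0..t} \<subseteq> {0..T}" by auto
    have "norm (velocity \<theta> (u s) 0) \<le> weight (u s) * G" for s
      using velocity_growth[OF G(2,3)[OF \<theta>], where x=0 and w="u s"] by simp
    then have "norm (integral {0..t} (\<lambda>s. velocity \<theta> (u s) 0)) \<le> G * integral {0..t} (\<lambda>s. weight (u s))"
      using Lp_ball_absolutely_integrable[OF p u]
      by (intro norm_integral_le_weight velocity_integrable_on \<theta> sub continuous_on_const)
    also have "\<dots> \<le> G * weight_bound p R"
      using integral_weight_le[OF p u t] G(1) by (rule mult_left_mono)
    finally show "norm (x0 \<theta> + integral {0..t} (\<lambda>s. velocity \<theta> (u s) 0) - 0) \<le> \<alpha>"
      using X(2)[OF \<theta>] norm_triangle_ineq[of "x0 \<theta>" "integral {0..t} (\<lambda>s. velocity \<theta> (u s) 0)"]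
      by (simp add: \<alpha>_def)
  qed (use T in simp)
  moreover have "0 \<le> \<alpha>" using X G T by (simp add: \<alpha>_def weight_bound_def)
  ultimately show ?thesis by (intro exI[of _ "2 * \<alpha> * exp (2 * (L * weight_bound p R))"]) simp
qed

lemma field_bounded_along_states:
  assumes p: "1 < p"
  shows "\<exists>H>0. \<forall>u\<in>Lp_ball p T R. \<forall>\<theta>\<in>\<Theta>. \<forall>t\<in>{0..T}.
    (\<forall>i. norm (F i (state u t \<theta>) \<theta>) \<le> H) \<and> (\<forall>w. norm (velocity \<theta> w (state u t \<theta>)) \<le> weight w * H)"
proof -
  obtain G where G: "0 \<le> G" "\<And>\<theta> x. \<theta> \<in> \<Theta> \<Longrightarrow> norm (F0 x \<theta>) \<le> G + L * norm x"
    "\<And>\<theta> x i. \<theta> \<in> \<Theta> \<Longrightarrow> norm (F i x \<theta>) \<le> G + L * norm x"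
    using field_growth by metis
  obtain B where B: "0 \<le> B" "\<forall>u\<in>Lp_ball p T R. \<forall>\<theta>\<in>\<Theta>. \<forall>t\<in>{0..T}. norm (state u t \<theta>) \<le> B"
    using state_bounded[OF p, of R] by (elim exE conjE)
  define H where "H = G + L * B + 1"
  have "norm (F i (state u t \<theta>) \<theta>) \<le> H" "norm (velocity \<theta> w (state u t \<theta>)) \<le> weight w * H"
    if "u \<in> Lp_ball p T R" "\<theta> \<in> \<Theta>" "t \<in> {0..T}" for u \<theta> t i w
  proof -
    have "G + L * norm (state u t \<theta>) \<le> H"
      using mult_left_mono[OF B(2)[rule_format, OF that], of L] L unfolding H_def by linarith
    with G(3)[OF that(2)] show "norm (F i (state u t \<theta>) \<theta>) \<le> H" by (rule order_trans)
    have "norm (velocity \<theta> w (state u t \<theta>)) \<le> weight w * (G + L * norm (state u t \<theta>))"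
      by (rule velocity_growth[OF G(2,3)[OF that(2)]])
    also have "\<dots> \<le> weight w * H"
      using \<open>G + L * norm (state u t \<theta>) \<le> H\<close> weight_ge_1[of w] by (intro mult_left_mono) auto
    finally show "norm (velocity \<theta> w (state u t \<theta>)) \<le> weight w * H" .
  qed
  moreover have "0 < H" using G(1) B(1) L by (simp add: H_def add_nonneg_pos)
  ultimately show ?thesis by (intro exI[of _ H] conjI ballI allI)
qed

lemma state_equicontinuous:
  assumes p: "1 < p" and \<omega>: "0 < \<omega>"
  shows "\<exists>\<eta>>0. \<forall>u\<in>Lp_ball p T R. \<forall>\<theta>\<in>\<Theta>. \<forall>s\<in>{0..T}. \<forall>t\<in>{0..T}.
    \<bar>s - t\<bar> \<le> \<eta> \<longrightarrow> norm (state u s \<theta> - state u t \<theta>) \<le> \<omega>"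
proof -
  obtain H where H: "0 < H" and vel: "\<forall>u\<in>Lp_ball p T R. \<forall>\<theta>\<in>\<Theta>. \<forall>t\<in>{0..T}.
    (\<forall>i. norm (F i (state u t \<theta>) \<theta>) \<le> H) \<and> (\<forall>w. norm (velocity \<theta> w (state u t \<theta>)) \<le> weight w * H)"
    using field_bounded_along_states[OF p, of R] by (elim exE conjE)
  define k where "k = real CARD('k)"
  have k: "0 < k" by (simp add: k_def)
  \<comment> \<open>An increment is at most \<open>H * (1 + k * K) * (t - s)\<close> plus
    \<open>H * k\<close> times a tail. \<open>K\<close> makes the tail term at most
    \<open>\<omega> / 2\<close>, and then \<open>\<eta>\<close> does the same for the first
    term.\<close>
  obtain K where K: "0 < K" "K powr (1 - p) * R powr p < \<omega> / (2 * H * k)"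
    using tail_factor_small[OF p, of "\<omega> / (2 * H * k)" "R powr p"] \<omega> H k by auto
  define \<eta> where "\<eta> = \<omega> / (2 * H * (1 + k * K))"
  have den: "0 < 2 * H * (1 + k * K)" using H k K by (simp add: add_pos_pos)
  have \<eta>: "0 < \<eta>" using \<omega> den by (simp add: \<eta>_def)
  have step: "norm (state u t \<theta> - state u s \<theta>) \<le> \<omega>"
    if u: "u \<in> Lp_ball p T R" and \<theta>: "\<theta> \<in> \<Theta>" and st: "s \<in> {0..T}" "t \<in> {0..T}" "s \<le> t" "t - s \<le> \<eta>"
    for u \<theta> s t
  proof -
    note ui = Lp_ball_absolutely_integrable[OF p u]
    note x = state_solves[OF ui \<theta>]
    have sub: "{s..t} \<subseteq> {0..T}" "{0..t} \<subseteq> {0..T}" using st by auto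
    note vi = velocity_integrable_on[OF ui \<theta> x(1) sub(1)] velocity_integrable_on[OF ui \<theta> x(1) sub(2)]
    have "integral {0..s} (\<lambda>s. velocity \<theta> (u s) (state u s \<theta>)) + integral {s..t} (\<lambda>s. velocity \<theta> (u s) (state u s \<theta>))
        = integral {0..t} (\<lambda>s. velocity \<theta> (u s) (state u s \<theta>))"
      using st vi by (intro Henstock_Kurzweil_Integration.integral_combine) auto
    then have eq: "state u t \<theta> - state u s \<theta> = integral {s..t} (\<lambda>s. velocity \<theta> (u s) (state u s \<theta>))"
      unfolding x(2)[OF st(1)] x(2)[OF st(2)] by (simp add: algebra_simps)
    have "norm (state u t \<theta> - state u s \<theta>) \<le> H * integral {s..t} (\<lambda>s. weight (u s))"
      unfolding eq
    proof (rule norm_integral_le_weight[OF ui sub(1) vi(1)])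
      fix r assume "r \<in> {s..t}"
      with sub(1) have "r \<in> {0..T}" by blast
      with vel u \<theta> show "norm (velocity \<theta> (u r) (state u r \<theta>)) \<le> weight (u r) * H" by simp
    qed
    also have "\<dots> \<le> H * ((t - s) + k * (K * (t - s) + K powr (1 - p) * R powr p))"
      using integral_weight_interval_le[OF p u, of s t K] st K(1) H
      by (intro mult_left_mono) (auto simp: k_def)
    also have "\<dots> = H * (1 + k * K) * (t - s) + H * k * (K powr (1 - p) * R powr p)"
      by (simp add: algebra_simps)
    also have "\<dots> \<le> H * (1 + k * K) * \<eta> + H * k * (\<omega> / (2 * H * k))"
      using st(4) H k K by (intro add_mono mult_left_mono) auto
    also have "\<dots> = \<omega>" using H k den by (simp add: \<eta>_def field_simps)
    finally show ?thesis .
  qed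
  show ?thesis
  proof (intro exI[of _ \<eta>] conjI impI ballI \<eta>)
    fix u :: "real \<Rightarrow> real^'k" and \<theta> s t
    assume *: "u \<in> Lp_ball p T R" "\<theta> \<in> \<Theta>" "s \<in> {0..T}" "t \<in> {0..T}" "\<bar>s - t\<bar> \<le> \<eta>"
    show "norm (state u s \<theta> - state u t \<theta>) \<le> \<omega>"
    proof (cases "s \<le> t")
      case True
      with step[OF *(1-4)] *(5) show ?thesis by (simp add: norm_minus_commute)
    next
      case False
      with step[OF *(1,2,4,3)] *(5) show ?thesis by simp
    qed
  qed
qed

text \<open>This plays the role of the weak continuity of the map from controls to trajectories.\<close>

lemma state_stable:
  assumes p: "1 < p" and e: "0 < e"
  shows "\<exists>d>0. \<forall>v\<in>Lp_ball p T R. \<forall>w\<in>Lp_ball p T R.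
    (\<forall>t\<in>{0..T}. norm (integral {0..t} v - integral {0..t} w) \<le> d) \<longrightarrow>
    (\<forall>\<theta>\<in>\<Theta>. \<forall>t\<in>{0..T}. norm (state v t \<theta> - state w t \<theta>) \<le> e)"
proof -
  obtain H where H: "0 < H" and vel: "\<forall>u\<in>Lp_ball p T R. \<forall>\<theta>\<in>\<Theta>. \<forall>t\<in>{0..T}.
    (\<forall>i. norm (F i (state u t \<theta>) \<theta>) \<le> H) \<and> (\<forall>w. norm (velocity \<theta> w (state u t \<theta>)) \<le> weight w * H)"
    using field_bounded_along_states[OF p, of R] by (elim exE conjE)
  define k where "k = real CARD('k)"
  have k: "0 < k" by (simp add: k_def)
  define E where "E = 2 * exp (2 * (L * weight_bound p R))"
  have E: "0 < E" by (simp add: E_def)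
  define N where "N = 2 * (T + R powr p)"
  have N: "0 < N" using T by (simp add: N_def add_pos_nonneg)
  \<comment> \<open>The order of choices matters. \<open>E\<close> is the Gronwall factor,
    \<open>N\<close> bounds the \<open>L1\<close> norm of a component of \<open>v - w\<close>, and
    \<open>\<omega>\<close> makes \<open>E * k * N * \<omega> = e / 2\<close>. This fixes the mesh
    \<open>\<eta>\<close> and the number \<open>m\<close> of cells; only then is \<open>d\<close>
    chosen with \<open>E * k * D * d = e / 2\<close>. The states may oscillate by
    \<open>\<omega> / L\<close> because the fields are \<open>L\<close>-Lipschitz.\<close>
  define \<omega> where "\<omega> = e / (2 * E * k * N)"
  have \<omega>: "0 < \<omega>" using e E k N by (simp add: \<omega>_def)
  obtain \<eta> where \<eta>: "0 < \<eta>" and equi: "\<forall>u\<in>Lp_ball p T R. \<forall>\<theta>\<in>\<Theta>. \<forall>s\<in>{0..T}. \<forall>t\<in>{0..T}.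
    \<bar>s - t\<bar> \<le> \<eta> \<longrightarrow> norm (state u s \<theta> - state u t \<theta>) \<le> \<omega> / L"
    using state_equicontinuous[OF p divide_pos_pos[OF \<omega> L], of R] by (elim exE conjE)
  obtain m :: nat where m: "T / \<eta> \<le> real m" using real_arch_simple by blast
  have mT: "T \<le> real m * \<eta>" using m \<eta> by (simp add: field_simps)
  have m0: "0 < real m" using mT T \<eta> by (metis mult_zero_left not_le of_nat_0_less_iff of_nat_0 gr0I)
  define D where "D = real m * (2 * H)"
  have D: "0 < D" using m0 H by (simp add: D_def)
  define d where "d = e / (2 * E * k * D)"
  have d: "0 < d" using e E k D by (simp add: d_def)
  have main: "norm (state v t \<theta> - state w t \<theta>) \<le> e"
    if v: "v \<in> Lp_ball p T R" and w: "w \<in> Lp_ball p T R"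
      and close: "\<And>t. t \<in> {0..T} \<Longrightarrow> norm (integral {0..t} v - integral {0..t} w) \<le> d"
      and \<theta>: "\<theta> \<in> \<Theta>" and t: "t \<in> {0..T}" for v w \<theta> t
  proof -
    note vi = Lp_ball_absolutely_integrable[OF p v] and wi = Lp_ball_absolutely_integrable[OF p w]
    define y where "y t = state w t \<theta>" for t
    note y = state_solves[OF wi \<theta>, folded y_def]
    \<comment> \<open>The state of \<open>w\<close> is an approximate solution for the control
      \<open>v\<close>. Its defect is the integral of the sum of \<open>(v - w) $ i\<close> times
      \<open>F i\<close> along the state of \<open>w\<close>, so each component pairs a function of
      small primitive with an equicontinuous one.\<close>
    define \<alpha> where "\<alpha> = k * (\<omega> * N + real m * (2 * d * H))"
    have "norm (state v t \<theta> - y t) \<le> 2 * \<alpha> * exp (2 * (L * weight_bound p R))"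
    proof (rule norm_state_diff_le[OF vi \<theta> y(1) _ integral_weight_le[OF p v] t])
      fix t assume t: "t \<in> {0..T}"
      then have sub: "{0..t} \<subseteq> {0..T}" by auto
      define h where "h i s = (v s - w s) $ i" for i s
      have vw: "(\<lambda>s. v s - w s) absolutely_integrable_on {0..T}"
        using vi wi by (rule set_integral_diff(1))
      have hi: "h i absolutely_integrable_on {0..T}" for i
        using absolutely_integrable_linear[OF vw bounded_linear_vec_nth[of i]] by (simp add: comp_def h_def[abs_def])
      note gc = continuous_on_field(2)[OF \<theta> y(1)]
      have component: "norm (integral {0..t} (\<lambda>s. h i s *\<^sub>R F i (y s) \<theta>)) \<le> \<omega> * N + real m * (2 * d * H)" for i
      proof -
        have "norm (integral {0..t} (\<lambda>s. h i s *\<^sub>R F i (y s) \<theta>)) \<le>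
            \<omega> * integral {0..t} (\<lambda>s. \<bar>h i s\<bar>) + real m * (2 * d * H)"
        proof (rule norm_integral_product_le[OF hi gc])
          fix s assume s: "s \<in> {0..T}"
          show "norm (F i (y s) \<theta>) \<le> H" using vel w \<theta> s by (simp add: y_def)
          have "(\<lambda>s. v s - w s) integrable_on {0..s}"
            using absolutely_integrable_subinterval[OF vw, of 0 s] s by (auto simp: absolutely_integrable_on_def)
          from has_integral_linear[OF integrable_integral[OF this] bounded_linear_vec_nth[of i]]
          have "integral {0..s} (h i) = integral {0..s} (\<lambda>s. v s - w s) $ i"
            by (simp add: comp_def h_def[abs_def] integral_unique)
          also have "integral {0..s} (\<lambda>s. v s - w s) = integral {0..s} v - integral {0..s} w"
            using absolutely_integrable_subinterval[OF vi, of 0 s] absolutely_integrable_subinterval[OF wi, of 0 s] s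
            by (intro Henstock_Kurzweil_Integration.integral_diff) (auto simp: absolutely_integrable_on_def)
          finally show "\<bar>integral {0..s} (h i)\<bar> \<le> d"
            using close[OF s] component_le_norm_cart[of "integral {0..s} v - integral {0..s} w" i] by simp
        next
          fix s s' assume s: "s \<in> {0..T}" "s' \<in> {0..T}" "\<bar>s - s'\<bar> \<le> \<eta>"
          have "norm (F i (y s) \<theta> - F i (y s') \<theta>) \<le> L * norm (y s - y s')"
            using F_lipschitz[OF \<theta> \<theta>, of i "y s" "y s'"] by simp
          also have "\<dots> \<le> L * (\<omega> / L)"
            using equi[rule_format, OF w \<theta> s] L by (intro mult_left_mono) (auto simp: y_def)
          finally show "norm (F i (y s) \<theta> - F i (y s') \<theta>) \<le> \<omega>" using L by simp
        qed (use \<eta> t mT in auto)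
        also have "integral {0..t} (\<lambda>s. \<bar>h i s\<bar>) \<le> N"
        proof -
          have hL: "integrable (lebesgue_on {0..T}) (\<lambda>s. \<bar>h i s\<bar>)"
            using hi by (simp add: absolutely_integrable_on_iff_lebesgue_on)
          have vL: "integrable (lebesgue_on {0..T}) v" "integrable (lebesgue_on {0..T}) w"
            using vi wi by (simp_all add: absolutely_integrable_on_iff_lebesgue_on)
          have "integral {0..t} (\<lambda>s. \<bar>h i s\<bar>) \<le> integral {0..T} (\<lambda>s. \<bar>h i s\<bar>)"
            using hi absolutely_integrable_subinterval[OF hi sub] sub
            by (intro integral_subset_le) (auto simp: absolutely_integrable_on_def)
          also have "\<dots> = (LINT s|lebesgue_on {0..T}. \<bar>h i s\<bar>)"
            using hL by (simp add: lebesgue_integral_eq_integral)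
          also have "\<dots> \<le> (LINT s|lebesgue_on {0..T}. norm (v s) + norm (w s))"
          proof (rule integral_mono[OF hL])
            show "\<bar>h i s\<bar> \<le> norm (v s) + norm (w s)" for s
              using component_le_norm_cart[of "v s - w s" i] norm_triangle_ineq4[of "v s" "w s"] by (simp add: h_def)
          qed (use vL in auto)
          also have "\<dots> = (LINT s|lebesgue_on {0..T}. norm (v s)) + (LINT s|lebesgue_on {0..T}. norm (w s))"
            using vL by simp
          also have "\<dots> \<le> N"
            using integral_norm_interval_le[OF p v, of 0 T 1] integral_norm_interval_le[OF p w, of 0 T 1] T
            by (simp add: N_def)
          finally show ?thesis .
        qed
        finally show ?thesis using \<omega> by (simp add: mult_left_mono)
      qed
      note i = velocity_integrable_on[OF vi \<theta> y(1) sub] velocity_integrable_on[OF wi \<theta> y(1) sub]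
      have "x0 \<theta> + integral {0..t} (\<lambda>s. velocity \<theta> (v s) (y s)) - y t =
          integral {0..t} (\<lambda>s. velocity \<theta> (v s) (y s) - velocity \<theta> (w s) (y s))"
        unfolding Henstock_Kurzweil_Integration.integral_diff[OF i] by (subst y(2)[OF t]) simp
      also have "\<dots> = integral {0..t} (\<lambda>s. \<Sum>i\<in>UNIV. h i s *\<^sub>R F i (y s) \<theta>)"
        by (simp add: velocity_def field_matrix_vector_mult h_def scaleR_diff_left sum_subtractf)
      also have "\<dots> = (\<Sum>i\<in>UNIV. integral {0..t} (\<lambda>s. h i s *\<^sub>R F i (y s) \<theta>))"
        using absolutely_integrable_subinterval[OF absolutely_integrable_scaleR_continuous[OF hi gc] sub]
        by (simp add: integral_sum absolutely_integrable_on_def)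
      finally have split: "x0 \<theta> + integral {0..t} (\<lambda>s. velocity \<theta> (v s) (y s)) - y t =
          (\<Sum>i\<in>UNIV. integral {0..t} (\<lambda>s. h i s *\<^sub>R F i (y s) \<theta>))" .
      have "norm (\<Sum>i\<in>UNIV. integral {0..t} (\<lambda>s. h i s *\<^sub>R F i (y s) \<theta>)) \<le>
          (\<Sum>i\<in>(UNIV::'k set). \<omega> * N + real m * (2 * d * H))"
        by (intro sum_norm_le component)
      then show "norm (x0 \<theta> + integral {0..t} (\<lambda>s. velocity \<theta> (v s) (y s)) - y t) \<le> \<alpha>"
        unfolding split by (simp add: \<alpha>_def k_def)
    qed (use T in simp)
    also have "\<dots> = E * k * N * \<omega> + E * k * D * d"
      by (simp add: E_def \<alpha>_def D_def algebra_simps)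
    also have "E * k * N * \<omega> = e / 2" using E k N by (simp add: \<omega>_def)
    also have "E * k * D * d = e / 2" using E k D by (simp add: d_def)
    finally show ?thesis by (simp add: y_def)
  qed
  show ?thesis
    by (intro exI[of _ d] conjI d ballI impI main) auto
qed

text \<open>With equal states \<open>y\<close>, the parameter part of the Lipschitz condition
  carries the factor \<open>norm (y + y)\<close>, at most \<open>2 * B\<close> by boundedness of the
  states. This is the source of the second term of \<open>\<alpha>\<close>.\<close>

lemma state_continuous_in_parameter:
  assumes p: "1 < p" and u: "u \<in> Lp_ball p T R" and t: "t \<in> {0..T}"
  shows "continuous_on \<Theta> (state u t)"
proof -
  obtain B where B: "0 \<le> B" "\<forall>u\<in>Lp_ball p T R. \<forall>\<theta>\<in>\<Theta>. \<forall>t\<in>{0..T}. norm (state u t \<theta>) \<le> B"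
    using state_bounded[OF p, of R] by (elim exE conjE)
  define W where "W = weight_bound p R"
  note ui = Lp_ball_absolutely_integrable[OF p u]
  define \<alpha> where "\<alpha> \<theta>1 \<theta>2 = norm (x0 \<theta>1 - x0 \<theta>2) + L * (2 * B * norm (\<theta>1 - \<theta>2)) * W" for \<theta>1 \<theta>2
  have est: "norm (state u t \<theta>1 - state u t \<theta>2) \<le> 2 * \<alpha> \<theta>1 \<theta>2 * exp (2 * (L * W))"
    if \<theta>: "\<theta>1 \<in> \<Theta>" "\<theta>2 \<in> \<Theta>" for \<theta>1 \<theta>2
    unfolding W_def
  proof (rule norm_state_diff_le[OF ui \<theta>(1) state_solves(1)[OF ui \<theta>(2)] _ integral_weight_le[OF p u] t])
    fix t assume t: "t \<in> {0..T}"
    then have sub: "{0..t} \<subseteq> {0..T}" by auto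
    define y where "y t = state u t \<theta>2" for t
    note y = state_solves[OF ui \<theta>(2), folded y_def]
    note i = velocity_integrable_on[OF ui \<theta>(1) y(1) sub] velocity_integrable_on[OF ui \<theta>(2) y(1) sub]
    define b where "b = L * (2 * B * norm (\<theta>1 - \<theta>2))"
    have b: "0 \<le> b" using B(1) L by (simp add: b_def)
    have "norm (integral {0..t} (\<lambda>s. velocity \<theta>1 (u s) (y s) - velocity \<theta>2 (u s) (y s))) \<le>
        b * integral {0..t} (\<lambda>s. weight (u s))"
    proof (rule norm_integral_le_weight[OF ui sub])
      fix s assume "s \<in> {0..t}"
      with sub have s: "s \<in> {0..T}" by blast
      have "norm (y s + y s) \<le> 2 * B"
        using B(2)[rule_format, OF u \<theta>(2) s] norm_triangle_ineq[of "y s" "y s"] by (simp add: y_def)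
      then have "L * weight (u s) * (norm (y s + y s) * norm (\<theta>1 - \<theta>2)) \<le> L * weight (u s) * (2 * B * norm (\<theta>1 - \<theta>2))"
        using L weight_ge_1[of "u s"] by (intro mult_left_mono mult_right_mono) auto
      with velocity_diff[OF \<theta>, of "u s" "y s" "y s"]
      show "norm (velocity \<theta>1 (u s) (y s) - velocity \<theta>2 (u s) (y s)) \<le> weight (u s) * b"
        by (simp add: b_def mult_ac)
    qed (intro Henstock_Kurzweil_Integration.integrable_diff i)
    also have "\<dots> \<le> b * W"
      unfolding W_def using integral_weight_le[OF p u t] b by (rule mult_left_mono)
    finally have "norm (integral {0..t} (\<lambda>s. velocity \<theta>1 (u s) (y s) - velocity \<theta>2 (u s) (y s))) \<le> b * W" .
    moreover have split: "x0 \<theta>1 + integral {0..t} (\<lambda>s. velocity \<theta>1 (u s) (y s)) - y t = (x0 \<theta>1 - x0 \<theta>2) +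
        integral {0..t} (\<lambda>s. velocity \<theta>1 (u s) (y s) - velocity \<theta>2 (u s) (y s))"
      unfolding Henstock_Kurzweil_Integration.integral_diff[OF i] by (subst y(2)[OF t]) simp
    ultimately have "norm (x0 \<theta>1 + integral {0..t} (\<lambda>s. velocity \<theta>1 (u s) (y s)) - y t) \<le> \<alpha> \<theta>1 \<theta>2"
      unfolding split \<alpha>_def b_def by (intro norm_triangle_mono order_refl)
    then show "norm (x0 \<theta>1 + integral {0..t} (\<lambda>s. velocity \<theta>1 (u s) (state u s \<theta>2)) - state u t \<theta>2) \<le> \<alpha> \<theta>1 \<theta>2"
      by (simp add: y_def)
  qed (use T in simp)
  show ?thesis
    unfolding continuous_on_def
  proof
    fix \<theta> assume \<theta>: "\<theta> \<in> \<Theta>"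
    have "((\<lambda>\<theta>'. 2 * \<alpha> \<theta>' \<theta> * exp (2 * (L * W))) \<longlongrightarrow> 2 * \<alpha> \<theta> \<theta> * exp (2 * (L * W))) (at \<theta> within \<Theta>)"
      unfolding \<alpha>_def using x0 \<theta> by (intro tendsto_intros) (auto simp: continuous_on_def)
    then have lim: "((\<lambda>\<theta>'. 2 * \<alpha> \<theta>' \<theta> * exp (2 * (L * W))) \<longlongrightarrow> 0) (at \<theta> within \<Theta>)"
      by (simp add: \<alpha>_def)
    have "((\<lambda>\<theta>'. state u t \<theta>' - state u t \<theta>) \<longlongrightarrow> 0) (at \<theta> within \<Theta>)"
      by (rule Lim_null_comparison[OF _ lim]) (use est \<theta> in \<open>auto simp: eventually_at_filter\<close>)
    then show "(state u t \<longlongrightarrow> state u t \<theta>) (at \<theta> within \<Theta>)"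
      by (rule LIM_zero_cancel)
  qed
qed

section \<open>The worst-case end-point cost as a real number\<close>

definition max_cost :: "(real^'d \<Rightarrow> real^'l \<Rightarrow> real) \<Rightarrow> (real^'l) set \<Rightarrow> (real \<Rightarrow> real^'k) \<Rightarrow> real" where
  "max_cost a S u = (SUP \<theta>\<in>S. a (state u T \<theta>) \<theta>)"

context
  fixes a :: "real^'d \<Rightarrow> real^'l \<Rightarrow> real" and p R :: real
  assumes a: "continuous_on (UNIV \<times> \<Theta>) (\<lambda>(x, \<theta>). a x \<theta>)" and p: "1 < p"
begin

lemma continuous_on_end_cost:
  assumes u: "u \<in> Lp_ball p T R"
  shows "continuous_on \<Theta> (\<lambda>\<theta>. a (state u T \<theta>) \<theta>)"
proof -
  have "continuous_on \<Theta> (\<lambda>\<theta>. (state u T \<theta>, \<theta>))"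
    using state_continuous_in_parameter[OF p u, of T] T by (intro continuous_intros) auto
  from continuous_on_compose2[OF a this] show ?thesis by auto
qed

lemma end_cost_bdd_above:
  assumes u: "u \<in> Lp_ball p T R" and S: "S \<subseteq> \<Theta>"
  shows "bdd_above ((\<lambda>\<theta>. a (state u T \<theta>) \<theta>) ` S)"
  using compact_continuous_image[OF continuous_on_end_cost[OF u] \<Theta>] S
  by (meson bdd_above_mono bounded_imp_bdd_above compact_imp_bounded image_mono)

lemma SUP_end_cost:
  assumes u: "u \<in> Lp_ball p T R" and S: "S \<subseteq> \<Theta>" "S \<noteq> {}"
  shows "(SUP \<theta>\<in>S. ereal (a (state u T \<theta>) \<theta>)) = ereal (max_cost a S u)"
proof (rule antisym)
  show "(SUP \<theta>\<in>S. ereal (a (state u T \<theta>) \<theta>)) \<le> ereal (max_cost a S u)"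
    unfolding max_cost_def using end_cost_bdd_above[OF u S(1)] by (intro SUP_least) (simp, rule cSUP_upper)
  show "ereal (max_cost a S u) \<le> (SUP \<theta>\<in>S. ereal (a (state u T \<theta>) \<theta>))"
  proof (rule ereal_le_epsilon2)
    fix e :: real assume "0 < e"
    then have "max_cost a S u - e < (SUP \<theta>\<in>S. a (state u T \<theta>) \<theta>)" by (simp add: max_cost_def)
    then obtain \<theta> where \<theta>: "\<theta> \<in> S" "max_cost a S u - e < a (state u T \<theta>) \<theta>"
      using less_cSUP_iff[OF S(2) end_cost_bdd_above[OF u S(1)]] by blast
    have "ereal (max_cost a S u) \<le> ereal (a (state u T \<theta>) \<theta>) + ereal e" using \<theta>(2) by simp
    also have "\<dots> \<le> (SUP \<theta>\<in>S. ereal (a (state u T \<theta>) \<theta>)) + ereal e"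
      using \<theta>(1) by (intro add_right_mono SUP_upper)
    finally show "ereal (max_cost a S u) \<le> (SUP \<theta>\<in>S. ereal (a (state u T \<theta>) \<theta>)) + ereal e" .
  qed
qed

lemma max_cost_nonneg:
  assumes u: "u \<in> Lp_ball p T R" and S: "S \<subseteq> \<Theta>" "S \<noteq> {}" and nonneg: "\<And>x \<theta>. \<theta> \<in> \<Theta> \<Longrightarrow> 0 \<le> a x \<theta>"
  shows "0 \<le> max_cost a S u"
proof -
  obtain \<theta> where "\<theta> \<in> S" using S(2) by blast
  then show ?thesis
    unfolding max_cost_def using nonneg S(1) by (intro cSUP_upper2[OF end_cost_bdd_above[OF u S(1)]]) auto
qed

text \<open>\<open>d\<close> is chosen before the parameter set \<open>S\<close>: state stability is
  uniform in \<theta>, and \<open>a\<close> is uniformly continuous on the product of a ball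
  containing all end points with \<open>\<Theta>\<close>. One modulus therefore serves all
  functionals of a sequence.\<close>

lemma max_cost_stable:
  assumes e: "0 < e"
  shows "\<exists>d>0. \<forall>S. S \<subseteq> \<Theta> \<longrightarrow> S \<noteq> {} \<longrightarrow> (\<forall>v\<in>Lp_ball p T R. \<forall>w\<in>Lp_ball p T R.
    (\<forall>t\<in>{0..T}. norm (integral {0..t} v - integral {0..t} w) \<le> d) \<longrightarrow> \<bar>max_cost a S v - max_cost a S w\<bar> \<le> e)"
proof -
  obtain B where B: "\<forall>u\<in>Lp_ball p T R. \<forall>\<theta>\<in>\<Theta>. \<forall>t\<in>{0..T}. norm (state u t \<theta>) \<le> B"
    using state_bounded[OF p, of R] by (elim exE conjE)
  have "uniformly_continuous_on (cball 0 B \<times> \<Theta>) (\<lambda>(x, \<theta>). a x \<theta>)"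
    using \<Theta> by (intro compact_uniformly_continuous continuous_on_subset[OF a] compact_Times) auto
  then obtain \<eta> where \<eta>: "0 < \<eta>" "\<And>z z'. z \<in> cball 0 B \<times> \<Theta> \<Longrightarrow> z' \<in> cball 0 B \<times> \<Theta> \<Longrightarrow> dist z' z < \<eta> \<Longrightarrow>
      dist ((\<lambda>(x, \<theta>). a x \<theta>) z') ((\<lambda>(x, \<theta>). a x \<theta>) z) < e"
    unfolding uniformly_continuous_on_def using e by meson
  obtain d where d: "0 < d" "\<forall>v\<in>Lp_ball p T R. \<forall>w\<in>Lp_ball p T R.
    (\<forall>t\<in>{0..T}. norm (integral {0..t} v - integral {0..t} w) \<le> d) \<longrightarrow>
    (\<forall>\<theta>\<in>\<Theta>. \<forall>t\<in>{0..T}. norm (state v t \<theta> - state w t \<theta>) \<le> \<eta> / 2)"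
    using state_stable[OF p half_gt_zero[OF \<eta>(1)], of R] by (elim exE conjE)
  show ?thesis
  proof (intro exI[of _ d] conjI d(1) allI impI ballI)
    fix S and v w :: "real \<Rightarrow> real^'k"
    assume S: "S \<subseteq> \<Theta>" "S \<noteq> {}" and vw: "v \<in> Lp_ball p T R" "w \<in> Lp_ball p T R"
      and close: "\<forall>t\<in>{0..T}. norm (integral {0..t} v - integral {0..t} w) \<le> d"
    have "\<bar>a (state v T \<theta>) \<theta> - a (state w T \<theta>) \<theta>\<bar> \<le> e" if "\<theta> \<in> S" for \<theta>
    proof -
      have \<theta>: "\<theta> \<in> \<Theta>" "T \<in> {0..T}" using that S(1) T by auto
      have "norm (state v T \<theta> - state w T \<theta>) \<le> \<eta> / 2"
        using d(2) vw close \<theta> by blast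
      then have "dist (state v T \<theta>, \<theta>) (state w T \<theta>, \<theta>) < \<eta>"
        using \<eta>(1) by (simp add: dist_Pair_Pair dist_norm)
      from \<eta>(2)[OF _ _ this] B[rule_format, OF vw(1) \<theta>] B[rule_format, OF vw(2) \<theta>] \<theta>
      show ?thesis by (simp add: dist_real_def)
    qed
    note pt = this
    show "\<bar>max_cost a S v - max_cost a S w\<bar> \<le> e"
      unfolding max_cost_def
    proof (rule abs_SUP_diff_le[OF S(2) S(2) end_cost_bdd_above[OF vw(1) S(1)] end_cost_bdd_above[OF vw(2) S(1)]])
      fix \<theta> assume \<theta>: "\<theta> \<in> S"
      show "\<exists>\<theta>'\<in>S. a (state v T \<theta>) \<theta> \<le> a (state w T \<theta>') \<theta>' + e"
        using pt[OF \<theta>] by (intro bexI[OF _ \<theta>]) linarith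
      show "\<exists>\<theta>'\<in>S. a (state w T \<theta>) \<theta> \<le> a (state v T \<theta>') \<theta>' + e"
        using pt[OF \<theta>] by (intro bexI[OF _ \<theta>]) linarith
    qed
  qed
qed

text \<open>For one control the end-point cost is uniformly continuous on \<open>\<Theta>\<close>,
  and Hausdorff closeness matches each point of either set with a nearby point of the other.\<close>

lemma max_cost_tendsto:
  assumes u: "u \<in> Lp_ball p T R" and Sn: "\<And>n. Sn n \<subseteq> \<Theta>" "\<And>n. Sn n \<noteq> {}" and S: "S \<subseteq> \<Theta>" "S \<noteq> {}"
    and lim: "(\<lambda>n. hausdorff_distance (Sn n) S) \<longlonglongrightarrow> 0"
  shows "(\<lambda>n. max_cost a (Sn n) u) \<longlonglongrightarrow> max_cost a S u"
proof (rule LIMSEQ_I)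
  fix e :: real assume e: "0 < e"
  define g where "g \<theta> = a (state u T \<theta>) \<theta>" for \<theta>
  have "uniformly_continuous_on \<Theta> g"
    unfolding g_def by (rule compact_uniformly_continuous[OF continuous_on_end_cost[OF u] \<Theta>])
  then obtain d where d: "0 < d" "\<And>\<theta> \<theta>'. \<theta> \<in> \<Theta> \<Longrightarrow> \<theta>' \<in> \<Theta> \<Longrightarrow> dist \<theta>' \<theta> < d \<Longrightarrow> dist (g \<theta>') (g \<theta>) < e / 2"
    unfolding uniformly_continuous_on_def using half_gt_zero[OF e] by meson
  have "\<forall>\<^sub>F n in sequentially. hausdorff_distance (Sn n) S < d"
    using lim d(1) by (rule order_tendstoD(2))
  then obtain N where N: "\<And>n. N \<le> n \<Longrightarrow> hausdorff_distance (Sn n) S < d"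
    unfolding eventually_sequentially by blast
  have bd: "bounded X" if "X \<subseteq> \<Theta>" for X
    using compact_imp_bounded[OF \<Theta>] that by (rule bounded_subset)
  have "\<bar>max_cost a (Sn n) u - max_cost a S u\<bar> \<le> e / 2" if n: "N \<le> n" for n
    unfolding max_cost_def
  proof (rule abs_SUP_diff_le[OF Sn(2) S(2) end_cost_bdd_above[OF u Sn(1)] end_cost_bdd_above[OF u S(1)]])
    fix \<theta> assume \<theta>: "\<theta> \<in> Sn n"
    obtain \<theta>' where \<theta>': "\<theta>' \<in> S" "norm (\<theta> - \<theta>') < d"
      using hausdorff_distance_less_imp[OF bd[OF Sn(1)] bd[OF S(1)] S(2) N[OF n] \<theta>] by blast
    have "dist (g \<theta>) (g \<theta>') < e / 2"
      using \<theta> \<theta>' S(1) Sn(1)[of n] by (intro d(2)) (auto simp: dist_norm)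
    then show "\<exists>\<theta>'\<in>S. a (state u T \<theta>) \<theta> \<le> a (state u T \<theta>') \<theta>' + e / 2"
      unfolding g_def dist_real_def by (intro bexI[OF _ \<theta>'(1)]) linarith
  next
    fix \<theta> assume \<theta>: "\<theta> \<in> S"
    have "hausdorff_distance S (Sn n) < d" using N[OF n] by (simp add: hausdorff_distance_commute)
    then obtain \<theta>' where \<theta>': "\<theta>' \<in> Sn n" "norm (\<theta> - \<theta>') < d"
      using hausdorff_distance_less_imp[OF bd[OF S(1)] bd[OF Sn(1)] Sn(2) _ \<theta>] by blast
    have "dist (g \<theta>) (g \<theta>') < e / 2"
      using \<theta> \<theta>' S(1) Sn(1)[of n] by (intro d(2)) (auto simp: dist_norm)
    then show "\<exists>\<theta>'\<in>Sn n. a (state u T \<theta>) \<theta> \<le> a (state u T \<theta>') \<theta>' + e / 2"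
      unfolding g_def dist_real_def by (intro bexI[OF _ \<theta>'(1)]) linarith
  qed
  then have "norm (max_cost a (Sn n) u - max_cost a S u) < e" if "N \<le> n" for n
    using that e by (force simp: real_norm_def)
  then show "\<exists>N. \<forall>n\<ge>N. norm (max_cost a (Sn n) u - max_cost a S u) < e" by blast
qed

end

end

section \<open>Minimizers\<close>

locale ensemble_problem =
  control_ensemble T L \<Theta> F0 F x0 + convex_integrand p T C f c
  for T L :: real and \<Theta> :: "(real^'l) set"
    and F0 :: "real^'d \<Rightarrow> real^'l \<Rightarrow> real^'d" and F :: "'k::finite \<Rightarrow> real^'d \<Rightarrow> real^'l \<Rightarrow> real^'d"
    and x0 :: "real^'l \<Rightarrow> real^'d" and p C :: real and f :: "real \<Rightarrow> real^'k \<Rightarrow> real" and c :: "real \<Rightarrow> real" +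
  fixes a :: "real^'d \<Rightarrow> real^'l \<Rightarrow> real"
  assumes a_continuous: "continuous_on (UNIV \<times> \<Theta>) (\<lambda>(x, \<theta>). a x \<theta>)"
    and a_nonneg: "\<And>x \<theta>. \<theta> \<in> \<Theta> \<Longrightarrow> 0 \<le> a x \<theta>"
begin

abbreviation cost :: "(real^'l) set \<Rightarrow> (real \<Rightarrow> real^'k) \<Rightarrow> ereal" where
  "cost \<equiv> ensemble_cost T F0 F x0 a f"

abbreviation finite_cost :: "(real^'l) set \<Rightarrow> (real \<Rightarrow> real^'k) \<Rightarrow> real" where
  "finite_cost S u \<equiv> max_cost a S u + running_cost u"

lemma Lp_fun_in_ball: "u \<in> Lp_fun p T \<Longrightarrow> u \<in> Lp_ball p T (Lp_norm p T u)"
  by (simp add: Lp_ball_def)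

text \<open>The end-point part is always finite, so integrability of the running cost alone decides
  finiteness; comparisons of \<open>ereal\<close> costs become comparisons of reals. The ball is the
  one whose radius is the norm of \<open>u\<close> itself.\<close>

lemma cost_eq:
  assumes "u \<in> Lp_fun p T" "S \<subseteq> \<Theta>" "S \<noteq> {}"
  shows "cost S u = (if integrable M (\<lambda>t. f t (u t)) then ereal (finite_cost S u) else \<infinity>)"
  using SUP_end_cost[OF a_continuous p Lp_fun_in_ball[OF assms(1)] assms(2,3)]
    extended_running_cost[OF Lp_funD(1)[OF assms(1)]]
  by (simp add: ensemble_cost_def)

lemma max_cost_ge_0:
  assumes "u \<in> Lp_fun p T" "S \<subseteq> \<Theta>" "S \<noteq> {}"
  shows "0 \<le> max_cost a S u"
  using max_cost_nonneg[OF a_continuous p Lp_fun_in_ball[OF assms(1)] assms(2,3) a_nonneg] by simp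

lemma Lp_norm_coercive:
  assumes "u \<in> Lp_fun p T" "integrable M (\<lambda>t. f t (u t))"
  shows "C * (LINT t|M. norm (u t) powr p) \<le> running_cost u + integral\<^sup>L M c"
proof -
  have "(LINT t|M. C * norm (u t) powr p) \<le> (LINT t|M. f t (u t) + c t)"
  proof (rule integral_mono_AE)
    show "AE t in M. C * norm (u t) powr p \<le> f t (u t) + c t"
      using f_coercive by eventually_elim (simp add: diff_le_eq)
  qed (use Lp_funD(2)[OF assms(1)] assms(2) c_integrable in auto)
  then show ?thesis using assms(2) c_integrable by simp
qed

lemma primitives_close:
  assumes u: "\<And>n. u n \<in> Lp_fun p T" and v: "v \<in> Lp_fun p T"
    and lim: "(\<lambda>n. Lp_norm p T (\<lambda>t. u n t - v t)) \<longlonglongrightarrow> 0" and d: "0 < d"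
  shows "\<forall>\<^sub>F n in sequentially. \<forall>t\<in>{0..T}. norm (integral {0..t} (u n :: real \<Rightarrow> real^'k) - integral {0..t} v) \<le> d"
proof -
  \<comment> \<open>\<open>K * T = d / 2\<close> takes one half of the tolerance; the tail term
    tends to 0 with the norm and takes the other half.\<close>
  define K where "K = d / (2 * T)"
  have K: "0 < K" "K * T = d / 2" using d control_ensemble.T[OF control_ensemble_axioms] by (auto simp: K_def)
  have "(\<lambda>n. K powr (1 - p) * Lp_norm p T (\<lambda>t. u n t - v t) powr p) \<longlonglongrightarrow> K powr (1 - p) * 0"
    using lim p0 by (intro tendsto_mult tendsto_const tendsto_zero_powrI[where b=p]) (auto simp: Lp_norm_nonneg)
  then have "\<forall>\<^sub>F n in sequentially. K powr (1 - p) * Lp_norm p T (\<lambda>t. u n t - v t) powr p < d / 2"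
    using d by (intro order_tendstoD(2)) auto
  then show ?thesis
  proof eventually_elim
    case (elim n)
    show ?case
    proof
      fix t assume t: "t \<in> {0..T}"
      have diff: "(\<lambda>t. u n t - v t) \<in> Lp_ball p T (Lp_norm p T (\<lambda>t. u n t - v t))"
        using u v p by (intro Lp_fun_in_ball Lp_fun_diff) auto
      have "(\<lambda>s. u n s) integrable_on {0..t}" "v integrable_on {0..t}"
        using absolutely_integrable_subinterval[OF Lp_ball_absolutely_integrable[OF p Lp_fun_in_ball[OF u]], of 0 t]
          absolutely_integrable_subinterval[OF Lp_ball_absolutely_integrable[OF p Lp_fun_in_ball[OF v]], of 0 t] t
        by (simp_all add: absolutely_integrable_on_def)
      then have "integral {0..t} (u n) - integral {0..t} v = integral {0..t} (\<lambda>s. u n s - v s)"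
        by (simp add: Henstock_Kurzweil_Integration.integral_diff)
      also have "norm \<dots> \<le> K * t + K powr (1 - p) * Lp_norm p T (\<lambda>t. u n t - v t) powr p"
        using norm_primitive_diff_le[OF p diff, of 0 t K] t K(1) by simp
      also have "K * t \<le> K * T" using t K(1) by (intro mult_left_mono) auto
      finally show "norm (integral {0..t} (u n) - integral {0..t} v) \<le> d" using elim K(2) by simp
    qed
  qed
qed

text \<open>The end-point costs converge, whereas for the running costs Fatou gives only an upper
  bound on the cost of the limit. Hence the end-point costs are subtracted from \<open>B n\<close>
  before Fatou is applied. Existence and identification of minimizers both use this lemma.\<close>

lemma cost_limit_le:
  fixes u :: "nat \<Rightarrow> real \<Rightarrow> real^'k"
  assumes u: "\<And>n. u n \<in> Lp_ball p T R" "\<And>n. integrable M (\<lambda>t. f t (u n t))" and v: "v \<in> Lp_fun p T"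
    and lim: "(\<lambda>n. Lp_norm p T (\<lambda>t. u n t - v t)) \<longlonglongrightarrow> 0"
    and Sn: "\<And>n. Sn n \<subseteq> \<Theta>" "\<And>n. Sn n \<noteq> {}" and S: "S \<subseteq> \<Theta>" "S \<noteq> {}"
    and haus: "(\<lambda>n. hausdorff_distance (Sn n) S) \<longlonglongrightarrow> 0"
    and le: "\<And>n. finite_cost (Sn n) (u n) \<le> B n" and B: "B \<longlonglongrightarrow> b"
  shows "v \<in> Lp_ball p T R" "integrable M (\<lambda>t. f t (v t))" "finite_cost S v \<le> b"
proof -
  have p1: "1 \<le> p" using p by simp
  have uL: "u n \<in> Lp_fun p T" for n using Lp_ballD(1)[OF u(1) p0] .
  have "Lp_norm p T v \<le> Lp_norm p T (\<lambda>t. u n t - v t) + R" for n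
  proof -
    have "Lp_norm p T (\<lambda>t. v t - 0) \<le> Lp_norm p T (\<lambda>t. v t - u n t) + Lp_norm p T (\<lambda>t. u n t - 0)"
      using v uL p0 by (intro Lp_norm_triangle_diff[OF p1]) (auto simp: Lp_fun_def)
    moreover have "Lp_norm p T (u n) \<le> R" using u(1) by (simp add: Lp_ball_def)
    ultimately show ?thesis using Lp_norm_minus_commute[of p T v "u n"] by simp
  qed
  moreover have "(\<lambda>n. Lp_norm p T (\<lambda>t. u n t - v t) + R) \<longlonglongrightarrow> 0 + R" by (intro tendsto_intros lim)
  ultimately have "Lp_norm p T v \<le> R" using LIMSEQ_le_const by fastforce
  then show v_ball: "v \<in> Lp_ball p T R" using v by (simp add: Lp_ball_def)
  \<comment> \<open>The control is replaced by its limit over the fixed set \<open>Sn n\<close>,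
    with a modulus independent of \<open>n\<close>; then the set is replaced under the fixed control
    \<open>v\<close>.\<close>
  have end_lim: "(\<lambda>n. max_cost a (Sn n) (u n)) \<longlonglongrightarrow> max_cost a S v"
  proof (rule LIM_zero_cancel, rule LIMSEQ_I)
    fix e :: real assume e: "0 < e"
    obtain d where d: "0 < d" and stable: "\<forall>S. S \<subseteq> \<Theta> \<longrightarrow> S \<noteq> {} \<longrightarrow> (\<forall>v\<in>Lp_ball p T R. \<forall>w\<in>Lp_ball p T R.
        (\<forall>t\<in>{0..T}. norm (integral {0..t} v - integral {0..t} w) \<le> d) \<longrightarrow> \<bar>max_cost a S v - max_cost a S w\<bar> \<le> e / 2)"
      using max_cost_stable[OF a_continuous p half_gt_zero[OF e], of R] by (elim exE conjE)
    have "(\<lambda>n. max_cost a (Sn n) v) \<longlonglongrightarrow> max_cost a S v"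
      by (rule max_cost_tendsto[OF a_continuous p v_ball Sn S haus])
    then have "\<forall>\<^sub>F n in sequentially. \<bar>max_cost a (Sn n) v - max_cost a S v\<bar> < e / 2"
      using half_gt_zero[OF e] unfolding tendsto_iff dist_real_def by blast
    with primitives_close[OF uL v lim d]
    have "\<forall>\<^sub>F n in sequentially. norm ((max_cost a (Sn n) (u n) - max_cost a S v) - 0) < e"
    proof eventually_elim
      case (elim n)
      have "\<bar>max_cost a (Sn n) (u n) - max_cost a (Sn n) v\<bar> \<le> e / 2"
        using stable[rule_format, OF Sn u(1) v_ball, of n n] elim(1) by simp
      with elim(2) show ?case unfolding real_norm_def by linarith
    qed
    then show "\<exists>N. \<forall>n\<ge>N. norm ((max_cost a (Sn n) (u n) - max_cost a S v) - 0) < e"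
      by (simp add: eventually_sequentially)
  qed
  have "(\<lambda>n. Lp_norm p T (\<lambda>t. u n t - v t) powr p) \<longlonglongrightarrow> 0"
    using lim p0 by (intro tendsto_zero_powrI[where b=p]) (auto simp: Lp_norm_nonneg)
  then have "(\<lambda>n. LINT t|M. norm (norm (u n t - v t) powr p)) \<longlonglongrightarrow> 0"
    by (simp add: Lp_norm_powr[OF p0])
  moreover have "integrable M (\<lambda>t. norm (u n t - v t) powr p)" for n
    using Lp_funD(2)[OF Lp_fun_diff[OF uL v p1]] .
  \<comment> \<open>Fatou needs a.e. convergence, which holds along a subsequence; the bounds
    converge along it to the same limit.\<close>
  ultimately obtain r where r: "strict_mono r" "AE t in M. (\<lambda>n. norm (u (r n) t - v t) powr p) \<longlonglongrightarrow> 0"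
    using tendsto_L1_AE_subseq[of M "\<lambda>n t. norm (u n t - v t) powr p"] by blast
  have ae: "AE t in M. (\<lambda>n. f t (u (r n) t) + c t) \<longlonglongrightarrow> f t (v t) + c t"
    using r(2) f_convex
  proof eventually_elim
    case (elim t)
    have "(\<lambda>n. (norm (u (r n) t - v t) powr p) powr (1 / p)) \<longlonglongrightarrow> 0"
      by (rule tendsto_zero_powrI[OF elim(1) tendsto_const[of "1 / p"]]) (use p0 in auto)
    then have "(\<lambda>n. u (r n) t) \<longlonglongrightarrow> v t"
      using p0 by (simp add: powr_powr tendsto_norm_zero_iff LIM_zero_iff)
    then have "(\<lambda>n. f t (u (r n) t)) \<longlonglongrightarrow> f t (v t)"
      using elim(2) by (intro isCont_tendsto_compose[of _ "f t"]) (auto simp: continuous_on_eq_continuous_at)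
    then show ?case by (intro tendsto_intros)
  qed
  have int: "integrable M (\<lambda>t. f t (u (r n) t) + c t)" for n using u(2) c_integrable by auto
  have nonneg: "AE t in M. 0 \<le> f t (u (r n) t) + c t" for n
    using f_lower[of "u (r n)"] by eventually_elim simp
  have bound: "(LINT t|M. f t (u (r n) t) + c t) \<le> B (r n) - max_cost a (Sn (r n)) (u (r n)) + integral\<^sup>L M c" for n
    using le[of "r n"] u(2) c_integrable by simp
  have "(\<lambda>n. B (r n)) \<longlonglongrightarrow> b" "(\<lambda>n. max_cost a (Sn (r n)) (u (r n))) \<longlonglongrightarrow> max_cost a S v"
    using LIMSEQ_subseq_LIMSEQ[OF B r(1)] LIMSEQ_subseq_LIMSEQ[OF end_lim r(1)] by (simp_all add: comp_def)
  then have blim: "(\<lambda>n. B (r n) - max_cost a (Sn (r n)) (u (r n)) + integral\<^sup>L M c) \<longlonglongrightarrow> b - max_cost a S v + integral\<^sup>L M c"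
    by (intro tendsto_intros)
  have meas: "(\<lambda>t. f t (v t) + c t) \<in> borel_measurable M"
    using f_compose_measurable[OF Lp_funD(1)[OF v]] c_integrable by auto
  note fatou = fatou_integrable[OF int nonneg bound blim meas ae]
  from Bochner_Integration.integrable_diff[OF fatou(1) c_integrable]
  show vi: "integrable M (\<lambda>t. f t (v t))" by simp
  show "finite_cost S v \<le> b" using fatou(2) vi c_integrable by simp
qed

lemma almost_minimizers_subseq:
  fixes u :: "nat \<Rightarrow> real \<Rightarrow> real^'k"
  assumes u: "\<And>n. u n \<in> Lp_ball p T R" "\<And>n. integrable M (\<lambda>t. f t (u n t))"
    and Sn: "\<And>n. Sn n \<subseteq> \<Theta>" "\<And>n. Sn n \<noteq> {}"
    and min: "\<And>n w. w \<in> Lp_ball p T R \<Longrightarrow> integrable M (\<lambda>t. f t (w t)) \<Longrightarrow>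
        finite_cost (Sn n) (u n) \<le> finite_cost (Sn n) w + \<epsilon> n"
    and \<epsilon>: "\<epsilon> \<longlonglongrightarrow> 0"
  shows "\<exists>v\<in>Lp_ball p T R. \<exists>r. strict_mono r \<and> (\<lambda>n. Lp_norm p T (\<lambda>t. u (r n) t - v t)) \<longlonglongrightarrow> 0"
proof (rule almost_minimizers_precompact[where A="\<lambda>n. max_cost a (Sn n)", OF u _ min \<epsilon>])
  fix e :: real assume "0 < e"
  then obtain d where d: "0 < d" and stable: "\<forall>S. S \<subseteq> \<Theta> \<longrightarrow> S \<noteq> {} \<longrightarrow> (\<forall>v\<in>Lp_ball p T R. \<forall>w\<in>Lp_ball p T R.
      (\<forall>t\<in>{0..T}. norm (integral {0..t} v - integral {0..t} w) \<le> d) \<longrightarrow> \<bar>max_cost a S v - max_cost a S w\<bar> \<le> e)"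
    using max_cost_stable[OF a_continuous p, of e R] by (elim exE conjE meta_impE)
  show "\<exists>d>0. \<forall>n. \<forall>v\<in>Lp_ball p T R. \<forall>w\<in>Lp_ball p T R.
      (\<forall>t\<in>{0..T}. norm (integral {0..t} v - integral {0..t} w) \<le> d) \<longrightarrow>
      \<bar>max_cost a (Sn n) v - max_cost a (Sn n) w\<bar> \<le> e"
    by (intro exI[of _ d] conjI d allI stable[THEN spec, THEN mp, THEN mp] Sn)
qed

text \<open>The direct method over controls of finite cost, of which \<open>w0\<close> is one. No
  ball is prescribed: coercivity places an infimizing sequence in some ball, and there it consists
  of almost minimizers of a single functional.\<close>

lemma minimizer_exists:
  assumes S: "S \<subseteq> \<Theta>" "S \<noteq> {}" "bounded S" and w0: "w0 \<in> Lp_fun p T" "integrable M (\<lambda>t. f t (w0 t))"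
  shows "\<exists>v. is_arg_min (cost S) (\<lambda>w. w \<in> Lp_fun p T) v \<and> integrable M (\<lambda>t. f t (v t))"
proof -
  define W where "W = {w \<in> Lp_fun p T. integrable M (\<lambda>t. f t (w t))}"
  have lower: "- integral\<^sup>L M c \<le> finite_cost S w" if "w \<in> W" for w
    using running_cost_lower[of w] max_cost_ge_0[of w, OF _ S(1,2)] that by (force simp: W_def)
  have bdd: "bdd_below (finite_cost S ` W)"
    using lower by (intro bdd_belowI[of _ "- integral\<^sup>L M c"]) auto
  have ne: "W \<noteq> {}" using w0 by (auto simp: W_def)
  define i where "i = (INF w\<in>W. finite_cost S w)"
  have i: "i \<le> finite_cost S w" if "w \<in> W" for w
    unfolding i_def by (rule cINF_lower[OF bdd that])
  have "- integral\<^sup>L M c \<le> i" unfolding i_def using lower by (intro cINF_greatest[OF ne])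
  then have i0: "0 \<le> i + 1 + integral\<^sup>L M c" by linarith
  have "\<exists>w\<in>W. finite_cost S w < i + inverse (real (Suc n))" for n
  proof -
    have "i < i + inverse (real (Suc n))" by simp
    then show ?thesis unfolding i_def cINF_less_iff[OF ne bdd] .
  qed
  then obtain w where w: "\<And>n. w n \<in> W" "\<And>n. finite_cost S (w n) < i + inverse (real (Suc n))" by metis
  \<comment> \<open>Along the sequence the cost is at most \<open>i + 1\<close> and the end-point
    part is nonnegative, so coercivity bounds the integral of the \<open>p\<close>-th power by
    \<open>(i + 1 + integral\<^sup>L M c) / C\<close>; \<open>R\<close> is its \<open>p\<close>-th
    root.\<close>
  define R where "R = ((i + 1 + integral\<^sup>L M c) / C) powr (1 / p)"
  have R: "R powr p = (i + 1 + integral\<^sup>L M c) / C" "0 \<le> R"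
    using i0 C p0 by (simp_all add: R_def powr_powr)
  have wi: "w n \<in> Lp_fun p T" "integrable M (\<lambda>t. f t (w n t))" for n using w(1)[of n] by (auto simp: W_def)
  have w_ball: "w n \<in> Lp_ball p T R" for n
  proof (rule Lp_ballI[OF wi(1) _ p0 R(2)])
    have "inverse (real (Suc n)) \<le> 1" by (simp add: field_simps)
    then have "running_cost (w n) + integral\<^sup>L M c \<le> i + 1 + integral\<^sup>L M c"
      using w(2)[of n] max_cost_ge_0[OF wi(1) S(1,2), of n] by linarith
    with Lp_norm_coercive[OF wi, of n] have "C * (LINT t|M. norm (w n t) powr p) \<le> i + 1 + integral\<^sup>L M c"
      by linarith
    then show "(LINT t|M. norm (w n t) powr p) \<le> R powr p"
      unfolding R using C by (simp add: field_simps)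
  qed
  obtain v r where v: "v \<in> Lp_ball p T R" "strict_mono r" "(\<lambda>n. Lp_norm p T (\<lambda>t. w (r n) t - v t)) \<longlonglongrightarrow> 0"
  proof -
    have "finite_cost S (w n) \<le> finite_cost S w' + inverse (real (Suc n))"
      if "w' \<in> Lp_ball p T R" "integrable M (\<lambda>t. f t (w' t))" for n w'
      using w(2)[of n] i[of w'] that Lp_ballD(1)[OF that(1) p0] by (simp add: W_def)
    from almost_minimizers_subseq[of w R "\<lambda>_. S", OF w_ball wi(2) S(1,2) this LIMSEQ_inverse_real_of_nat] that
    show thesis by blast
  qed
  have vL: "v \<in> Lp_fun p T" using Lp_ballD(1)[OF v(1) p0] .
  have le: "finite_cost S (w (r n)) \<le> i + inverse (real (Suc (r n)))" for n using w(2)[of "r n"] by simp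
  have i_lim: "(\<lambda>n. i + inverse (real (Suc (r n)))) \<longlonglongrightarrow> i + 0"
    using LIMSEQ_subseq_LIMSEQ[OF LIMSEQ_inverse_real_of_nat v(2)] by (intro tendsto_intros) (simp add: comp_def)
  \<comment> \<open>The limit lemma is used with a constant sequence of parameter sets.\<close>
  have haus: "hausdorff_distance S S = 0"
  proof -
    have "(INF y\<in>S. norm (x - y)) = 0" if "x \<in> S" for x
      using that by (intro cInf_eq_minimum) (auto intro!: image_eqI[of _ _ x])
    then show ?thesis using S(2) by (simp add: hausdorff_distance_def cong: SUP_cong)
  qed
  have "(\<lambda>_::nat. hausdorff_distance S S) \<longlonglongrightarrow> 0" unfolding haus by (rule tendsto_const)
  note limit = cost_limit_le[of "\<lambda>n. w (r n)" R v "\<lambda>_. S" S, OF w_ball wi(2) vL v(3) S(1,2) S(1,2) this le i_lim]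
  have vc: "integrable M (\<lambda>t. f t (v t))" "finite_cost S v \<le> i + 0" by (rule limit(2), rule limit(3))
  have "is_arg_min (cost S) (\<lambda>w. w \<in> Lp_fun p T) v"
    unfolding is_arg_min_def
  proof (intro conjI notI vL)
    assume "\<exists>y. y \<in> Lp_fun p T \<and> cost S y < cost S v"
    then obtain y where y: "y \<in> Lp_fun p T" "cost S y < cost S v" by blast
    then have "integrable M (\<lambda>t. f t (y t))" "finite_cost S y < finite_cost S v"
      unfolding cost_eq[OF y(1) S(1,2)] cost_eq[OF vL S(1,2)] using vc(1) by (auto split: if_splits)
    then show False using i[of y] vc(2) y(1) by (simp add: W_def)
  qed
  with vc(1) show ?thesis by blast
qed

end

theorem corollary3p5:
  fixes p T L C \<rho> :: real
    and \<Theta> :: "(real^'l) set"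
    and F0 :: "real^'d \<Rightarrow> real^'l \<Rightarrow> real^'d"
    and F :: "'k::finite \<Rightarrow> real^'d \<Rightarrow> real^'l \<Rightarrow> real^'d"
    and x0 :: "real^'l \<Rightarrow> real^'d"
    and a :: "real^'d \<Rightarrow> real^'l \<Rightarrow> real"
    and f :: "real \<Rightarrow> real^'k \<Rightarrow> real"
    and c c' :: "real \<Rightarrow> real"
    and u' :: "real^'k"
    and \<Theta>s :: "enat \<Rightarrow> (real^'l) set"
    and J :: "enat \<Rightarrow> (real \<Rightarrow> real^'k) \<Rightarrow> ereal"
    and \<X> :: "(real \<Rightarrow> real^'k) set"
    and u :: "nat \<Rightarrow> real \<Rightarrow> real^'k"
  defines "J \<equiv> \<lambda>N. ensemble_cost T F0 F x0 a f (\<Theta>s N)"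
    and "\<X> \<equiv> {v \<in> Lp_fun p T. Lp_norm p T v \<le> \<rho>}"
  assumes "1 < p" and "0 < T" and "compact \<Theta>"
    and "0 < L"
    and F0_lipschitz: "\<And>x1 x2 \<theta>1 \<theta>2. \<theta>1 \<in> \<Theta> \<Longrightarrow> \<theta>2 \<in> \<Theta> \<Longrightarrow>
      norm (F0 x1 \<theta>1 - F0 x2 \<theta>2) \<le> L * (norm (x1 - x2) + norm (x1 + x2) * norm (\<theta>1 - \<theta>2))"
    and F_lipschitz: "\<And>i x1 x2 \<theta>1 \<theta>2. \<theta>1 \<in> \<Theta> \<Longrightarrow> \<theta>2 \<in> \<Theta> \<Longrightarrow>
      norm (F i x1 \<theta>1 - F i x2 \<theta>2) \<le> L * (norm (x1 - x2) + norm (x1 + x2) * norm (\<theta>1 - \<theta>2))"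
    and "continuous_on \<Theta> x0"
    and a_continuous: "continuous_on (UNIV \<times> \<Theta>) (\<lambda>(x, \<theta>). a x \<theta>)"
    and a_nonneg: "\<And>x \<theta>. \<theta> \<in> \<Theta> \<Longrightarrow> 0 \<le> a x \<theta>"
    and f_measurable: "\<And>v. (\<lambda>t. f t v) \<in> borel_measurable (lebesgue_on {0..T})"
    and f_convex: "AE t in lebesgue_on {0..T}. continuous_on UNIV (f t) \<and> convex_on UNIV (f t)"
    and "integrable (lebesgue_on {0..T}) c" and "\<And>t. t \<in> {0..T} \<Longrightarrow> 0 \<le> c t"
    and "0 < C"
    and f_coercive: "AE t in lebesgue_on {0..T}. \<forall>v. f t v \<ge> C * norm v powr p - c t"
    and "integrable (lebesgue_on {0..T}) c'" and "\<And>t. t \<in> {0..T} \<Longrightarrow> 0 \<le> c' t"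
    and f_bounded: "AE t in lebesgue_on {0..T}. \<bar>f t u'\<bar> \<le> c' t"
    and f_strict: "AE t in lebesgue_on {0..T}. strictly_convex (f t)"
    and \<Theta>s: "\<And>N. 1 \<le> N \<Longrightarrow> \<Theta>s N \<subseteq> \<Theta> \<and> \<Theta>s N \<noteq> {} \<and> compact (\<Theta>s N)"
    and \<Theta>s_converge: "(\<lambda>N::nat. hausdorff_distance (\<Theta>s (enat N)) (\<Theta>s \<infinity>)) \<longlonglongrightarrow> 0"
    and "0 < \<rho>"
    and \<rho>: "\<And>N v. 1 \<le> N \<Longrightarrow> is_arg_min (J N) (\<lambda>w. w \<in> Lp_fun p T) v \<Longrightarrow> Lp_norm p T v \<le> \<rho>"
    and u_minimizer: "\<And>N::nat. 1 \<le> N \<Longrightarrow> is_arg_min (J (enat N)) (\<lambda>w. w \<in> \<X>) (u N)"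
  shows "compactin (Lp_topology p T) (Lp_topology p T closure_of (u ` {1..})) \<and>
    (\<forall>v r. v \<in> Lp_fun p T \<longrightarrow> strict_mono r \<longrightarrow> (\<forall>n. 1 \<le> r n) \<longrightarrow>
       (\<lambda>n::nat. Lp_norm p T (\<lambda>t. u (r n) t - v t)) \<longlonglongrightarrow> 0 \<longrightarrow>
       is_arg_min (J \<infinity>) (\<lambda>w. w \<in> \<X>) v)"
proof -
  interpret ensemble_problem T L \<Theta> F0 F x0 p C f c a
    using assms by unfold_locales auto
  have J: "J N = cost (\<Theta>s N)" for N by (simp add: J_def)
  have \<X>: "\<X> = Lp_ball p T \<rho>" by (simp add: \<X>_def Lp_ball_def)
  have S: "\<Theta>s N \<subseteq> \<Theta>" "\<Theta>s N \<noteq> {}" if "1 \<le> N" for N using \<Theta>s[OF that] by auto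
  have J_eq: "J N w = (if integrable M (\<lambda>t. f t (w t)) then ereal (finite_cost (\<Theta>s N) w) else \<infinity>)"
    if "w \<in> \<X>" "1 \<le> N" for w N
    unfolding J using that(1) Lp_ballD(1)[OF _ p0, of w T \<rho>] S[OF that(2)] by (intro cost_eq) (auto simp: \<X>)
  have one: "1 \<le> enat N" if "1 \<le> N" for N using that by (simp add: one_enat_def)
  \<comment> \<open>The constant \<open>u'\<close> starts the direct method for
    \<open>J \<infinity>\<close>, and the choice of \<open>\<rho>\<close> puts the resulting global
    minimizer into the ball. Finiteness depends on the running cost, which does not involve the
    index, so \<open>v0\<close> is a finite competitor for every \<open>J N\<close>.\<close>
  obtain v0 where v0: "v0 \<in> \<X>" "integrable M (\<lambda>t. f t (v0 t))"
  proof -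
    have const: "(\<lambda>_. u') \<in> Lp_fun p T" by (auto simp: Lp_fun_def)
    have "integrable M (\<lambda>t. f t u')"
      using f_bounded by (intro Bochner_Integration.integrable_bound[OF \<open>integrable M c'\<close> f_measurable])
        (auto elim!: eventually_mono)
    moreover have "1 \<le> (\<infinity>::enat)" by simp
    moreover have "bounded (\<Theta>s \<infinity>)" using \<Theta>s[of \<infinity>] by (simp add: compact_imp_bounded)
    ultimately obtain v where v: "is_arg_min (J \<infinity>) (\<lambda>w. w \<in> Lp_fun p T) v" "integrable M (\<lambda>t. f t (v t))"
      using minimizer_exists[OF S[of \<infinity>] _ const] unfolding J by blast
    have "v \<in> \<X>" using \<rho>[OF _ v(1)] v(1) by (simp add: \<X> Lp_ball_def is_arg_min_def)
    with v(2) show thesis by (rule that[rotated])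
  qed
  have u_ball: "u N \<in> Lp_ball p T \<rho>" if "1 \<le> N" for N
    using u_minimizer[OF that] by (simp add: is_arg_min_def \<X>)
  have u_le: "J (enat N) (u N) \<le> J (enat N) w" if "1 \<le> N" "w \<in> \<X>" for N w
    using u_minimizer[OF that(1)] that(2) by (auto simp: is_arg_min_def not_less)
  \<comment> \<open>The cost of \<open>u N\<close> is at most that of \<open>v0\<close>, hence
    finite.\<close>
  have u_int: "integrable M (\<lambda>t. f t (u N t))" if N: "1 \<le> N" for N
    using u_le[OF N v0(1)] J_eq[OF v0(1) one[OF N]] J_eq[OF _ one[OF N], of "u N"] v0(2) u_ball[OF N]
    by (auto simp: \<X> split: if_splits)
  have u_min: "finite_cost (\<Theta>s (enat N)) (u N) \<le> finite_cost (\<Theta>s (enat N)) w"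
    if N: "1 \<le> N" and w: "w \<in> Lp_ball p T \<rho>" "integrable M (\<lambda>t. f t (w t))" for N w
    using u_le[OF N, of w] J_eq[OF _ one[OF N], of "u N"] J_eq[OF _ one[OF N], of w] u_ball[OF N] u_int[OF N] w
    by (simp add: \<X>)
  have "compactin (Lp_topology p T) (Lp_topology p T closure_of (u ` {1..}))"
  proof (rule compactin_closure_Lp_topology)
    show "u ` {1..} \<subseteq> Lp_fun p T" using u_ball Lp_ballD(1)[OF _ p0] by auto
    fix s :: "nat \<Rightarrow> real \<Rightarrow> real^'k" assume "range s \<subseteq> u ` {1..}"
    \<comment> \<open>A sequence in the range may repeat or reorder the minimizers, so each term
      carries its own index, and with it its own parameter set, through the map
      \<open>N\<close>.\<close>
    then have "\<forall>n. \<exists>N\<ge>1. s n = u N" by force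
    then obtain N where N: "\<And>n. 1 \<le> N n" "\<And>n. s n = u (N n)" by metis
    have "\<exists>v\<in>Lp_ball p T \<rho>. \<exists>r. strict_mono r \<and> (\<lambda>n. Lp_norm p T (\<lambda>t. s (r n) t - v t)) \<longlonglongrightarrow> 0"
    proof (rule almost_minimizers_subseq[where Sn="\<lambda>n. \<Theta>s (enat (N n))" and \<epsilon>="\<lambda>_. 0"])
      show "finite_cost (\<Theta>s (enat (N n))) (s n) \<le> finite_cost (\<Theta>s (enat (N n))) w + 0"
        if "w \<in> Lp_ball p T \<rho>" "integrable M (\<lambda>t. f t (w t))" for n w
        using u_min[OF N(1) that] N(2) by simp
    qed (use u_ball u_int N S one in auto)
    then show "\<exists>v\<in>Lp_fun p T. \<exists>r. strict_mono r \<and> (\<lambda>n. Lp_norm p T (\<lambda>t. s (r n) t - v t)) \<longlonglongrightarrow> 0"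
      using Lp_ballD(1)[OF _ p0] by blast
  qed (use p in simp)
  moreover have "is_arg_min (J \<infinity>) (\<lambda>w. w \<in> \<X>) v"
    if v: "v \<in> Lp_fun p T" and r: "strict_mono r" "\<forall>n. 1 \<le> r n"
      and lim: "(\<lambda>n::nat. Lp_norm p T (\<lambda>t. u (r n) t - v t)) \<longlonglongrightarrow> 0" for v r
  proof -
    have inf: "1 \<le> (\<infinity>::enat)" by simp
    have haus: "(\<lambda>n. hausdorff_distance (\<Theta>s (enat (r n))) (\<Theta>s \<infinity>)) \<longlonglongrightarrow> 0"
      using LIMSEQ_subseq_LIMSEQ[OF \<Theta>s_converge r(1)] by (simp add: comp_def)
    \<comment> \<open>A fixed competitor \<open>w\<close> bounds each minimum by its own cost, and
      these costs converge to that of \<open>w\<close> for \<open>\<Theta>s \<infinity>\<close>.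
      They serve as the bounds \<open>B n\<close> of the limit lemma.\<close>
    have limit: "v \<in> Lp_ball p T \<rho>" "integrable M (\<lambda>t. f t (v t))" "finite_cost (\<Theta>s \<infinity>) v \<le> finite_cost (\<Theta>s \<infinity>) w"
      if w: "w \<in> Lp_ball p T \<rho>" "integrable M (\<lambda>t. f t (w t))" for w
    proof -
      have "(\<lambda>n. max_cost a (\<Theta>s (enat (r n))) w) \<longlonglongrightarrow> max_cost a (\<Theta>s \<infinity>) w"
        using S[OF one] S[OF inf] r(2) by (intro max_cost_tendsto[OF a_continuous p w(1)] haus) auto
      then have B: "(\<lambda>n. finite_cost (\<Theta>s (enat (r n))) w) \<longlonglongrightarrow> finite_cost (\<Theta>s \<infinity>) w"
        by (intro tendsto_intros)
      have rn: "1 \<le> r n" for n using r(2) by simp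
      note cost_limit_le[of "\<lambda>n. u (r n)" \<rho> v "\<lambda>n. \<Theta>s (enat (r n))" "\<Theta>s \<infinity>",
          OF u_ball[OF rn] u_int[OF rn] v lim S[OF one[OF rn]] S[OF inf] haus u_min[OF rn w] B]
      then show "v \<in> Lp_ball p T \<rho>" "integrable M (\<lambda>t. f t (v t))" "finite_cost (\<Theta>s \<infinity>) v \<le> finite_cost (\<Theta>s \<infinity>) w"
        by auto
    qed
    \<comment> \<open>The first two conclusions do not mention the competitor; \<open>v0\<close>
      guarantees that there is one.\<close>
    have vX: "v \<in> \<X>" and vi: "integrable M (\<lambda>t. f t (v t))"
      using limit(1,2)[of v0] v0 by (auto simp: \<X>)
    have "\<not> J \<infinity> w < J \<infinity> v" if w: "w \<in> \<X>" for w
      using J_eq[OF w inf] J_eq[OF vX inf] limit(3)[of w] w vi by (auto simp: \<X> not_less)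
    with vX show ?thesis by (auto simp: is_arg_min_def)
  qed
  ultimately show ?thesis by blast
qed

end
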